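(* Let $\mathcal D_H$ be a left $H$-category, $M$ a right-left SAYD module over $H$ and $r\geq1$. The morphisms of Hochschild complexes $$C_\bullet({inc}_1,M)^{hoc}:C_\bullet(\mathcal{D}_H,M)^{hoc} \longrightarrow C_\bullet(\mathcal{D}_H \otimes M_r(k),M)^{hoc},\qquad C_\bullet(tr^M)^{hoc}:C_\bullet(\mathcal{D}_H \otimes M_r(k),M)^{hoc} \longrightarrow C_\bullet(\mathcal{D}_H,M)^{hoc}$$ are homotopy inverses of each other.
   Context: $k$ is a field of characteristic zero; $H$ is a Hopf algebra over $k$ with coproduct $\Delta(h)=h_1\otimes h_2$, counit $\varepsilon$, bijective antipode $S$. A left $H$-category is a small $k$-linear category $\mathcal D_H$ with each $Hom_{\mathcal D_H}(X,Y)$ a left $H$-module, $h(id_X)=\varepsilon(h)id_X$, $h(gf)=(h_1g)(h_2f)$. A right-left SAYD module is a right $H$-module and left $H$-comodule $M$, $m\mapsto m_{(-1)}\otimes m_{(0)}$, with $(mh)_{(-1)}\otimes(mh)_{(0)}=S(h_3)m_{(-1)}h_1\otimes m_{(0)}h_2$ and $m_{(0)}m_{(-1)}=m$. $\mathcal D_H\otimes M_r(k)$ is the left $H$-category with the objects of $\mathcal D_H$, $Hom_{\mathcal D_H\otimes M_r(k)}(X,Y)=Hom_{\mathcal D_H}(X,Y)\otimes M_r(k)$, componentwise composition, and $h(f\otimes B)=hf\otimes B$. $CN_n(\mathcal D_H)=\bigoplus_{(X_0,\ldots,X_n)}Hom_{\mathcal D_H}(X_1,X_0)\otimes Hom_{\mathcal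 D_H}(X_2,X_1)\otimes\ldots\otimes Hom_{\mathcal D_H}(X_0,X_n)$. $C_n(\mathcal D_H,M)=M\otimes CN_n(\mathcal D_H)$ with face maps $d_i(m\otimes f^0\otimes\ldots\otimes f^n)=m\otimes f^0\otimes\ldots\otimes f^if^{i+1}\otimes\ldots\otimes f^n$ for $0\le i\le n-1$ and $d_n(m\otimes f^0\otimes\ldots\otimes f^n)=m_{(0)}\otimes(S^{-1}(m_{(-1)})f^n)f^0\otimes f^1\otimes\ldots\otimes f^{n-1}$. The Hochschild complex $C_\bullet(\mathcal D_H,M)^{hoc}$ is $(C_\bullet(\mathcal D_H,M),b=\sum_{i=0}^n(-1)^id_i)$; similarly for $\mathcal D_H\otimes M_r(k)$. $C_\bullet(inc_1,M)^{hoc}$ is given by $m\otimes f^0\otimes\ldots\otimes f^n\mapsto m\otimes(f^0\otimes E_{11})\otimes\ldots\otimes(f^n\otimes E_{11})$, with $E_{11}\in M_r(k)$ the elementary matrix. $C_\bullet(tr^M)^{hoc}$ is given by $m\otimes(f^0\otimes B^0)\otimes\ldots\otimes(f^n\otimes B^n)\mapsto(m\otimes f^0\otimes\ldots\otimes f^n)\,\mathrm{trace}(B^0\cdots B^n)$. *)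

theory Defs
  imports
    "Jordan_Normal_Form.VS_Connect"
    "HOL-Algebra.AbelCoset"
    "HOL-Library.Poly_Mapping"
begin

section \<open>Tensor products of vector spaces\<close>

text \<open>
  The ground field is a type \<open>'k\<close> of class \<^class>\<open>field\<close>; a \<open>'k\<close>-vector space is a
  \<^typ>\<open>('k, 'v) module\<close> record \<open>V\<close> with \<open>vectorspace class_ring V\<close>. If \<open>V\<close> is only used as a
  vector space, its fields \<^const>\<open>mult\<close> and \<^const>\<open>one\<close> are irrelevant.
\<close>

definition free_space :: "'x set \<Rightarrow> ('k::field, 'x \<Rightarrow>\<^sub>0 'k) module" where
  "free_space X =
    \<lparr>carrier = {p. Poly_Mapping.keys p \<subseteq> X}, mult = undefined, one = undefined,
     zero = 0, add = (+), smult = (\<lambda>c. Poly_Mapping.map ((*) c))\<rparr>"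

text \<open>The term \<open>N\<close> in the scalar multiplication is needed for \<open>c = 0\<close> only.\<close>

definition quotient_space :: "('k::field, 'v) module \<Rightarrow> 'v set \<Rightarrow> ('k, 'v set) module" where
  "quotient_space V N =
    \<lparr>carrier = A_RCOSETS V N, mult = undefined, one = undefined,
     zero = N, add = set_add V, smult = (\<lambda>c A. set_add V N ((\<lambda>v. c \<odot>\<^bsub>V\<^esub> v) ` A))\<rparr>"

definition relation_span :: "'x set \<Rightarrow> ('x \<Rightarrow>\<^sub>0 'k::field) set \<Rightarrow> ('x \<Rightarrow>\<^sub>0 'k) set" where
  "relation_span X R = LinearCombinations.module.span class_ring (free_space X) R"

definition presented_space ::
  "'x set \<Rightarrow> ('x \<Rightarrow>\<^sub>0 'k::field) set \<Rightarrow> ('k, ('x \<Rightarrow>\<^sub>0 'k) set) module" where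
  "presented_space X R = quotient_space (free_space X) (relation_span X R)"

definition generator :: "'x set \<Rightarrow> ('x \<Rightarrow>\<^sub>0 'k::field) set \<Rightarrow> 'x \<Rightarrow> ('x \<Rightarrow>\<^sub>0 'k) set" where
  "generator X R x = a_r_coset (free_space X) (relation_span X R) (Poly_Mapping.single x 1)"

text \<open>
  For \<open>\<phi>\<close> compatible with the relations, \<open>lin_ext W \<phi>\<close> is the linear map from a presented space to
  \<open>W\<close> with value \<open>\<phi> x\<close> at the generator of \<open>x\<close>; it is computed on a chosen representative.
  It also serves as Sweedler notation: \<open>lin_ext W (\<lambda>(x, y). \<phi> x y) (\<Delta> h)\<close> is
  \<open>\<phi> h\<^sub>1 h\<^sub>2\<close> with summation understood.
\<close>

definition lin_ext ::
  "('k::field, 'w) module \<Rightarrow> ('x \<Rightarrow> 'w) \<Rightarrow> ('x \<Rightarrow>\<^sub>0 'k) set \<Rightarrow> 'w" where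
  "lin_ext W \<phi> A =
    (let p = (SOME p. p \<in> A)
     in finsum W (\<lambda>x. Poly_Mapping.lookup p x \<odot>\<^bsub>W\<^esub> \<phi> x) (Poly_Mapping.keys p))"

definition tensor_relations ::
  "('k::field, 'v) module \<Rightarrow> ('k, 'w) module \<Rightarrow> ('v \<times> 'w \<Rightarrow>\<^sub>0 'k) set" where
  "tensor_relations V W =
     {Poly_Mapping.single (v \<oplus>\<^bsub>V\<^esub> v', w) 1 - Poly_Mapping.single (v, w) 1
        - Poly_Mapping.single (v', w) 1 | v v' w.
        v \<in> carrier V \<and> v' \<in> carrier V \<and> w \<in> carrier W}
   \<union> {Poly_Mapping.single (v, w \<oplus>\<^bsub>W\<^esub> w') 1 - Poly_Mapping.single (v, w) 1
        - Poly_Mapping.single (v, w') 1 | v w w'.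
        v \<in> carrier V \<and> w \<in> carrier W \<and> w' \<in> carrier W}
   \<union> {Poly_Mapping.single (c \<odot>\<^bsub>V\<^esub> v, w) 1 - Poly_Mapping.single (v, w) c | c v w.
        v \<in> carrier V \<and> w \<in> carrier W}
   \<union> {Poly_Mapping.single (v, c \<odot>\<^bsub>W\<^esub> w) 1 - Poly_Mapping.single (v, w) c | c v w.
        v \<in> carrier V \<and> w \<in> carrier W}"

definition tensor ::
  "('k::field, 'v) module \<Rightarrow> ('k, 'w) module \<Rightarrow> ('k, ('v \<times> 'w \<Rightarrow>\<^sub>0 'k) set) module" where
  "tensor V W = presented_space (carrier V \<times> carrier W) (tensor_relations V W)"

definition tens ::
  "('k::field, 'v) module \<Rightarrow> ('k, 'w) module \<Rightarrow> 'v \<Rightarrow> 'w \<Rightarrow> ('v \<times> 'w \<Rightarrow>\<^sub>0 'k) set" where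
  "tens V W v w = generator (carrier V \<times> carrier W) (tensor_relations V W) (v, w)"

definition bilinear_map ::
  "('k::field, 'u) module \<Rightarrow> ('k, 'v) module \<Rightarrow> ('k, 'w) module \<Rightarrow> ('u \<Rightarrow> 'v \<Rightarrow> 'w) \<Rightarrow> bool" where
  "bilinear_map U V W \<phi> \<longleftrightarrow>
     (\<forall>u\<in>carrier U. linear_map class_ring V W (\<lambda>v. \<phi> u v)) \<and>
     (\<forall>v\<in>carrier V. linear_map class_ring U W (\<lambda>u. \<phi> u v))"


section \<open>Hopf algebras, \<open>H\<close>-categories and SAYD modules\<close>

locale hopf_algebra =
  fixes H :: "('k::field, 'h) module"
    and \<Delta> :: "'h \<Rightarrow> ('h \<times> 'h \<Rightarrow>\<^sub>0 'k) set"
    and \<epsilon> :: "'h \<Rightarrow> 'k"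
    and S :: "'h \<Rightarrow> 'h"
  assumes ring_H: "ring H"
    and vectorspace_H: "vectorspace class_ring H"
    and mult_bilinear: "bilinear_map H H H (mult H)"
    and coproduct_linear: "linear_map class_ring H (tensor H H) \<Delta>"
    and coassociative: "h \<in> carrier H \<Longrightarrow>
      lin_ext (tensor H (tensor H H)) (\<lambda>(x, y).
        lin_ext (tensor H (tensor H H)) (\<lambda>(x1, x2). tens H (tensor H H) x1 (tens H H x2 y)) (\<Delta> x))
        (\<Delta> h)
      = lin_ext (tensor H (tensor H H)) (\<lambda>(x, y). tens H (tensor H H) x (\<Delta> y)) (\<Delta> h)"
    and counit_add: "\<lbrakk>g \<in> carrier H; h \<in> carrier H\<rbrakk> \<Longrightarrow> \<epsilon> (g \<oplus>\<^bsub>H\<^esub> h) = \<epsilon> g + \<epsilon> h"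
    and counit_smult: "h \<in> carrier H \<Longrightarrow> \<epsilon> (c \<odot>\<^bsub>H\<^esub> h) = c * \<epsilon> h"
    and counit_left: "h \<in> carrier H \<Longrightarrow> lin_ext H (\<lambda>(x, y). \<epsilon> x \<odot>\<^bsub>H\<^esub> y) (\<Delta> h) = h"
    and counit_right: "h \<in> carrier H \<Longrightarrow> lin_ext H (\<lambda>(x, y). \<epsilon> y \<odot>\<^bsub>H\<^esub> x) (\<Delta> h) = h"
    and coproduct_mult: "\<lbrakk>g \<in> carrier H; h \<in> carrier H\<rbrakk> \<Longrightarrow>
      \<Delta> (g \<otimes>\<^bsub>H\<^esub> h) =
        lin_ext (tensor H H) (\<lambda>(g1, g2).
          lin_ext (tensor H H) (\<lambda>(h1, h2). tens H H (g1 \<otimes>\<^bsub>H\<^esub> h1) (g2 \<otimes>\<^bsub>H\<^esub> h2)) (\<Delta> h)) (\<Delta> g)"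
    and coproduct_one: "\<Delta> \<one>\<^bsub>H\<^esub> = tens H H \<one>\<^bsub>H\<^esub> \<one>\<^bsub>H\<^esub>"
    and counit_mult: "\<lbrakk>g \<in> carrier H; h \<in> carrier H\<rbrakk> \<Longrightarrow> \<epsilon> (g \<otimes>\<^bsub>H\<^esub> h) = \<epsilon> g * \<epsilon> h"
    and counit_one: "\<epsilon> \<one>\<^bsub>H\<^esub> = 1"
    and antipode_linear: "linear_map class_ring H H S"
    and antipode_left: "h \<in> carrier H \<Longrightarrow>
      lin_ext H (\<lambda>(x, y). S x \<otimes>\<^bsub>H\<^esub> y) (\<Delta> h) = \<epsilon> h \<odot>\<^bsub>H\<^esub> \<one>\<^bsub>H\<^esub>"
    and antipode_right: "h \<in> carrier H \<Longrightarrow>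
      lin_ext H (\<lambda>(x, y). x \<otimes>\<^bsub>H\<^esub> S y) (\<Delta> h) = \<epsilon> h \<odot>\<^bsub>H\<^esub> \<one>\<^bsub>H\<^esub>"

text \<open>
  \<open>Hom D X Y\<close> is the space of morphisms from \<open>X\<close> to \<open>Y\<close>, and \<open>Comp D X Y Z g f\<close> is the composite
  \<open>gf\<close> of \<open>f : X \<rightarrow> Y\<close> and \<open>g : Y \<rightarrow> Z\<close>. Different morphism spaces may have common elements, so
  composition and action carry the objects as arguments.
\<close>

record ('o, 'k, 'f, 'h) H_cat =
  Obj :: "'o set"
  Hom :: "'o \<Rightarrow> 'o \<Rightarrow> ('k, 'f) module"
  Comp :: "'o \<Rightarrow> 'o \<Rightarrow> 'o \<Rightarrow> 'f \<Rightarrow> 'f \<Rightarrow> 'f"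
  Ident :: "'o \<Rightarrow> 'f"
  Act :: "'o \<Rightarrow> 'o \<Rightarrow> 'h \<Rightarrow> 'f \<Rightarrow> 'f"

locale left_H_category = hopf_algebra H \<Delta> \<epsilon> S
  for H :: "('k::field, 'h) module" and \<Delta> and \<epsilon> and S +
  fixes D :: "('o, 'k, 'f, 'h) H_cat"
  assumes vectorspace_Hom: "\<lbrakk>X \<in> Obj D; Y \<in> Obj D\<rbrakk> \<Longrightarrow> vectorspace class_ring (Hom D X Y)"
    and comp_bilinear: "\<lbrakk>X \<in> Obj D; Y \<in> Obj D; Z \<in> Obj D\<rbrakk> \<Longrightarrow>
      bilinear_map (Hom D Y Z) (Hom D X Y) (Hom D X Z) (Comp D X Y Z)"
    and ident_closed: "X \<in> Obj D \<Longrightarrow> Ident D X \<in> carrier (Hom D X X)"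
    and comp_ident_left: "\<lbrakk>X \<in> Obj D; Y \<in> Obj D; f \<in> carrier (Hom D X Y)\<rbrakk> \<Longrightarrow>
      Comp D X Y Y (Ident D Y) f = f"
    and comp_ident_right: "\<lbrakk>X \<in> Obj D; Y \<in> Obj D; f \<in> carrier (Hom D X Y)\<rbrakk> \<Longrightarrow>
      Comp D X X Y f (Ident D X) = f"
    and comp_assoc:
      "\<lbrakk>W \<in> Obj D; X \<in> Obj D; Y \<in> Obj D; Z \<in> Obj D;
        f \<in> carrier (Hom D W X); g \<in> carrier (Hom D X Y); h \<in> carrier (Hom D Y Z)\<rbrakk> \<Longrightarrow>
      Comp D W X Z (Comp D X Y Z h g) f = Comp D W Y Z h (Comp D W X Y g f)"
    and act_bilinear: "\<lbrakk>X \<in> Obj D; Y \<in> Obj D\<rbrakk> \<Longrightarrow>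
      bilinear_map H (Hom D X Y) (Hom D X Y) (Act D X Y)"
    and act_one: "\<lbrakk>X \<in> Obj D; Y \<in> Obj D; f \<in> carrier (Hom D X Y)\<rbrakk> \<Longrightarrow> Act D X Y \<one>\<^bsub>H\<^esub> f = f"
    and act_mult: "\<lbrakk>X \<in> Obj D; Y \<in> Obj D; f \<in> carrier (Hom D X Y); a \<in> carrier H; b \<in> carrier H\<rbrakk> \<Longrightarrow>
      Act D X Y (a \<otimes>\<^bsub>H\<^esub> b) f = Act D X Y a (Act D X Y b f)"
    and act_ident: "\<lbrakk>X \<in> Obj D; a \<in> carrier H\<rbrakk> \<Longrightarrow>
      Act D X X a (Ident D X) = \<epsilon> a \<odot>\<^bsub>Hom D X X\<^esub> Ident D X"
    and act_comp:
      "\<lbrakk>X \<in> Obj D; Y \<in> Obj D; Z \<in> Obj D; a \<in> carrier H;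
        f \<in> carrier (Hom D X Y); g \<in> carrier (Hom D Y Z)\<rbrakk> \<Longrightarrow>
      Act D X Z a (Comp D X Y Z g f) =
        lin_ext (Hom D X Z) (\<lambda>(a1, a2). Comp D X Y Z (Act D Y Z a1 g) (Act D X Y a2 f)) (\<Delta> a)"

locale sayd_module = hopf_algebra H \<Delta> \<epsilon> S
  for H :: "('k::field, 'h) module" and \<Delta> and \<epsilon> and S +
  fixes M :: "('k, 'm) module"
    and ract :: "'m \<Rightarrow> 'h \<Rightarrow> 'm"
    and \<rho> :: "'m \<Rightarrow> ('h \<times> 'm \<Rightarrow>\<^sub>0 'k) set"
  assumes vectorspace_M: "vectorspace class_ring M"
    and ract_bilinear: "bilinear_map M H M ract"
    and ract_one: "m \<in> carrier M \<Longrightarrow> ract m \<one>\<^bsub>H\<^esub> = m"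
    and ract_mult: "\<lbrakk>m \<in> carrier M; a \<in> carrier H; b \<in> carrier H\<rbrakk> \<Longrightarrow>
      ract m (a \<otimes>\<^bsub>H\<^esub> b) = ract (ract m a) b"
    and coaction_linear: "linear_map class_ring M (tensor H M) \<rho>"
    and coaction_coassociative: "m \<in> carrier M \<Longrightarrow>
      lin_ext (tensor H (tensor H M)) (\<lambda>(a, m0).
        lin_ext (tensor H (tensor H M)) (\<lambda>(a1, a2). tens H (tensor H M) a1 (tens H M a2 m0)) (\<Delta> a))
        (\<rho> m)
      = lin_ext (tensor H (tensor H M)) (\<lambda>(a, m0). tens H (tensor H M) a (\<rho> m0)) (\<rho> m)"
    and coaction_counit: "m \<in> carrier M \<Longrightarrow> lin_ext M (\<lambda>(a, m0). \<epsilon> a \<odot>\<^bsub>M\<^esub> m0) (\<rho> m) = m"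
    and anti_yetter_drinfeld: "\<lbrakk>m \<in> carrier M; h \<in> carrier H\<rbrakk> \<Longrightarrow>
      \<rho> (ract m h) =
        lin_ext (tensor H M) (\<lambda>(h1, y).
          lin_ext (tensor H M) (\<lambda>(h2, h3).
            lin_ext (tensor H M) (\<lambda>(a, m0).
              tens H M (S h3 \<otimes>\<^bsub>H\<^esub> a \<otimes>\<^bsub>H\<^esub> h1) (ract m0 h2)) (\<rho> m)) (\<Delta> y)) (\<Delta> h)"
    and stable: "m \<in> carrier M \<Longrightarrow> lin_ext M (\<lambda>(a, m0). ract m0 a) (\<rho> m) = m"


section \<open>The category \<open>D \<otimes> M\<^sub>r(k)\<close>\<close>

abbreviation matrix_space :: "nat \<Rightarrow> ('k::field, 'k mat) module" where
  "matrix_space r \<equiv> module_mat TYPE('k) r r"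

definition matrix_category ::
  "nat \<Rightarrow> ('o, 'k::field, 'f, 'h) H_cat \<Rightarrow> ('o, 'k, ('f \<times> 'k mat \<Rightarrow>\<^sub>0 'k) set, 'h) H_cat" where
  "matrix_category r D =
    (let T = (\<lambda>X Y. tensor (Hom D X Y) (matrix_space r));
         t = (\<lambda>X Y. tens (Hom D X Y) (matrix_space r))
     in \<lparr>Obj = Obj D, Hom = T,
         Comp = (\<lambda>X Y Z u v.
           lin_ext (T X Z) (\<lambda>(g, B).
             lin_ext (T X Z) (\<lambda>(f, C). t X Z (Comp D X Y Z g f) (B * C)) v) u),
         Ident = (\<lambda>X. t X X (Ident D X) (1\<^sub>m r)),
         Act = (\<lambda>X Y h. lin_ext (T X Y) (\<lambda>(f, B). t X Y (Act D X Y h f) B))\<rparr>)"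


section \<open>The Hochschild complex of an \<open>H\<close>-category with coefficients\<close>

text \<open>
  A generator of degree \<open>n\<close> is a pair of lists \<open>[X\<^sub>0, \<dots>, X\<^sub>n]\<close> and \<open>[f\<^sup>0, \<dots>, f\<^sup>n]\<close> with
  \<open>f\<^sup>i : X\<^sub>i\<^sub>+\<^sub>1 \<rightarrow> X\<^sub>i\<close> for \<open>i < n\<close> and \<open>f\<^sup>n : X\<^sub>0 \<rightarrow> X\<^sub>n\<close>. The relations are multilinearity in the
  morphisms for each fixed list of objects, so the space presented is the direct sum, over all
  lists of objects, of the tensor products of the morphism spaces.
\<close>

definition hom_at :: "('o, 'k, 'f, 'h) H_cat \<Rightarrow> 'o list \<Rightarrow> nat \<Rightarrow> ('k, 'f) module" where
  "hom_at D Xs i = Hom D (Xs ! (Suc i mod length Xs)) (Xs ! i)"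

definition CN_basis :: "('o, 'k, 'f, 'h) H_cat \<Rightarrow> nat \<Rightarrow> ('o list \<times> 'f list) set" where
  "CN_basis D n = {(Xs, fs). length Xs = Suc n \<and> length fs = Suc n \<and> set Xs \<subseteq> Obj D \<and>
     (\<forall>i\<le>n. fs ! i \<in> carrier (hom_at D Xs i))}"

definition CN_relations ::
  "('o, 'k::field, 'f, 'h) H_cat \<Rightarrow> nat \<Rightarrow> ('o list \<times> 'f list \<Rightarrow>\<^sub>0 'k) set" where
  "CN_relations D n =
     {Poly_Mapping.single (Xs, fs[i := f \<oplus>\<^bsub>hom_at D Xs i\<^esub> g]) 1
        - Poly_Mapping.single (Xs, fs[i := f]) 1 - Poly_Mapping.single (Xs, fs[i := g]) 1
        | Xs fs i f g. (Xs, fs) \<in> CN_basis D n \<and> i \<le> n \<and>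
          f \<in> carrier (hom_at D Xs i) \<and> g \<in> carrier (hom_at D Xs i)}
   \<union> {Poly_Mapping.single (Xs, fs[i := c \<odot>\<^bsub>hom_at D Xs i\<^esub> f]) 1
        - Poly_Mapping.single (Xs, fs[i := f]) c
        | Xs fs i c f. (Xs, fs) \<in> CN_basis D n \<and> i \<le> n \<and> f \<in> carrier (hom_at D Xs i)}"

definition CN ::
  "('o, 'k::field, 'f, 'h) H_cat \<Rightarrow> nat \<Rightarrow> ('k, ('o list \<times> 'f list \<Rightarrow>\<^sub>0 'k) set) module" where
  "CN D n = presented_space (CN_basis D n) (CN_relations D n)"

type_synonym ('m, 'o, 'f, 'k) chain = "('m \<times> ('o list \<times> 'f list \<Rightarrow>\<^sub>0 'k) set \<Rightarrow>\<^sub>0 'k) set"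

definition chain_space ::
  "('k::field, 'm) module \<Rightarrow> ('o, 'k, 'f, 'h) H_cat \<Rightarrow> nat \<Rightarrow>
    ('k, ('m, 'o, 'f, 'k) chain) module" where
  "chain_space M D n = tensor M (CN D n)"

definition pure_chain ::
  "('k::field, 'm) module \<Rightarrow> ('o, 'k, 'f, 'h) H_cat \<Rightarrow> nat \<Rightarrow>
    'm \<Rightarrow> 'o list \<times> 'f list \<Rightarrow> ('m, 'o, 'f, 'k) chain" where
  "pure_chain M D n m x =
     tens M (CN D n) m (generator (CN_basis D n) (CN_relations D n) x)"

text \<open>
  The linear map on \<^term>\<open>chain_space M D n\<close> whose value at \<open>m \<otimes> f\<^sup>0 \<otimes> \<dots> \<otimes> f\<^sup>n\<close> is
  \<open>\<psi> m [X\<^sub>0, \<dots>, X\<^sub>n] [f\<^sup>0, \<dots>, f\<^sup>n]\<close>.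
\<close>

definition chain_ext ::
  "('k::field, 'w) module \<Rightarrow> ('m \<Rightarrow> 'o list \<Rightarrow> 'f list \<Rightarrow> 'w) \<Rightarrow> ('m, 'o, 'f, 'k) chain \<Rightarrow> 'w" where
  "chain_ext W \<psi> = lin_ext W (\<lambda>(m, t). lin_ext W (\<lambda>(Xs, fs). \<psi> m Xs fs) t)"

definition inner_face ::
  "('k::field, 'm) module \<Rightarrow> ('o, 'k, 'f, 'h) H_cat \<Rightarrow> nat \<Rightarrow> nat \<Rightarrow>
    ('m, 'o, 'f, 'k) chain \<Rightarrow> ('m, 'o, 'f, 'k) chain" where
  "inner_face M D n i =
    chain_ext (chain_space M D (n - 1)) (\<lambda>m Xs fs.
      pure_chain M D (n - 1) m
        (take (Suc i) Xs @ drop (i + 2) Xs,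
         take i fs
           @ Comp D (Xs ! ((i + 2) mod Suc n)) (Xs ! Suc i) (Xs ! i) (fs ! i) (fs ! Suc i)
           # drop (i + 2) fs))"

definition last_face ::
  "('k::field, 'h) module \<Rightarrow> ('h \<Rightarrow> 'h) \<Rightarrow> ('k, 'm) module \<Rightarrow>
    ('m \<Rightarrow> ('h \<times> 'm \<Rightarrow>\<^sub>0 'k) set) \<Rightarrow> ('o, 'k, 'f, 'h) H_cat \<Rightarrow> nat \<Rightarrow>
    ('m, 'o, 'f, 'k) chain \<Rightarrow> ('m, 'o, 'f, 'k) chain" where
  "last_face H S M \<rho> D n =
    chain_ext (chain_space M D (n - 1)) (\<lambda>m Xs fs.
      lin_ext (chain_space M D (n - 1)) (\<lambda>(a, m0).
        pure_chain M D (n - 1) m0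
          (Xs ! n # butlast (tl Xs),
           Comp D (Xs ! 1) (Xs ! 0) (Xs ! n)
             (Act D (Xs ! 0) (Xs ! n) (inv_into (carrier H) S a) (fs ! n)) (fs ! 0)
           # butlast (tl fs)))
        (\<rho> m))"

definition face ::
  "('k::field, 'h) module \<Rightarrow> ('h \<Rightarrow> 'h) \<Rightarrow> ('k, 'm) module \<Rightarrow>
    ('m \<Rightarrow> ('h \<times> 'm \<Rightarrow>\<^sub>0 'k) set) \<Rightarrow> ('o, 'k, 'f, 'h) H_cat \<Rightarrow> nat \<Rightarrow> nat \<Rightarrow>
    ('m, 'o, 'f, 'k) chain \<Rightarrow> ('m, 'o, 'f, 'k) chain" where
  "face H S M \<rho> D n i = (if i < n then inner_face M D n i else last_face H S M \<rho> D n)"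

text \<open>Only \<open>n \<ge> 1\<close> is used: the complex is zero in negative degrees.\<close>

definition hochschild_boundary ::
  "('k::field, 'h) module \<Rightarrow> ('h \<Rightarrow> 'h) \<Rightarrow> ('k, 'm) module \<Rightarrow>
    ('m \<Rightarrow> ('h \<times> 'm \<Rightarrow>\<^sub>0 'k) set) \<Rightarrow> ('o, 'k, 'f, 'h) H_cat \<Rightarrow> nat \<Rightarrow>
    ('m, 'o, 'f, 'k) chain \<Rightarrow> ('m, 'o, 'f, 'k) chain" where
  "hochschild_boundary H S M \<rho> D n x =
    finsum (chain_space M D (n - 1))
      (\<lambda>i. ((- 1) ^ i) \<odot>\<^bsub>chain_space M D (n - 1)\<^esub> face H S M \<rho> D n i x) {0..n}"


section \<open>The maps induced by the inclusion and the trace\<close>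

text \<open>\<open>E\<^sub>1\<^sub>1\<close>; matrix indices start at \<open>0\<close>.\<close>

definition E11 :: "nat \<Rightarrow> 'k::field mat" where
  "E11 r = mat r r (\<lambda>(i, j). if i = 0 \<and> j = 0 then 1 else 0)"

definition inc_map ::
  "('k::field, 'm) module \<Rightarrow> ('o, 'k, 'f, 'h) H_cat \<Rightarrow> nat \<Rightarrow> nat \<Rightarrow>
    ('m, 'o, 'f, 'k) chain \<Rightarrow> ('m, 'o, ('f \<times> 'k mat \<Rightarrow>\<^sub>0 'k) set, 'k) chain" where
  "inc_map M D r n =
    chain_ext (chain_space M (matrix_category r D) n) (\<lambda>m Xs fs.
      pure_chain M (matrix_category r D) n m
        (Xs, map (\<lambda>i. tens (hom_at D Xs i) (matrix_space r) (fs ! i) (E11 r)) [0..<Suc n]))"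

definition mat_trace :: "'k::field mat \<Rightarrow> 'k" where
  "mat_trace A = (\<Sum>i<dim_row A. A $$ (i, i))"

text \<open>
  Multilinear extension: for multilinear \<open>\<phi>\<close>, the value of \<open>multi_ext W \<phi>\<close> at a list
  \<open>[f\<^sup>0 \<otimes> B\<^sup>0, \<dots>, f\<^sup>n \<otimes> B\<^sup>n]\<close> of pure tensors is \<open>\<phi> [(f\<^sup>0, B\<^sup>0), \<dots>, (f\<^sup>n, B\<^sup>n)]\<close>.
\<close>

primrec multi_ext ::
  "('k::field, 'w) module \<Rightarrow> ('x list \<Rightarrow> 'w) \<Rightarrow> ('x \<Rightarrow>\<^sub>0 'k) set list \<Rightarrow> 'w" where
  "multi_ext W \<phi> [] = \<phi> []"
| "multi_ext W \<phi> (t # ts) = lin_ext W (\<lambda>x. multi_ext W (\<lambda>xs. \<phi> (x # xs)) ts) t"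

definition trace_map ::
  "('k::field, 'm) module \<Rightarrow> ('o, 'k, 'f, 'h) H_cat \<Rightarrow> nat \<Rightarrow> nat \<Rightarrow>
    ('m, 'o, ('f \<times> 'k mat \<Rightarrow>\<^sub>0 'k) set, 'k) chain \<Rightarrow> ('m, 'o, 'f, 'k) chain" where
  "trace_map M D r n =
    chain_ext (chain_space M D n) (\<lambda>m Xs ts.
      multi_ext (chain_space M D n) (\<lambda>ps.
        mat_trace (foldr (*) (map snd ps) (1\<^sub>m r))
          \<odot>\<^bsub>chain_space M D n\<^esub> pure_chain M D n m (Xs, map fst ps)) ts)"


section \<open>Homotopy inverses\<close>

text \<open>Complexes are non-negatively graded, with \<open>d (Suc n)\<close> going from degree \<open>n + 1\<close> to \<open>n\<close>.\<close>

definition is_chain_map ::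
  "(nat \<Rightarrow> ('k::field, 'a) module) \<Rightarrow> (nat \<Rightarrow> 'a \<Rightarrow> 'a) \<Rightarrow>
   (nat \<Rightarrow> ('k, 'b) module) \<Rightarrow> (nat \<Rightarrow> 'b \<Rightarrow> 'b) \<Rightarrow> (nat \<Rightarrow> 'a \<Rightarrow> 'b) \<Rightarrow> bool" where
  "is_chain_map C d C' d' f \<longleftrightarrow>
     (\<forall>n. linear_map class_ring (C n) (C' n) (f n)) \<and>
     (\<forall>n. \<forall>x\<in>carrier (C (Suc n)). f n (d (Suc n) x) = d' (Suc n) (f (Suc n) x))"

definition chain_homotopic ::
  "(nat \<Rightarrow> ('k::field, 'a) module) \<Rightarrow> (nat \<Rightarrow> 'a \<Rightarrow> 'a) \<Rightarrow>
   (nat \<Rightarrow> ('k, 'b) module) \<Rightarrow> (nat \<Rightarrow> 'b \<Rightarrow> 'b) \<Rightarrow>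
   (nat \<Rightarrow> 'a \<Rightarrow> 'b) \<Rightarrow> (nat \<Rightarrow> 'a \<Rightarrow> 'b) \<Rightarrow> bool" where
  "chain_homotopic C d C' d' f g \<longleftrightarrow>
     (\<exists>h. (\<forall>n. linear_map class_ring (C n) (C' (Suc n)) (h n)) \<and>
       (\<forall>x\<in>carrier (C 0). f 0 x \<ominus>\<^bsub>C' 0\<^esub> g 0 x = d' (Suc 0) (h 0 x)) \<and>
       (\<forall>n. \<forall>x\<in>carrier (C (Suc n)).
          f (Suc n) x \<ominus>\<^bsub>C' (Suc n)\<^esub> g (Suc n) x =
            d' (Suc (Suc n)) (h (Suc n) x) \<oplus>\<^bsub>C' (Suc n)\<^esub> h n (d (Suc n) x)))"

definition homotopy_inverses ::
  "(nat \<Rightarrow> ('k::field, 'a) module) \<Rightarrow> (nat \<Rightarrow> 'a \<Rightarrow> 'a) \<Rightarrow>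
   (nat \<Rightarrow> ('k, 'b) module) \<Rightarrow> (nat \<Rightarrow> 'b \<Rightarrow> 'b) \<Rightarrow>
   (nat \<Rightarrow> 'a \<Rightarrow> 'b) \<Rightarrow> (nat \<Rightarrow> 'b \<Rightarrow> 'a) \<Rightarrow> bool" where
  "homotopy_inverses C d C' d' f g \<longleftrightarrow>
     is_chain_map C d C' d' f \<and> is_chain_map C' d' C d g \<and>
     chain_homotopic C d C d (\<lambda>n x. g n (f n x)) (\<lambda>n x. x) \<and>
     chain_homotopic C' d' C' d' (\<lambda>n x. f n (g n x)) (\<lambda>n x. x)"

end

theory Submission
  imports Defs
begin

text \<open>
  Since \<open>trace E\<^sub>1\<^sub>1 = 1\<close>, the composite of the inclusion with the trace is the identity. For the other
  composite one uses Loday's homotopy \<open>\<Sum>\<^sub>j (-1)\<^sup>j h\<^sub>j\<close> for Morita invariance, where \<open>h\<^sub>j\<close> sends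
  \<open>m \<otimes> f\<^sup>0B\<^sup>0 \<otimes> \<dots> \<otimes> f\<^sup>nB\<^sup>n\<close> to the sum over \<open>q\<close> of
  \<open>m \<otimes> f\<^sup>0(B\<^sup>0\<dots>B\<^sup>jE\<^sub>q\<^sub>1) \<otimes> f\<^sup>1E\<^sub>1\<^sub>1 \<otimes> \<dots> \<otimes> f\<^sup>jE\<^sub>1\<^sub>1 \<otimes> id E\<^sub>1\<^sub>q \<otimes> f\<^sup>j\<^sup>+\<^sup>1B\<^sup>j\<^sup>+\<^sup>1 \<otimes> \<dots> \<otimes> f\<^sup>nB\<^sup>n\<close>.
  The \<open>h\<^sub>j\<close> form a presimplicial homotopy with \<open>d\<^sub>0 h\<^sub>0 = id\<close>. The coefficients enter
  only into \<open>d\<^sub>n\<^sub>+\<^sub>1 h\<^sub>n\<close>, which is the inclusion after the trace because \<open>H\<close> acts on identity morphisms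
  by the counit and \<open>\<epsilon> \<circ> S = \<epsilon>\<close>.
\<close>

text \<open>The formulas of the overview are values on pure tensors, whereas \<open>lin_ext\<close>
  and \<open>multi_ext\<close> are total functions on cosets that compute with a chosen
  representative. So every formula is first shown to be linear in each slot, which gives a linear
  map with the prescribed values; conversely, linear maps are compared on lists of pairs (f^i, B^i)
  only. The presimplicial identities then become equalities of lists, summand by summand in q and in
  the coaction, with three exceptions that explain why h_j is a sum over q. For d_0 h_0 = id the sum
  of all E_qq has to be 1. For d_j h_j = d_j h_(j-1) a matrix B has to pass across the inserted
  identity: the sum of B E_q1 tensor E_1q equals the sum of E_q1 tensor E_1q B. In d_(n+1) h_n the
  product E_1q B E_q1 is B_qq E_11, and the sum over q produces the trace. The signs are settled
  once, for formal symbols in a free space, because chain spaces are records and class-based laws of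
  summation do not apply to them.\<close>

abbreviation vspace :: "('k::field, 'v) module \<Rightarrow> bool" where
  "vspace V \<equiv> vectorspace class_ring V"

abbreviation lin :: "('k::field, 'v) module \<Rightarrow> ('k, 'w) module \<Rightarrow> ('v \<Rightarrow> 'w) \<Rightarrow> bool" where
  "lin V W f \<equiv> linear_map class_ring V W f"

section \<open>Vector spaces and linear maps with scalars in a field type\<close>

lemma vspaceD:
  assumes "vspace W"
  shows "abelian_group W"
    and "\<And>a b w. w \<in> carrier W \<Longrightarrow> (a + b) \<odot>\<^bsub>W\<^esub> w = a \<odot>\<^bsub>W\<^esub> w \<oplus>\<^bsub>W\<^esub> b \<odot>\<^bsub>W\<^esub> w"
    and "\<And>a b w. w \<in> carrier W \<Longrightarrow> (a * b) \<odot>\<^bsub>W\<^esub> w = a \<odot>\<^bsub>W\<^esub> (b \<odot>\<^bsub>W\<^esub> w)"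
    and "\<And>a v w. v \<in> carrier W \<Longrightarrow> w \<in> carrier W \<Longrightarrow>
      a \<odot>\<^bsub>W\<^esub> (v \<oplus>\<^bsub>W\<^esub> w) = a \<odot>\<^bsub>W\<^esub> v \<oplus>\<^bsub>W\<^esub> a \<odot>\<^bsub>W\<^esub> w"
    and "\<And>a w. w \<in> carrier W \<Longrightarrow> a \<odot>\<^bsub>W\<^esub> w \<in> carrier W"
    and "\<And>w. w \<in> carrier W \<Longrightarrow> 1 \<odot>\<^bsub>W\<^esub> w = w"
    and "\<And>w. w \<in> carrier W \<Longrightarrow> 0 \<odot>\<^bsub>W\<^esub> w = \<zero>\<^bsub>W\<^esub>"
    and "\<And>a. a \<odot>\<^bsub>W\<^esub> \<zero>\<^bsub>W\<^esub> = \<zero>\<^bsub>W\<^esub>"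
    and "\<And>w. w \<in> carrier W \<Longrightarrow> (- 1) \<odot>\<^bsub>W\<^esub> w = \<ominus>\<^bsub>W\<^esub> w"
proof -
  interpret W: vectorspace class_ring W by fact
  show "abelian_group W" by unfold_locales
  show smult_add: "(a + b) \<odot>\<^bsub>W\<^esub> w = a \<odot>\<^bsub>W\<^esub> w \<oplus>\<^bsub>W\<^esub> b \<odot>\<^bsub>W\<^esub> w" if "w \<in> carrier W" for a b w
    using W.module.smult_l_distr[of a b w] that by simp
  show "(a * b) \<odot>\<^bsub>W\<^esub> w = a \<odot>\<^bsub>W\<^esub> (b \<odot>\<^bsub>W\<^esub> w)" if "w \<in> carrier W" for a b w
    using W.module.smult_assoc1[of a b w] that by simp
  show "a \<odot>\<^bsub>W\<^esub> (v \<oplus>\<^bsub>W\<^esub> w) = a \<odot>\<^bsub>W\<^esub> v \<oplus>\<^bsub>W\<^esub> a \<odot>\<^bsub>W\<^esub> w"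
    if "v \<in> carrier W" "w \<in> carrier W" for a v w
    using W.module.smult_r_distr[of a v w] that by simp
  show closed: "a \<odot>\<^bsub>W\<^esub> w \<in> carrier W" if "w \<in> carrier W" for a w
    using W.module.smult_closed[of a w] that by simp
  show one: "1 \<odot>\<^bsub>W\<^esub> w = w" if "w \<in> carrier W" for w
    using W.module.smult_one[of w] that by simp
  show zero: "0 \<odot>\<^bsub>W\<^esub> w = \<zero>\<^bsub>W\<^esub>" if "w \<in> carrier W" for w
    using W.module.smult_l_null[of w] that by simp
  show "a \<odot>\<^bsub>W\<^esub> \<zero>\<^bsub>W\<^esub> = \<zero>\<^bsub>W\<^esub>" for a
    using W.module.smult_r_null[of a] by simp
  show "(- 1) \<odot>\<^bsub>W\<^esub> w = \<ominus>\<^bsub>W\<^esub> w" if w: "w \<in> carrier W" for w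
  proof -
    have "(- 1) \<odot>\<^bsub>W\<^esub> w \<oplus>\<^bsub>W\<^esub> w = (- 1 + 1) \<odot>\<^bsub>W\<^esub> w"
      using smult_add[OF w, of "- 1" 1] one[OF w] by simp
    then show ?thesis using w closed zero[OF w] by (simp add: W.module.M.minus_equality)
  qed
qed

lemma vspaceI:
  fixes V :: "('k::field, 'v) module"
  assumes "abelian_group V"
    and "\<And>a v. v \<in> carrier V \<Longrightarrow> a \<odot>\<^bsub>V\<^esub> v \<in> carrier V"
    and "\<And>a b v. v \<in> carrier V \<Longrightarrow> (a + b) \<odot>\<^bsub>V\<^esub> v = a \<odot>\<^bsub>V\<^esub> v \<oplus>\<^bsub>V\<^esub> b \<odot>\<^bsub>V\<^esub> v"
    and "\<And>a v w. v \<in> carrier V \<Longrightarrow> w \<in> carrier V \<Longrightarrow>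
      a \<odot>\<^bsub>V\<^esub> (v \<oplus>\<^bsub>V\<^esub> w) = a \<odot>\<^bsub>V\<^esub> v \<oplus>\<^bsub>V\<^esub> a \<odot>\<^bsub>V\<^esub> w"
    and "\<And>a b v. v \<in> carrier V \<Longrightarrow> (a * b) \<odot>\<^bsub>V\<^esub> v = a \<odot>\<^bsub>V\<^esub> (b \<odot>\<^bsub>V\<^esub> v)"
    and "\<And>v. v \<in> carrier V \<Longrightarrow> 1 \<odot>\<^bsub>V\<^esub> v = v"
  shows "vspace V"
proof -
  have "cring (class_ring :: 'k ring)" using class_field field_def domain_def by blast
  moreover have "module_axioms class_ring V" using assms by (intro module_axioms.intro) simp_all
  ultimately show ?thesis
    by (intro vectorspace.intro Module.module.intro class_field assms)
qed

lemma linI: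
  assumes "vspace V" "vspace W"
    and "\<And>v. v \<in> carrier V \<Longrightarrow> f v \<in> carrier W"
    and "\<And>v v'. v \<in> carrier V \<Longrightarrow> v' \<in> carrier V \<Longrightarrow> f (v \<oplus>\<^bsub>V\<^esub> v') = f v \<oplus>\<^bsub>W\<^esub> f v'"
    and "\<And>c v. v \<in> carrier V \<Longrightarrow> f (c \<odot>\<^bsub>V\<^esub> v) = c \<odot>\<^bsub>W\<^esub> f v"
  shows "lin V W f"
  using assms
  by (auto simp: linear_map_def mod_hom_def mod_hom_axioms_def LinearCombinations.module_hom_def vectorspace_def)

lemma linD:
  assumes "lin V W f"
  shows "vspace V" "vspace W"
    and "\<And>v. v \<in> carrier V \<Longrightarrow> f v \<in> carrier W"
    and "\<And>v v'. v \<in> carrier V \<Longrightarrow> v' \<in> carrier V \<Longrightarrow> f (v \<oplus>\<^bsub>V\<^esub> v') = f v \<oplus>\<^bsub>W\<^esub> f v'"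
    and "\<And>c v. v \<in> carrier V \<Longrightarrow> f (c \<odot>\<^bsub>V\<^esub> v) = c \<odot>\<^bsub>W\<^esub> f v"
    and "f \<zero>\<^bsub>V\<^esub> = \<zero>\<^bsub>W\<^esub>"
proof -
  interpret linear_map class_ring V W f by fact
  show "vspace V" "vspace W" by unfold_locales
  show "\<And>v. v \<in> carrier V \<Longrightarrow> f v \<in> carrier W"
    "\<And>v v'. v \<in> carrier V \<Longrightarrow> v' \<in> carrier V \<Longrightarrow> f (v \<oplus>\<^bsub>V\<^esub> v') = f v \<oplus>\<^bsub>W\<^esub> f v'"
    "\<And>c v. v \<in> carrier V \<Longrightarrow> f (c \<odot>\<^bsub>V\<^esub> v) = c \<odot>\<^bsub>W\<^esub> f v"
    using f_hom by (auto simp: LinearCombinations.module_hom_def)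
  show "f \<zero>\<^bsub>V\<^esub> = \<zero>\<^bsub>W\<^esub>" by simp
qed

text \<open>Maps are total functions that are only controlled on carriers; this lets a formula valid
  on the carrier replace another one.\<close>

lemma lin_cong:
  assumes "lin V W f" "\<And>v. v \<in> carrier V \<Longrightarrow> f v = g v"
  shows "lin V W g"
proof -
  interpret linear_map class_ring V W f by fact
  show ?thesis
    by (rule linI) (use linD[OF assms(1)] in \<open>auto simp flip: assms(2)\<close>)
qed

lemma lin_comp:
  assumes "lin U V f" "lin V W g"
  shows "lin U W (\<lambda>x. g (f x))"
  by (rule linI) (use linD[OF assms(1)] linD[OF assms(2)] in auto)

lemma lin_id: "vspace V \<Longrightarrow> lin V V (\<lambda>x. x)"
  by (rule linI) auto

lemma lin_zero:
  assumes "vspace V" "vspace W" shows "lin V W (\<lambda>x. \<zero>\<^bsub>W\<^esub>)"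
proof -
  interpret W: vectorspace class_ring W by fact
  show ?thesis by (rule linI) (use assms in auto)
qed

lemma lin_add:
  assumes "lin V W f" "lin V W g"
  shows "lin V W (\<lambda>x. f x \<oplus>\<^bsub>W\<^esub> g x)"
proof -
  interpret linear_map class_ring V W f by fact
  note f = linD[OF assms(1)] and g = linD[OF assms(2)]
  show ?thesis
    by (rule linI) (use f g in \<open>auto simp: vspaceD(4)[OF f(2)] W.module.M.add.m_ac\<close>)
qed

lemma lin_smult:
  assumes "lin V W f"
  shows "lin V W (\<lambda>x. c \<odot>\<^bsub>W\<^esub> f x)"
proof -
  interpret linear_map class_ring V W f by fact
  note f = linD[OF assms(1)]
  show ?thesis
  proof (rule linI)
    fix d v assume v: "v \<in> carrier V"
    have "c \<odot>\<^bsub>W\<^esub> (d \<odot>\<^bsub>W\<^esub> f v) = (c * d) \<odot>\<^bsub>W\<^esub> f v"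
      using v f vspaceD(3)[OF f(2), of "f v" c d] by simp
    also have "\<dots> = d \<odot>\<^bsub>W\<^esub> (c \<odot>\<^bsub>W\<^esub> f v)"
      using v f vspaceD(3)[OF f(2), of "f v" d c] by (simp add: mult.commute)
    finally show "c \<odot>\<^bsub>W\<^esub> f (d \<odot>\<^bsub>V\<^esub> v) = d \<odot>\<^bsub>W\<^esub> (c \<odot>\<^bsub>W\<^esub> f v)" using v f by simp
  qed (use f in \<open>auto simp: vspaceD(4,5)[OF f(2)]\<close>)
qed

text \<open>A linear functional times a fixed vector. The scalars are a type and not a module
  record, so linearity of \<open>g\<close> enters through two equations; the trace and the counit
  are used in this form.\<close>

lemma lin_scale:
  fixes V :: "('k::field, 'v) module" and c :: "'a \<Rightarrow> 'k"
  assumes "vspace W" "w \<in> carrier W"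
    and "vspace V"
    and "\<And>u v. u \<in> carrier V \<Longrightarrow> v \<in> carrier V \<Longrightarrow> g (u \<oplus>\<^bsub>V\<^esub> v) = g u + g v"
    and "\<And>d v. v \<in> carrier V \<Longrightarrow> g (d \<odot>\<^bsub>V\<^esub> v) = d * g v"
  shows "lin V W (\<lambda>x. g x \<odot>\<^bsub>W\<^esub> w)"
proof -
  interpret W: vectorspace class_ring W by fact
  show ?thesis
    by (rule linI) (use assms in \<open>auto simp: vspaceD[OF assms(1)]\<close>)
qed

lemma lin_finsum_apply:
  assumes "lin V W f" "finite A" "g \<in> A \<rightarrow> carrier V"
  shows "f (finsum V g A) = finsum W (\<lambda>x. f (g x)) A"
  using assms(2,3)
proof (induction A rule: finite_induct)
  interpret linear_map class_ring V W f by fact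
  case empty show ?case by simp
next
  interpret linear_map class_ring V W f by fact
  case (insert x A)
  note f = linD[OF assms(1)]
  have 1: "g \<in> A \<rightarrow> carrier V" "g x \<in> carrier V" using insert.prems by auto
  have 2: "(\<lambda>x. f (g x)) \<in> A \<rightarrow> carrier W" "f (g x) \<in> carrier W" using 1 f by auto
  show ?case using insert 1 2 f(4)[of "g x" "finsum V g A"]
    by (simp add: V.module.M.finsum_insert W.module.M.finsum_insert)
qed

lemma lin_finsum:
  assumes "vspace V" "vspace W" "finite A" "\<And>a. a \<in> A \<Longrightarrow> lin V W (\<lambda>x. f a x)"
  shows "lin V W (\<lambda>x. finsum W (\<lambda>a. f a x) A)"
  using assms(3,4)
proof (induction A rule: finite_induct)
  interpret W: vectorspace class_ring W by fact
  case empty show ?case using lin_zero[OF assms(1,2)] by simp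
next
  interpret W: vectorspace class_ring W by fact
  case (insert a A)
  have fa: "lin V W (f a)" by (rule insert.prems) simp
  have fA: "lin V W (\<lambda>x. finsum W (\<lambda>a. f a x) A)"
    by (rule insert.IH) (rule insert.prems, simp)
  have "lin V W (\<lambda>x. f a x \<oplus>\<^bsub>W\<^esub> finsum W (\<lambda>a. f a x) A)"
    by (rule lin_add[OF fa fA])
  then show ?case
  proof (rule lin_cong)
    fix x assume "x \<in> carrier V"
    then have "(\<lambda>a. f a x) \<in> A \<rightarrow> carrier W" "f a x \<in> carrier W"
      using linD(3)[OF insert.prems, of _ x] by auto
    then show "f a x \<oplus>\<^bsub>W\<^esub> finsum W (\<lambda>a. f a x) A = finsum W (\<lambda>a. f a x) (insert a A)"
      using insert.hyps by (simp add: W.module.M.finsum_insert)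
  qed
qed

lemma finsum_smult:
  assumes "vspace W" "finite A" "g \<in> A \<rightarrow> carrier W"
  shows "c \<odot>\<^bsub>W\<^esub> finsum W g A = finsum W (\<lambda>x. c \<odot>\<^bsub>W\<^esub> g x) A"
  using lin_finsum_apply[OF lin_smult[OF lin_id[OF assms(1)]] assms(2,3)] .

section \<open>Free spaces\<close>

lemma free_space_simps [simp]:
  "carrier (free_space X) = {p. Poly_Mapping.keys p \<subseteq> X}"
  "add (free_space X) = (+)" "zero (free_space X) = 0"
  "smult (free_space X) = (\<lambda>c. Poly_Mapping.map ((*) c))"
  by (simp_all add: free_space_def)

lemma lookup_scale [simp]:
  "Poly_Mapping.lookup (Poly_Mapping.map ((*) (c::'k::field)) p) x = c * Poly_Mapping.lookup p x"
  by (simp add: Poly_Mapping.map.rep_eq when_def)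

lemma keys_scale: "Poly_Mapping.keys (Poly_Mapping.map ((*) (c::'k::field)) p) \<subseteq> Poly_Mapping.keys p"
  by (auto simp: in_keys_iff)

lemma vspace_free_space: "vspace (free_space X :: ('k::field, 'x \<Rightarrow>\<^sub>0 'k) module)"
proof -
  let ?F = "free_space X :: ('k::field, 'x \<Rightarrow>\<^sub>0 'k) module"
  have "abelian_group ?F"
  proof (rule abelian_groupI)
    fix x assume "x \<in> carrier ?F"
    then show "\<exists>y\<in>carrier ?F. y \<oplus>\<^bsub>?F\<^esub> x = \<zero>\<^bsub>?F\<^esub>"
      by (intro bexI[of _ "- x"]) (auto simp: in_keys_iff)
  qed (use Poly_Mapping.keys_add in \<open>fastforce simp: add_ac\<close>)+
  then show ?thesis
  proof (rule vspaceI)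
    fix a :: 'k and x assume "x \<in> carrier ?F"
    then show "a \<odot>\<^bsub>?F\<^esub> x \<in> carrier ?F" using keys_scale[of a x] by auto
  qed (auto intro!: poly_mapping_eqI simp: lookup_add algebra_simps)
qed

text \<open>The body of \<open>lin_ext\<close> with the representative as an argument: linearity is
  proved here, and the choice of a representative is dealt with separately.\<close>

definition free_ext :: "('k::field, 'w) module \<Rightarrow> ('x \<Rightarrow> 'w) \<Rightarrow> ('x \<Rightarrow>\<^sub>0 'k) \<Rightarrow> 'w" where
  "free_ext W \<phi> p = finsum W (\<lambda>x. Poly_Mapping.lookup p x \<odot>\<^bsub>W\<^esub> \<phi> x) (Poly_Mapping.keys p)"

lemma lin_ext_eq_free_ext: "lin_ext W \<phi> A = free_ext W \<phi> (SOME p. p \<in> A)"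
  by (simp add: lin_ext_def free_ext_def Let_def)

text \<open>Supports shrink when terms cancel, so sums and multiples can be compared only over a
  common finite set that contains all the supports.\<close>

lemma free_ext_superset:
  assumes "vspace W" "finite Y" "Poly_Mapping.keys p \<subseteq> Y" "\<phi> \<in> Y \<rightarrow> carrier W"
  shows "free_ext W \<phi> p = finsum W (\<lambda>x. Poly_Mapping.lookup p x \<odot>\<^bsub>W\<^esub> \<phi> x) Y"
proof -
  interpret W: vectorspace class_ring W by fact
  show ?thesis unfolding free_ext_def
    by (rule W.module.M.add.finprod_mono_neutral_cong_left)
      (use assms in \<open>auto simp: in_keys_iff vspaceD(5,7)[OF assms(1)] Pi_iff\<close>)
qed

lemma lin_free_ext:
  fixes W :: "('k::field, 'w) module" and \<phi> :: "'x \<Rightarrow> 'w"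
  assumes W: "vspace W" and \<phi>: "\<phi> \<in> X \<rightarrow> carrier W"
  shows "lin (free_space X) W (free_ext W \<phi>)"
proof -
  interpret W: vectorspace class_ring W by fact
  note sup = free_ext_superset[OF W]
  show ?thesis
  proof (rule linI[OF vspace_free_space W])
    fix p :: "'x \<Rightarrow>\<^sub>0 'k" assume "p \<in> carrier (free_space X)"
    then have p: "Poly_Mapping.keys p \<subseteq> X" by simp
    then show "free_ext W \<phi> p \<in> carrier W"
      unfolding free_ext_def using \<phi> by (intro W.module.M.finsum_closed) (auto intro!: vspaceD(5)[OF W])
    fix c
    \<comment> \<open>For c = 0 the support becomes empty, hence the sum is taken over the keys of
      \<open>p\<close>.\<close>
    have "free_ext W \<phi> (Poly_Mapping.map ((*) c) p) =
      finsum W (\<lambda>x. c \<odot>\<^bsub>W\<^esub> (Poly_Mapping.lookup p x \<odot>\<^bsub>W\<^esub> \<phi> x)) (Poly_Mapping.keys p)"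
      by (subst sup[of "Poly_Mapping.keys p"])
        (use p \<phi> keys_scale[of c p] in \<open>auto intro!: W.module.M.finsum_cong' simp: vspaceD(3,5)[OF W] Pi_iff subset_iff\<close>)
    also have "\<dots> = c \<odot>\<^bsub>W\<^esub> free_ext W \<phi> p" unfolding free_ext_def
      by (subst finsum_smult) (use W p \<phi> in \<open>auto intro!: vspaceD(5)[OF W]\<close>)
    finally show "free_ext W \<phi> (c \<odot>\<^bsub>free_space X\<^esub> p) = c \<odot>\<^bsub>W\<^esub> free_ext W \<phi> p" by simp
  next
    fix p q :: "'x \<Rightarrow>\<^sub>0 'k" assume "p \<in> carrier (free_space X)" "q \<in> carrier (free_space X)"
    then have pq: "Poly_Mapping.keys p \<subseteq> X" "Poly_Mapping.keys q \<subseteq> X" by auto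
    let ?Y = "Poly_Mapping.keys p \<union> Poly_Mapping.keys q"
    have Y: "finite ?Y" "\<phi> \<in> ?Y \<rightarrow> carrier W" "Poly_Mapping.keys (p + q) \<subseteq> ?Y"
      using \<phi> pq Poly_Mapping.keys_add[of p q] by auto
    have "free_ext W \<phi> (p + q) = finsum W (\<lambda>x. Poly_Mapping.lookup p x \<odot>\<^bsub>W\<^esub> \<phi> x
        \<oplus>\<^bsub>W\<^esub> Poly_Mapping.lookup q x \<odot>\<^bsub>W\<^esub> \<phi> x) ?Y"
      unfolding sup[OF Y(1,3,2)]
      by (rule W.module.M.finsum_cong')
        (use Y(2) in \<open>auto simp: lookup_add vspaceD(2,5)[OF W] Pi_iff\<close>)
    also have "\<dots> = finsum W (\<lambda>x. Poly_Mapping.lookup p x \<odot>\<^bsub>W\<^esub> \<phi> x) ?Y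
       \<oplus>\<^bsub>W\<^esub> finsum W (\<lambda>x. Poly_Mapping.lookup q x \<odot>\<^bsub>W\<^esub> \<phi> x) ?Y"
      by (rule W.module.M.finsum_addf) (use Y in \<open>auto intro!: vspaceD(5)[OF W]\<close>)
    also have "\<dots> = free_ext W \<phi> p \<oplus>\<^bsub>W\<^esub> free_ext W \<phi> q"
      using sup[OF Y(1) _ Y(2), of p] sup[OF Y(1) _ Y(2), of q] by simp
    finally show "free_ext W \<phi> (p \<oplus>\<^bsub>free_space X\<^esub> q) = free_ext W \<phi> p \<oplus>\<^bsub>W\<^esub> free_ext W \<phi> q" by simp
  qed
qed

lemma free_ext_single:
  assumes "vspace W" "\<phi> x \<in> carrier W"
  shows "free_ext W \<phi> (Poly_Mapping.single x c) = c \<odot>\<^bsub>W\<^esub> \<phi> x"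
proof -
  interpret W: vectorspace class_ring W by fact
  show ?thesis by (subst free_ext_superset[of _ "{x}"]) (use assms in \<open>auto simp: vspaceD[OF assms(1)]\<close>)
qed

lemma free_ext_cong:
  assumes "vspace W" "\<And>x. x \<in> Poly_Mapping.keys p \<Longrightarrow> \<phi> x = \<psi> x"
    "\<And>x. x \<in> Poly_Mapping.keys p \<Longrightarrow> \<psi> x \<in> carrier W"
  shows "free_ext W \<phi> p = free_ext W \<psi> p"
proof -
  interpret W: vectorspace class_ring W by fact
  show ?thesis unfolding free_ext_def
    by (rule W.module.M.finsum_cong') (use assms in auto)
qed

section \<open>Presented spaces\<close>

lemma quotient_space_simps [simp]:
  "carrier (quotient_space V N) = A_RCOSETS V N"
  "add (quotient_space V N) = set_add V" "zero (quotient_space V N) = N"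
  "smult (quotient_space V N) = (\<lambda>c A. set_add V N ((\<lambda>v. c \<odot>\<^bsub>V\<^esub> v) ` A))"
  by (simp_all add: quotient_space_def)

locale quotient =
  fixes V :: "('k::field, 'v) module" and N
  assumes V: "vspace V" and N: "submodule class_ring N V"
begin

sublocale V: vectorspace class_ring V by (rule V)

lemma N_subset: "N \<subseteq> carrier V" and N_zero: "\<zero>\<^bsub>V\<^esub> \<in> N"
  and N_add: "\<lbrakk>u \<in> N; v \<in> N\<rbrakk> \<Longrightarrow> u \<oplus>\<^bsub>V\<^esub> v \<in> N"
  and N_smult: "u \<in> N \<Longrightarrow> c \<odot>\<^bsub>V\<^esub> u \<in> N"
  using N by (auto simp: submodule_def)

sublocale abelian_subgroup N V
proof (rule abelian_subgroupI3)
  show "additive_subgroup N V"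
  proof (rule additive_subgroup.intro, rule V.module.M.a_group[THEN group.subgroupI])
    show "inv\<^bsub>add_monoid V\<^esub> a \<in> N" if "a \<in> N" for a
      using N_smult[OF that, of "- 1"] that N_subset vspaceD(9)[OF V, of a] by (auto simp: a_inv_def)
  qed (use N_subset N_zero N_add in auto)
qed (rule V.module.M.abelian_group_axioms)

abbreviation proj :: "'v \<Rightarrow> 'v set" where "proj v \<equiv> a_r_coset V N v"

lemma rcosets: "A_RCOSETS V N = proj ` carrier V"
  by (auto simp: A_RCOSETS_def RCOSETS_def a_r_coset_def)

lemma proj_zero: "proj \<zero>\<^bsub>V\<^esub> = N"
  by (rule V.module.M.a_coset_add_zero[OF N_subset])

text \<open>An element u + c (n' + v) of the left side differs from c v by u + c n', which lies in
  \<open>N\<close>. Conversely n + c v arises from u = n and n' = 0.\<close>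

lemma smult_proj:
  assumes v: "v \<in> carrier V"
  shows "set_add V N ((\<lambda>v. c \<odot>\<^bsub>V\<^esub> v) ` proj v) = proj (c \<odot>\<^bsub>V\<^esub> v)"
proof -
  have eq: "u \<oplus>\<^bsub>V\<^esub> c \<odot>\<^bsub>V\<^esub> (n' \<oplus>\<^bsub>V\<^esub> v) = (u \<oplus>\<^bsub>V\<^esub> c \<odot>\<^bsub>V\<^esub> n') \<oplus>\<^bsub>V\<^esub> c \<odot>\<^bsub>V\<^esub> v"
    if "u \<in> N" "n' \<in> N" for u n'
  proof -
    have "u \<in> carrier V" "n' \<in> carrier V" using that N_subset by auto
    then show ?thesis using v by (simp add: vspaceD(4,5)[OF V] V.module.M.a_assoc)
  qed
  have L: "set_add V N ((\<lambda>v. c \<odot>\<^bsub>V\<^esub> v) ` proj v)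
      = (\<lambda>(u, n'). u \<oplus>\<^bsub>V\<^esub> c \<odot>\<^bsub>V\<^esub> (n' \<oplus>\<^bsub>V\<^esub> v)) ` (N \<times> N)"
    and R: "proj (c \<odot>\<^bsub>V\<^esub> v) = (\<lambda>n. n \<oplus>\<^bsub>V\<^esub> c \<odot>\<^bsub>V\<^esub> v) ` N"
    by (force simp: set_add_def set_mult_def a_r_coset_def r_coset_def)+
  show ?thesis unfolding L R
  proof (intro equalityI image_subsetI)
    fix p assume "p \<in> N \<times> N"
    then obtain u n' where p: "p = (u, n')" "u \<in> N" "n' \<in> N" by (cases p) simp
    show "(case p of (u, n') \<Rightarrow> u \<oplus>\<^bsub>V\<^esub> c \<odot>\<^bsub>V\<^esub> (n' \<oplus>\<^bsub>V\<^esub> v)) \<in> (\<lambda>n. n \<oplus>\<^bsub>V\<^esub> c \<odot>\<^bsub>V\<^esub> v) ` N"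
      unfolding p(1) prod.case eq[OF p(2,3)]
      by (rule imageI) (rule N_add[OF p(2) N_smult[OF p(3)]])
  next
    fix n assume n: "n \<in> N"
    have "n \<oplus>\<^bsub>V\<^esub> c \<odot>\<^bsub>V\<^esub> v = (case (n, \<zero>\<^bsub>V\<^esub>) of (u, n') \<Rightarrow> u \<oplus>\<^bsub>V\<^esub> c \<odot>\<^bsub>V\<^esub> (n' \<oplus>\<^bsub>V\<^esub> v))"
      using v by simp
    then show "n \<oplus>\<^bsub>V\<^esub> c \<odot>\<^bsub>V\<^esub> v
      \<in> (\<lambda>(u, n'). u \<oplus>\<^bsub>V\<^esub> c \<odot>\<^bsub>V\<^esub> (n' \<oplus>\<^bsub>V\<^esub> v)) ` (N \<times> N)"
      by (rule image_eqI) (use n N_zero in simp)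
  qed
qed

lemma vspace_quotient: "vspace (quotient_space V N)"
proof (rule vspaceI)
  show "abelian_group (quotient_space V N)"
  proof (rule abelian_groupI)
    fix A assume "A \<in> carrier (quotient_space V N)"
    then obtain v where v: "v \<in> carrier V" "A = proj v" by (auto simp: rcosets)
    have "proj (\<ominus>\<^bsub>V\<^esub> v) <+>\<^bsub>V\<^esub> A = N"
      using v proj_zero by (simp add: a_rcos_sum V.module.M.l_neg)
    then show "\<exists>B\<in>carrier (quotient_space V N). B \<oplus>\<^bsub>quotient_space V N\<^esub> A = \<zero>\<^bsub>quotient_space V N\<^esub>"
      using v by (auto simp: rcosets)
    have "\<zero>\<^bsub>quotient_space V N\<^esub> = proj \<zero>\<^bsub>V\<^esub>" using proj_zero by simp
    then show "\<zero>\<^bsub>quotient_space V N\<^esub> \<oplus>\<^bsub>quotient_space V N\<^esub> A = A"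
      using v a_rcos_sum[of "\<zero>\<^bsub>V\<^esub>" v] by simp
  next
    have "N = proj \<zero>\<^bsub>V\<^esub>" using proj_zero by simp
    then show "\<zero>\<^bsub>quotient_space V N\<^esub> \<in> carrier (quotient_space V N)"
      by (auto simp: rcosets)
  qed (auto simp: rcosets a_rcos_sum V.module.M.a_ac)
qed (auto simp: rcosets a_rcos_sum smult_proj vspaceD(2-6)[OF V])

lemma lin_proj: "lin V (quotient_space V N) proj"
  by (rule linI) (auto simp: V vspace_quotient rcosets a_rcos_sum smult_proj)

text \<open>Since \<open>f\<close> vanishes on \<open>N\<close> it is constant on cosets, so a
  \<open>g\<close> that agrees with \<open>f\<close> at one unknown element of each coset is the
  induced map. This is the form in which \<open>SOME\<close> delivers
  \<open>lin_ext\<close>.\<close>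

lemma lin_quotient:
  assumes f: "lin V W f" and f0: "\<And>n. n \<in> N \<Longrightarrow> f n = \<zero>\<^bsub>W\<^esub>"
    and g: "\<And>A. A \<in> carrier (quotient_space V N) \<Longrightarrow> \<exists>v\<in>A. g A = f v"
  shows "v \<in> carrier V \<Longrightarrow> g (proj v) = f v" and "lin (quotient_space V N) W g"
proof -
  note f = linD[OF f]
  interpret W: vectorspace class_ring W by (rule f)
  show *: "g (proj v) = f v" if v: "v \<in> carrier V" for v
  proof -
    obtain u where u: "u \<in> proj v" "g (proj v) = f u" using g[of "proj v"] v by (auto simp: rcosets)
    then obtain n where n: "n \<in> N" "u = n \<oplus>\<^bsub>V\<^esub> v" by (auto simp: a_r_coset_def r_coset_def)
    then have "f u = f n \<oplus>\<^bsub>W\<^esub> f v" using v N_subset f(4) by auto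
    then show ?thesis using u n f0 f(3)[OF v] by simp
  qed
  show "lin (quotient_space V N) W g"
    by (rule linI) (auto simp: f vspace_quotient rcosets a_rcos_sum smult_proj * vspaceD(5)[OF V])
qed

end

text \<open>Places the relations in the free space on \<open>X\<close>, so that their span is a
  submodule and the presented space a genuine quotient.\<close>

definition relators :: "'x set \<Rightarrow> ('x \<Rightarrow>\<^sub>0 'k::field) set \<Rightarrow> bool" where
  "relators X R \<longleftrightarrow> (\<forall>p\<in>R. Poly_Mapping.keys p \<subseteq> X)"

lemma presented_quotient:
  assumes "relators X R"
  shows "quotient (free_space X) (relation_span X R)"
proof -
  interpret F: vectorspace class_ring "free_space X :: ('b, 'a \<Rightarrow>\<^sub>0 'b) module" by (rule vspace_free_space)
  show ?thesis
    unfolding relation_span_def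
    by (intro quotient.intro vspace_free_space F.module.span_is_submodule)
      (use assms in \<open>auto simp: relators_def\<close>)
qed

lemma vspace_presented: "relators X R \<Longrightarrow> vspace (presented_space X R)"
  unfolding presented_space_def by (intro quotient.vspace_quotient presented_quotient)

lemma generator_closed:
  assumes "relators X R" "x \<in> X"
  shows "generator X R x \<in> carrier (presented_space X R)"
  using linD(3)[OF quotient.lin_proj[OF presented_quotient[OF assms(1)]]] assms(2)
  by (simp add: generator_def presented_space_def)

text \<open>Universal property of a presentation: the kernel of the free extension is a submodule
  containing the relators, hence it contains their span.\<close>

lemma lin_ext_presented:
  fixes X :: "'x set" and R :: "('x \<Rightarrow>\<^sub>0 'k::field) set"
  assumes R: "relators X R" and W: "vspace W" and \<phi>: "\<And>x. x \<in> X \<Longrightarrow> \<phi> x \<in> carrier W"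
    and \<phi>R: "\<And>p. p \<in> R \<Longrightarrow> free_ext W \<phi> p = \<zero>\<^bsub>W\<^esub>"
  shows "lin (presented_space X R) W (lin_ext W \<phi>)"
    and "x \<in> X \<Longrightarrow> lin_ext W \<phi> (generator X R x) = \<phi> x"
proof -
  let ?F = "free_space X :: ('k, 'x \<Rightarrow>\<^sub>0 'k) module" and ?N = "relation_span X R"
  interpret quotient ?F ?N by (rule presented_quotient[OF R])
  have f: "lin ?F W (free_ext W \<phi>)" using \<phi> by (intro lin_free_ext W) auto
  interpret f: linear_map class_ring ?F W "free_ext W \<phi>" by fact
  have "?N \<subseteq> f.ker" unfolding relation_span_def
    by (intro V.module.span_is_subset f.ker_is_submodule)
      (use R \<phi>R in \<open>auto simp: f.ker_def relators_def\<close>)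
  then have N0: "free_ext W \<phi> n = \<zero>\<^bsub>W\<^esub>" if "n \<in> ?N" for n using that by (auto simp: f.ker_def)
  \<comment> \<open>A coset contains the element it is formed from, so it is nonempty and
    \<open>SOME\<close> returns one of its elements.\<close>
  have rep: "\<exists>v\<in>A. lin_ext W \<phi> A = free_ext W \<phi> v" if "A \<in> carrier (quotient_space ?F ?N)" for A
  proof -
    from that obtain v where "v \<in> carrier ?F" "A = proj v" by (auto simp: rcosets)
    then have "v \<in> A" using a_rcos_self by blast
    then show ?thesis unfolding lin_ext_eq_free_ext using someI[of "\<lambda>p. p \<in> A" v] by blast
  qed
  note q = lin_quotient[OF f N0 rep]
  show "lin (presented_space X R) W (lin_ext W \<phi>)" using q(2) by (simp add: presented_space_def)
  show "lin_ext W \<phi> (generator X R x) = \<phi> x" if "x \<in> X"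
    using that q(1)[of "Poly_Mapping.single x 1"] W \<phi>[OF that]
    by (simp add: generator_def free_ext_single vspaceD(6)[OF W])
qed

text \<open>Ensures that \<open>lin_ext\<close> evaluates its function on \<open>X\<close> only; all
  the rules for replacing or transforming that function rest on this.\<close>

lemma presented_rep:
  assumes "relators X R" "A \<in> carrier (presented_space X R)"
  shows "Poly_Mapping.keys (SOME p. p \<in> A) \<subseteq> X"
proof -
  interpret quotient "free_space X :: ('b, 'a \<Rightarrow>\<^sub>0 'b) module" "relation_span X R"
    by (rule presented_quotient[OF assms(1)])
  obtain v where v: "Poly_Mapping.keys v \<subseteq> X" "A = proj v" using assms(2) by (auto simp: presented_space_def rcosets)
  have "(SOME p. p \<in> A) \<in> A" using someI[of "\<lambda>p. p \<in> A" v] v a_rcos_self[of v] by auto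
  moreover have "A \<subseteq> carrier (free_space X)" using v V.module.M.a_r_coset_subset_G[OF N_subset, of v] by simp
  ultimately show ?thesis by auto
qed

text \<open>Both sides use the same representative of \<open>A\<close>, and its support lies in
  \<open>X\<close>.\<close>

lemma lin_ext_cong:
  assumes "relators X R" "A \<in> carrier (presented_space X R)" "vspace W"
    and "\<And>x. x \<in> X \<Longrightarrow> \<phi> x = \<psi> x" "\<And>x. x \<in> X \<Longrightarrow> \<psi> x \<in> carrier W"
  shows "lin_ext W \<phi> A = lin_ext W \<psi> A"
  unfolding lin_ext_eq_free_ext
  by (rule free_ext_cong) (use presented_rep[OF assms(1,2)] assms(3-) in auto)

lemma lin_ext_closed:
  assumes "relators X R" "A \<in> carrier (presented_space X R)" "vspace W"
    and "\<And>x. x \<in> X \<Longrightarrow> \<phi> x \<in> carrier W"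
  shows "lin_ext W \<phi> A \<in> carrier W"
  unfolding lin_ext_eq_free_ext
  by (rule linD(3)[OF lin_free_ext[of _ _ X]]) (use presented_rep[OF assms(1,2)] assms(3-) in auto)

text \<open>
  This holds for arbitrary \<open>\<phi>\<close>, compatible with the relations or not: the representative that
  \<^const>\<open>lin_ext\<close> chooses depends on the coset only.
\<close>

lemma lin_lin_ext:
  assumes "relators X R" "A \<in> carrier (presented_space X R)" "lin V W f"
    and "\<And>x. x \<in> X \<Longrightarrow> \<phi> x \<in> carrier V"
  shows "f (lin_ext V \<phi> A) = lin_ext W (\<lambda>x. f (\<phi> x)) A"
proof -
  note f = linD[OF assms(3)]
  interpret W: vectorspace class_ring W by (rule f)
  note rep = presented_rep[OF assms(1,2)]
  show ?thesis unfolding lin_ext_eq_free_ext free_ext_def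
    by (subst lin_finsum_apply[OF assms(3)])
      (use rep assms(4) in \<open>auto intro!: W.module.M.finsum_cong' vspaceD(5)[OF f(1)] vspaceD(5)[OF f(2)] f(3)
        simp: f(5) subset_iff\<close>)
qed

lemma lin_ext_add:
  assumes "relators X R" "A \<in> carrier (presented_space X R)" "vspace W"
    and "\<And>x. x \<in> X \<Longrightarrow> \<phi> x \<in> carrier W" "\<And>x. x \<in> X \<Longrightarrow> \<psi> x \<in> carrier W"
  shows "lin_ext W (\<lambda>x. \<phi> x \<oplus>\<^bsub>W\<^esub> \<psi> x) A = lin_ext W \<phi> A \<oplus>\<^bsub>W\<^esub> lin_ext W \<psi> A"
proof -
  interpret W: vectorspace class_ring W by fact
  note rep = presented_rep[OF assms(1,2)]
  let ?p = "SOME p. p \<in> A"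
  let ?c = "Poly_Mapping.lookup ?p" and ?K = "Poly_Mapping.keys ?p"
  have c: "x \<in> ?K \<Longrightarrow> \<phi> x \<in> carrier W" "x \<in> ?K \<Longrightarrow> \<psi> x \<in> carrier W" for x
    using rep assms(4,5) by auto
  have "finsum W (\<lambda>x. ?c x \<odot>\<^bsub>W\<^esub> (\<phi> x \<oplus>\<^bsub>W\<^esub> \<psi> x)) ?K
    = finsum W (\<lambda>x. ?c x \<odot>\<^bsub>W\<^esub> \<phi> x \<oplus>\<^bsub>W\<^esub> ?c x \<odot>\<^bsub>W\<^esub> \<psi> x) ?K"
    by (rule W.module.M.finsum_cong') (auto simp: vspaceD(4,5)[OF assms(3)] c)
  also have "\<dots> = finsum W (\<lambda>x. ?c x \<odot>\<^bsub>W\<^esub> \<phi> x) ?K \<oplus>\<^bsub>W\<^esub> finsum W (\<lambda>x. ?c x \<odot>\<^bsub>W\<^esub> \<psi> x) ?K"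
    by (rule W.module.M.finsum_addf) (auto simp: vspaceD(5)[OF assms(3)] c)
  finally show ?thesis unfolding lin_ext_eq_free_ext free_ext_def .
qed

lemma lin_ext_smult:
  assumes "relators X R" "A \<in> carrier (presented_space X R)" "vspace W"
    and "\<And>x. x \<in> X \<Longrightarrow> \<phi> x \<in> carrier W"
  shows "lin_ext W (\<lambda>x. c \<odot>\<^bsub>W\<^esub> \<phi> x) A = c \<odot>\<^bsub>W\<^esub> lin_ext W \<phi> A"
  using lin_lin_ext[OF assms(1,2) lin_smult[OF lin_id[OF assms(3)]], of \<phi> c] assms(4) by simp

lemma lin_ext_zero:
  assumes "vspace W" shows "lin_ext W (\<lambda>x. \<zero>\<^bsub>W\<^esub>) A = \<zero>\<^bsub>W\<^esub>"
proof -
  interpret W: vectorspace class_ring W by fact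
  show ?thesis unfolding lin_ext_eq_free_ext free_ext_def
    by (simp add: vspaceD(8)[OF assms])
qed

text \<open>Exchanges a finite sum with the summation that \<open>lin_ext\<close> stands for; it
  will move the sum over q past the coaction.\<close>

lemma lin_ext_finsum:
  assumes R: "relators X R" and A: "A \<in> carrier (presented_space X R)" and W: "vspace W" and "finite I"
    and "\<And>i x. \<lbrakk>i \<in> I; x \<in> X\<rbrakk> \<Longrightarrow> \<phi> i x \<in> carrier W"
  shows "lin_ext W (\<lambda>x. finsum W (\<lambda>i. \<phi> i x) I) A = finsum W (\<lambda>i. lin_ext W (\<phi> i) A) I"
  using assms(4,5)
proof (induction I rule: finite_induct)
  interpret W: vectorspace class_ring W by fact
  case empty show ?case by (simp add: lin_ext_zero[OF W])
next
  interpret W: vectorspace class_ring W by fact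
  case (insert i I)
  have "lin_ext W (\<lambda>x. finsum W (\<lambda>i. \<phi> i x) (insert i I)) A
    = lin_ext W (\<lambda>x. \<phi> i x \<oplus>\<^bsub>W\<^esub> finsum W (\<lambda>i. \<phi> i x) I) A"
    by (rule lin_ext_cong[OF R A W]) (use insert in \<open>auto intro!: W.module.M.finsum_insert\<close>)
  also have "\<dots> = lin_ext W (\<phi> i) A \<oplus>\<^bsub>W\<^esub> lin_ext W (\<lambda>x. finsum W (\<lambda>i. \<phi> i x) I) A"
    by (rule lin_ext_add[OF R A W]) (use insert in \<open>auto intro!: W.module.M.finsum_closed\<close>)
  also have "lin_ext W (\<lambda>x. finsum W (\<lambda>i. \<phi> i x) I) A = finsum W (\<lambda>i. lin_ext W (\<phi> i) A) I"
    using insert by simp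
  also have "lin_ext W (\<phi> i) A \<oplus>\<^bsub>W\<^esub> finsum W (\<lambda>i. lin_ext W (\<phi> i) A) I
    = finsum W (\<lambda>i. lin_ext W (\<phi> i) A) (insert i I)"
    by (rule W.module.M.finsum_insert[symmetric])
      (use insert in \<open>auto intro!: lin_ext_closed[OF R A W]\<close>)
  finally show ?case .
qed

text \<open>Every element is the coset of a finite combination of generators, so induction on the
  support, one key at a time, reduces equality to the generators.\<close>

lemma lin_presented_eqI:
  assumes R: "relators X R" and f: "lin (presented_space X R) W f" and g: "lin (presented_space X R) W g"
    and eq: "\<And>x. x \<in> X \<Longrightarrow> f (generator X R x) = g (generator X R x)"
    and A: "A \<in> carrier (presented_space X R)"
  shows "f A = g A"
proof -
  interpret quotient "free_space X :: ('b, 'a \<Rightarrow>\<^sub>0 'b) module" "relation_span X R"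
    by (rule presented_quotient[OF R])
  let ?F = "free_space X :: ('b, 'a \<Rightarrow>\<^sub>0 'b) module"
  note f' = linD[OF f] and g' = linD[OF g]
  note W = f'(2)
  interpret W: vectorspace class_ring W by (rule W)
  have proj: "lin ?F (presented_space X R) proj" using lin_proj by (simp add: presented_space_def)
  note fp = linD[OF lin_comp[OF proj f]] and gp = linD[OF lin_comp[OF proj g]]
  have main: "f (proj p) = g (proj p)" if "Poly_Mapping.keys p \<subseteq> X" for p :: "'a \<Rightarrow>\<^sub>0 'b"
    using finite_keys[of p] that
  proof (induction "Poly_Mapping.keys p" arbitrary: p rule: finite_induct)
    case empty
    have "Poly_Mapping.keys p = {}" using empty.hyps by (rule sym)
    then have "p = \<zero>\<^bsub>?F\<^esub>" by simp
    then show ?case using fp(6) gp(6) by simp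
  next
    case (insert x Y)
    let ?c = "Poly_Mapping.lookup p x"
    \<comment> \<open>Subtracting the whole coefficient at \<open>x\<close> removes \<open>x\<close>
      from the support and leaves the other coefficients alone.\<close>
    define q where "q = p - Poly_Mapping.single x ?c"
    have q: "Poly_Mapping.keys q = Y"
    proof (rule Set.set_eqI)
      fix y show "y \<in> Poly_Mapping.keys q \<longleftrightarrow> y \<in> Y"
        using insert.hyps(2,4) by (auto simp: q_def in_keys_iff lookup_minus lookup_single when_def set_eq_iff)
    qed
    have x: "x \<in> X" "Poly_Mapping.keys q \<subseteq> X" using insert q by auto
    have p: "p = ?c \<odot>\<^bsub>?F\<^esub> Poly_Mapping.single x 1 \<oplus>\<^bsub>?F\<^esub> q"
      by (rule poly_mapping_eqI) (simp add: q_def lookup_add lookup_minus lookup_single when_def)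
    have eqx: "f (proj (Poly_Mapping.single x 1)) = g (proj (Poly_Mapping.single x 1))"
      using eq[OF x(1)] by (simp add: generator_def)
    have c: "Poly_Mapping.single x (1::'b) \<in> carrier ?F" "q \<in> carrier ?F"
      "?c \<odot>\<^bsub>?F\<^esub> Poly_Mapping.single x 1 \<in> carrier ?F"
      using x keys_scale[of ?c "Poly_Mapping.single x 1"] by (auto simp: in_keys_iff lookup_single when_def split: if_splits)
    have "f (proj q) = g (proj q)" using insert.hyps(3)[of q] q x by simp
    then show ?case
      by (subst (1 2) p) (simp only: fp(4)[OF c(3,2)] gp(4)[OF c(3,2)] fp(5)[OF c(1)] gp(5)[OF c(1)] eqx)
  qed
  obtain p where "Poly_Mapping.keys p \<subseteq> X" "A = proj p" using A by (auto simp: presented_space_def rcosets)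
  then show ?thesis using main by simp
qed

lemma proj_single:
  fixes X :: "'x set" and R :: "('x \<Rightarrow>\<^sub>0 'k::field) set"
  assumes "relators X R" "x \<in> X"
  shows "a_r_coset (free_space X) (relation_span X R) (Poly_Mapping.single x c)
    = c \<odot>\<^bsub>presented_space X R\<^esub> generator X R x"
proof -
  note p = linD[OF quotient.lin_proj[OF presented_quotient[OF assms(1)]]]
  have "Poly_Mapping.single x c = c \<odot>\<^bsub>free_space X :: ('k, 'x \<Rightarrow>\<^sub>0 'k) module\<^esub> Poly_Mapping.single x 1"
    by (rule poly_mapping_eqI) (simp add: lookup_single when_def)
  then show ?thesis using p(5)[of "Poly_Mapping.single x 1" c] assms(2)
    by (simp add: generator_def presented_space_def)
qed

lemma proj_relator:
  fixes X :: "'x set" and R :: "('x \<Rightarrow>\<^sub>0 'k::field) set"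
  assumes "relators X R" "p \<in> R"
  shows "a_r_coset (free_space X) (relation_span X R) p = \<zero>\<^bsub>presented_space X R\<^esub>"
proof -
  interpret quotient "free_space X :: ('k, 'x \<Rightarrow>\<^sub>0 'k) module" "relation_span X R"
    by (rule presented_quotient[OF assms(1)])
  have "R \<subseteq> carrier (free_space X)" using assms(1) by (auto simp: relators_def)
  then have "R \<subseteq> relation_span X R" unfolding relation_span_def by (rule V.module.in_own_span)
  then have "p \<in> relation_span X R" using assms(2) by blast
  then show ?thesis
    by (simp add: presented_space_def a_rcos_const)
qed

text \<open>In the free space the symbol of \<open>a\<close> is the relator plus the symbols of
  \<open>b\<close> and \<open>c\<close>, and the relator is zero in the quotient.\<close>

lemma generator_add:
  fixes X :: "'x set" and R :: "('x \<Rightarrow>\<^sub>0 'k::field) set"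
  assumes R: "relators X R" and abc: "a \<in> X" "b \<in> X" "c \<in> X"
    and r: "Poly_Mapping.single a 1 - Poly_Mapping.single b 1 - Poly_Mapping.single c 1 \<in> R"
      (is "?r \<in> R")
  shows "generator X R a = generator X R b \<oplus>\<^bsub>presented_space X R\<^esub> generator X R c"
proof -
  let ?F = "free_space X :: ('k, 'x \<Rightarrow>\<^sub>0 'k) module"
  note p = linD[OF quotient.lin_proj[OF presented_quotient[OF R]]]
  have V: "vspace (presented_space X R)" by (rule vspace_presented[OF R])
  interpret V: vectorspace class_ring "presented_space X R" by (rule V)
  have r': "?r \<in> carrier ?F" using R r by (auto simp: relators_def)
  have "Poly_Mapping.single a 1 = ?r \<oplus>\<^bsub>?F\<^esub> (Poly_Mapping.single b 1 \<oplus>\<^bsub>?F\<^esub> Poly_Mapping.single c 1)"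
    by simp
  then have "generator X R a = a_r_coset ?F (relation_span X R)
    (?r \<oplus>\<^bsub>?F\<^esub> (Poly_Mapping.single b 1 \<oplus>\<^bsub>?F\<^esub> Poly_Mapping.single c 1))" by (simp add: generator_def)
  also have "\<dots> = \<zero>\<^bsub>presented_space X R\<^esub> \<oplus>\<^bsub>presented_space X R\<^esub>
      (generator X R b \<oplus>\<^bsub>presented_space X R\<^esub> generator X R c)"
  proof -
    have k: "Poly_Mapping.single b 1 \<in> carrier ?F" "Poly_Mapping.single c 1 \<in> carrier ?F"
      using abc by auto
    then have "Poly_Mapping.single b 1 \<oplus>\<^bsub>?F\<^esub> Poly_Mapping.single c 1 \<in> carrier ?F"
      using keys_add[of "Poly_Mapping.single b (1::'k)" "Poly_Mapping.single c 1"] by auto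
    from p(4)[OF r' this] show ?thesis
      unfolding p(4)[OF k] presented_space_def[symmetric] proj_relator[OF R r] generator_def .
  qed
  finally show ?thesis using generator_closed[OF R abc(2)] generator_closed[OF R abc(3)] by simp
qed

lemma generator_smult:
  fixes X :: "'x set" and R :: "('x \<Rightarrow>\<^sub>0 'k::field) set"
  assumes R: "relators X R" and ab: "a \<in> X" "b \<in> X"
    and r: "Poly_Mapping.single a 1 - Poly_Mapping.single b c \<in> R" (is "?r \<in> R")
  shows "generator X R a = c \<odot>\<^bsub>presented_space X R\<^esub> generator X R b"
proof -
  let ?F = "free_space X :: ('k, 'x \<Rightarrow>\<^sub>0 'k) module"
  note p = linD[OF quotient.lin_proj[OF presented_quotient[OF R]]]
  have V: "vspace (presented_space X R)" by (rule vspace_presented[OF R])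
  interpret V: vectorspace class_ring "presented_space X R" by (rule V)
  have r': "?r \<in> carrier ?F" using R r by (auto simp: relators_def)
  have "generator X R a = a_r_coset ?F (relation_span X R) (?r \<oplus>\<^bsub>?F\<^esub> Poly_Mapping.single b c)"
    by (simp add: generator_def)
  also have "\<dots> = \<zero>\<^bsub>presented_space X R\<^esub> \<oplus>\<^bsub>presented_space X R\<^esub> c \<odot>\<^bsub>presented_space X R\<^esub> generator X R b"
    using ab r' by (subst p(4)) (simp_all add: proj_single[OF R] proj_relator[OF R r] flip: presented_space_def)
  finally show ?thesis using generator_closed[OF R ab(2)] vspaceD(5)[OF V] by simp
qed

text \<open>Turns additivity of \<open>\<phi>\<close> at one triple into the condition that
  \<open>lin_ext_presented\<close> asks for. The free extension is considered on the free space over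
  \<open>a\<close>, \<open>b\<close>, \<open>c\<close>, where linearity needs just these three
  values.\<close>

lemma free_ext_add_relator:
  fixes W :: "('k::field, 'w) module" and \<phi> :: "'x \<Rightarrow> 'w"
  assumes W: "vspace W" and bc: "\<phi> b \<in> carrier W" "\<phi> c \<in> carrier W"
    and a: "\<phi> a = \<phi> b \<oplus>\<^bsub>W\<^esub> \<phi> c"
  shows "free_ext W \<phi> (Poly_Mapping.single a 1 - Poly_Mapping.single b 1 - Poly_Mapping.single c 1) = \<zero>\<^bsub>W\<^esub>"
proof -
  interpret W: vectorspace class_ring W by (rule W)
  have assms: "\<phi> a \<in> carrier W" "\<phi> b \<in> carrier W" "\<phi> c \<in> carrier W" "\<phi> a = \<phi> b \<oplus>\<^bsub>W\<^esub> \<phi> c"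
    using a bc by auto
  let ?F = "free_space {a, b, c} :: ('k, 'x \<Rightarrow>\<^sub>0 'k) module"
  let ?r = "Poly_Mapping.single a 1 - Poly_Mapping.single b 1 - Poly_Mapping.single c 1"
  have eq: "?r = Poly_Mapping.single a 1 \<oplus>\<^bsub>?F\<^esub> (Poly_Mapping.single b (-1) \<oplus>\<^bsub>?F\<^esub> Poly_Mapping.single c (-1))"
    by (rule poly_mapping_eqI) (simp add: lookup_add lookup_minus lookup_single when_def)
  have l: "lin ?F W (free_ext W \<phi>)" by (rule lin_free_ext) (use assms W in auto)
  have k: "Poly_Mapping.single b (-1) + Poly_Mapping.single c (-1) \<in> carrier ?F"
    using keys_add[of "Poly_Mapping.single b (-1::'k)" "Poly_Mapping.single c (-1)"] by auto
  have "free_ext W \<phi> ?r = \<phi> a \<oplus>\<^bsub>W\<^esub> ((-1) \<odot>\<^bsub>W\<^esub> \<phi> b \<oplus>\<^bsub>W\<^esub> (-1) \<odot>\<^bsub>W\<^esub> \<phi> c)"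
    unfolding eq using k linD(4)[OF l] assms
    by (simp add: free_ext_single[OF W] vspaceD(6)[OF W])
  also have "\<dots> = \<phi> b \<oplus>\<^bsub>W\<^esub> \<phi> c \<oplus>\<^bsub>W\<^esub> \<ominus>\<^bsub>W\<^esub> (\<phi> b \<oplus>\<^bsub>W\<^esub> \<phi> c)"
    using assms by (simp add: vspaceD(9)[OF W] W.module.M.minus_add)
  finally show ?thesis using assms by (simp add: W.module.M.r_neg)
qed

lemma free_ext_smult_relator:
  fixes W :: "('k::field, 'w) module" and \<phi> :: "'x \<Rightarrow> 'w"
  assumes W: "vspace W" and b: "\<phi> b \<in> carrier W" and a: "\<phi> a = c \<odot>\<^bsub>W\<^esub> \<phi> b"
  shows "free_ext W \<phi> (Poly_Mapping.single a 1 - Poly_Mapping.single b c) = \<zero>\<^bsub>W\<^esub>"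
proof -
  interpret W: vectorspace class_ring W by (rule W)
  have assms: "\<phi> a \<in> carrier W" "\<phi> b \<in> carrier W" "\<phi> a = c \<odot>\<^bsub>W\<^esub> \<phi> b"
    using a b vspaceD(5)[OF W] by auto
  let ?F = "free_space {a, b} :: ('k, 'x \<Rightarrow>\<^sub>0 'k) module"
  let ?r = "Poly_Mapping.single a 1 - Poly_Mapping.single b c"
  have eq: "?r = Poly_Mapping.single a 1 \<oplus>\<^bsub>?F\<^esub> Poly_Mapping.single b (- c)"
    by (rule poly_mapping_eqI) (simp add: lookup_add lookup_minus lookup_single when_def)
  have l: "lin ?F W (free_ext W \<phi>)" by (rule lin_free_ext) (use assms W in auto)
  have "free_ext W \<phi> ?r = \<phi> a \<oplus>\<^bsub>W\<^esub> (- c) \<odot>\<^bsub>W\<^esub> \<phi> b"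
    unfolding eq using linD(4)[OF l] assms
    by (simp add: free_ext_single[OF W] vspaceD(6)[OF W])
  also have "\<dots> = (c + - c) \<odot>\<^bsub>W\<^esub> \<phi> b"
    using vspaceD(2)[OF W b, of c "- c"] a by simp
  finally show ?thesis using vspaceD(7)[OF W b] by simp
qed

section \<open>Tensor products\<close>

lemma bilinear_mapD:
  assumes "bilinear_map U V W \<phi>"
  shows "u \<in> carrier U \<Longrightarrow> lin V W (\<phi> u)" "v \<in> carrier V \<Longrightarrow> lin U W (\<lambda>u. \<phi> u v)"
    "u \<in> carrier U \<Longrightarrow> v \<in> carrier V \<Longrightarrow> \<phi> u v \<in> carrier W"
  using assms linD(3) by (fastforce simp: bilinear_map_def)+

lemma relator_add_keys:
  "a \<in> X \<Longrightarrow> b \<in> X \<Longrightarrow> c \<in> X \<Longrightarrow>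
    Poly_Mapping.keys (Poly_Mapping.single a 1 - Poly_Mapping.single b 1 - Poly_Mapping.single c (1::'k::field)) \<subseteq> X"
  by (auto simp: in_keys_iff lookup_minus lookup_single when_def split: if_splits)

lemma relator_smult_keys:
  "a \<in> X \<Longrightarrow> b \<in> X \<Longrightarrow>
    Poly_Mapping.keys (Poly_Mapping.single a 1 - Poly_Mapping.single b (c::'k::field)) \<subseteq> X"
  by (auto simp: in_keys_iff lookup_minus lookup_single when_def split: if_splits)

locale tensor_pair =
  fixes V :: "('k::field, 'v) module" and W :: "('k, 'w) module"
  assumes V: "vspace V" and W: "vspace W"
begin

interpretation V: vectorspace class_ring V by (rule V)
interpretation W: vectorspace class_ring W by (rule W)

lemma relators: "relators (carrier V \<times> carrier W) (tensor_relations V W)"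
  unfolding relators_def
proof
  fix p assume "p \<in> tensor_relations V W"
  then show "Poly_Mapping.keys p \<subseteq> carrier V \<times> carrier W"
    unfolding tensor_relations_def
    by (elim UnE CollectE exE conjE; hypsubst; intro relator_add_keys relator_smult_keys)
      (auto intro: vspaceD(5)[OF V] vspaceD(5)[OF W])
qed

lemma vspace_tensor: "vspace (tensor V W)"
  unfolding tensor_def by (rule vspace_presented[OF relators])

lemma tens_closed: "v \<in> carrier V \<Longrightarrow> w \<in> carrier W \<Longrightarrow> tens V W v w \<in> carrier (tensor V W)"
  unfolding tensor_def tens_def by (rule generator_closed[OF relators]) simp

lemma tens_bilinear: "bilinear_map V W (tensor V W) (tens V W)"
  unfolding bilinear_map_def
proof (intro conjI ballI)
  fix v assume v: "v \<in> carrier V"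
  show "lin W (tensor V W) (tens V W v)"
  proof (rule linI[OF W vspace_tensor])
    fix w w' assume w: "w \<in> carrier W" "w' \<in> carrier W"
    then show "tens V W v (w \<oplus>\<^bsub>W\<^esub> w') = tens V W v w \<oplus>\<^bsub>tensor V W\<^esub> tens V W v w'"
      unfolding tens_def tensor_def using v
      by (intro generator_add[OF relators]) (auto simp: tensor_relations_def)
  next
    fix c w assume w: "w \<in> carrier W"
    then show "tens V W v (c \<odot>\<^bsub>W\<^esub> w) = c \<odot>\<^bsub>tensor V W\<^esub> tens V W v w"
      unfolding tens_def tensor_def using v vspaceD(5)[OF W]
      by (intro generator_smult[OF relators]) (auto simp: tensor_relations_def)
  qed (use v tens_closed in auto)
next
  fix w assume w: "w \<in> carrier W"
  show "lin V (tensor V W) (\<lambda>v. tens V W v w)"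
  proof (rule linI[OF V vspace_tensor])
    fix v v' assume v: "v \<in> carrier V" "v' \<in> carrier V"
    then show "tens V W (v \<oplus>\<^bsub>V\<^esub> v') w = tens V W v w \<oplus>\<^bsub>tensor V W\<^esub> tens V W v' w"
      unfolding tens_def tensor_def using w
      by (intro generator_add[OF relators]) (auto simp: tensor_relations_def)
  next
    fix c v assume v: "v \<in> carrier V"
    then show "tens V W (c \<odot>\<^bsub>V\<^esub> v) w = c \<odot>\<^bsub>tensor V W\<^esub> tens V W v w"
      unfolding tens_def tensor_def using w vspaceD(5)[OF V]
      by (intro generator_smult[OF relators]) (auto simp: tensor_relations_def)
  qed (use w tens_closed in auto)
qed

text \<open>Universal property of the tensor product: the four families of relators vanish under
  \<open>\<phi>\<close> by additivity and homogeneity in each of the two arguments.\<close>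

lemma tensor_ext:
  assumes U: "vspace U" and \<phi>: "bilinear_map V W U (\<lambda>v w. \<phi> (v, w))"
  shows "lin (tensor V W) U (lin_ext U \<phi>)"
    and "v \<in> carrier V \<Longrightarrow> w \<in> carrier W \<Longrightarrow> lin_ext U \<phi> (tens V W v w) = \<phi> (v, w)"
proof -
  note b = bilinear_mapD[OF \<phi>]
  have c: "\<phi> x \<in> carrier U" if "x \<in> carrier V \<times> carrier W" for x
    using that b(3) by (cases x) auto
  have z: "free_ext U \<phi> p = \<zero>\<^bsub>U\<^esub>" if "p \<in> tensor_relations V W" for p
    by (insert that, unfold tensor_relations_def, elim UnE CollectE exE conjE; hypsubst;
        intro free_ext_add_relator[OF U] free_ext_smult_relator[OF U])
      (auto intro!: c vspaceD(5)[OF V] vspaceD(5)[OF W]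
        simp: linD(4)[OF b(1)] linD(4)[OF b(2)] linD(5)[OF b(1)] linD(5)[OF b(2)])
  show "lin (tensor V W) U (lin_ext U \<phi>)"
    unfolding tensor_def by (rule lin_ext_presented(1)[OF relators U c z])
  show "lin_ext U \<phi> (tens V W v w) = \<phi> (v, w)" if "v \<in> carrier V" "w \<in> carrier W"
    unfolding tens_def by (rule lin_ext_presented(2)[OF relators U c z]) (use that in auto)
qed

lemma lin_tensor_eqI:
  assumes "lin (tensor V W) U f" "lin (tensor V W) U g"
    and "\<And>v w. \<lbrakk>v \<in> carrier V; w \<in> carrier W\<rbrakk> \<Longrightarrow> f (tens V W v w) = g (tens V W v w)"
    and "t \<in> carrier (tensor V W)"
  shows "f t = g t"
proof (rule lin_presented_eqI[OF relators assms(1,2)[unfolded tensor_def] _ assms(4)[unfolded tensor_def]])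
  fix x assume "x \<in> carrier V \<times> carrier W"
  then show "f (generator (carrier V \<times> carrier W) (tensor_relations V W) x)
    = g (generator (carrier V \<times> carrier W) (tensor_relations V W) x)"
    using assms(3)[of "fst x" "snd x", unfolded tens_def] by auto
qed

end

text \<open>The representative depends on \<open>A\<close> and not on \<open>v\<close>, so linear
  dependence of the function on a parameter carries over to \<open>lin_ext\<close>. This gives
  linearity in the variables that are not themselves being extended.\<close>

lemma lin_lin_ext_param:
  assumes R: "relators X R" and A: "A \<in> carrier (presented_space X R)" and V: "vspace V" and W: "vspace W"
    and l: "\<And>x. x \<in> X \<Longrightarrow> lin V W (\<lambda>v. \<phi> v x)"
  shows "lin V W (\<lambda>v. lin_ext W (\<phi> v) A)"
proof (rule linI[OF V W])
  interpret W: vectorspace class_ring W by (rule W)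
  note c = linD(3)[OF l]
  fix v assume v: "v \<in> carrier V"
  show "lin_ext W (\<phi> v) A \<in> carrier W" by (rule lin_ext_closed[OF R A W c[OF _ v]])
  fix v' assume v': "v' \<in> carrier V"
  have "lin_ext W (\<phi> (v \<oplus>\<^bsub>V\<^esub> v')) A = lin_ext W (\<lambda>x. \<phi> v x \<oplus>\<^bsub>W\<^esub> \<phi> v' x) A"
    by (rule lin_ext_cong[OF R A W]) (use c[OF _ v] c[OF _ v'] linD(4)[OF l v v'] in auto)
  also have "\<dots> = lin_ext W (\<phi> v) A \<oplus>\<^bsub>W\<^esub> lin_ext W (\<phi> v') A"
    by (rule lin_ext_add[OF R A W c[OF _ v] c[OF _ v']])
  finally show "lin_ext W (\<phi> (v \<oplus>\<^bsub>V\<^esub> v')) A = \<dots>" .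
next
  note c = linD(3)[OF l]
  fix a v assume v: "v \<in> carrier V"
  have "lin_ext W (\<phi> (a \<odot>\<^bsub>V\<^esub> v)) A = lin_ext W (\<lambda>x. a \<odot>\<^bsub>W\<^esub> \<phi> v x) A"
    by (rule lin_ext_cong[OF R A W]) (use c[OF _ v] linD(5)[OF l v] vspaceD(5)[OF W] in auto)
  also have "\<dots> = a \<odot>\<^bsub>W\<^esub> lin_ext W (\<phi> v) A"
    by (rule lin_ext_smult[OF R A W c[OF _ v]])
  finally show "lin_ext W (\<phi> (a \<odot>\<^bsub>V\<^esub> v)) A = \<dots>" .
qed

section \<open>Chains\<close>

definition hom_spaces :: "('o, 'k::field, 'f, 'h) H_cat \<Rightarrow> bool" where
  "hom_spaces D \<longleftrightarrow> (\<forall>X\<in>Obj D. \<forall>Y\<in>Obj D. vspace (Hom D X Y))"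

text \<open>Linearity is tested through the update of one slot with the object list fixed, just as
  \<open>CN_relations\<close> relates generators with equal object lists only.\<close>

definition multilinear ::
  "('o, 'k::field, 'f, 'h) H_cat \<Rightarrow> nat \<Rightarrow> ('k, 'w) module \<Rightarrow> ('o list \<Rightarrow> 'f list \<Rightarrow> 'w) \<Rightarrow> bool" where
  "multilinear D n W \<psi> \<longleftrightarrow> (\<forall>Xs fs. (Xs, fs) \<in> CN_basis D n \<longrightarrow>
     (\<forall>i\<le>n. lin (hom_at D Xs i) W (\<lambda>f. \<psi> Xs (fs[i := f]))))"

definition chain_multilinear ::
  "('k::field, 'm) module \<Rightarrow> ('o, 'k, 'f, 'h) H_cat \<Rightarrow> nat \<Rightarrow> ('k, 'w) module \<Rightarrow>
    ('m \<Rightarrow> 'o list \<Rightarrow> 'f list \<Rightarrow> 'w) \<Rightarrow> bool" where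
  "chain_multilinear M D n W \<psi> \<longleftrightarrow> (\<forall>m\<in>carrier M. multilinear D n W (\<psi> m)) \<and>
     (\<forall>Xs fs. (Xs, fs) \<in> CN_basis D n \<longrightarrow> lin M W (\<lambda>m. \<psi> m Xs fs))"

lemma CN_basisD:
  assumes "(Xs, fs) \<in> CN_basis D n"
  shows "length Xs = Suc n" "length fs = Suc n" "set Xs \<subseteq> Obj D"
    "i \<le> n \<Longrightarrow> Xs ! i \<in> Obj D" "i \<le> n \<Longrightarrow> fs ! i \<in> carrier (hom_at D Xs i)"
  using assms by (auto simp: CN_basis_def)

lemma CN_basis_update:
  "(Xs, fs) \<in> CN_basis D n \<Longrightarrow> f \<in> carrier (hom_at D Xs i) \<Longrightarrow> (Xs, fs[i := f]) \<in> CN_basis D n"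
  by (cases "i < length fs") (auto simp: CN_basis_def nth_list_update)

lemma vspace_hom_at:
  assumes "hom_spaces D" "(Xs, fs) \<in> CN_basis D n" "i \<le> n"
  shows "vspace (hom_at D Xs i)"
proof -
  note b = CN_basisD[OF assms(2)]
  have "Xs ! (Suc i mod length Xs) \<in> Obj D"
    using b(1) by (intro b(4)) (simp add: less_Suc_eq_le[symmetric])
  then show ?thesis using assms b(4)[OF assms(3)] by (simp add: hom_spaces_def hom_at_def)
qed

lemma multilinear_closed:
  assumes "multilinear D n W \<psi>" "(Xs, fs) \<in> CN_basis D n"
  shows "\<psi> Xs fs \<in> carrier W"
proof -
  have "lin (hom_at D Xs 0) W (\<lambda>f. \<psi> Xs (fs[0 := f]))"
    using assms by (simp add: multilinear_def)
  from linD(3)[OF this CN_basisD(5)[OF assms(2), of 0]] show ?thesis by simp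
qed

lemma relators_CN:
  assumes D: "hom_spaces D"
  shows "relators (CN_basis D n) (CN_relations D n)"
  unfolding relators_def
proof
  fix p assume "p \<in> CN_relations D n"
  then consider
    Xs fs i f g where "p = Poly_Mapping.single (Xs, fs[i := f \<oplus>\<^bsub>hom_at D Xs i\<^esub> g]) 1
        - Poly_Mapping.single (Xs, fs[i := f]) 1 - Poly_Mapping.single (Xs, fs[i := g]) 1"
      "(Xs, fs) \<in> CN_basis D n" "i \<le> n" "f \<in> carrier (hom_at D Xs i)" "g \<in> carrier (hom_at D Xs i)"
  | Xs fs i c f where "p = Poly_Mapping.single (Xs, fs[i := c \<odot>\<^bsub>hom_at D Xs i\<^esub> f]) 1
        - Poly_Mapping.single (Xs, fs[i := f]) c"
      "(Xs, fs) \<in> CN_basis D n" "i \<le> n" "f \<in> carrier (hom_at D Xs i)"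
    unfolding CN_relations_def by blast
  then show "Poly_Mapping.keys p \<subseteq> CN_basis D n"
  proof cases
    case (1 Xs fs i f g)
    interpret V: vectorspace class_ring "hom_at D Xs i" by (rule vspace_hom_at[OF D 1(2,3)])
    show ?thesis unfolding 1(1) by (intro relator_add_keys CN_basis_update 1) (use 1 in simp)
  next
    case (2 Xs fs i c f)
    show ?thesis unfolding 2(1)
      by (intro relator_smult_keys CN_basis_update 2 vspaceD(5)[OF vspace_hom_at[OF D 2(2,3)]])
  qed
qed

lemma vspace_CN: "hom_spaces D \<Longrightarrow> vspace (CN D n)"
  unfolding CN_def by (intro vspace_presented relators_CN)

abbreviation "gen D n \<equiv> generator (CN_basis D n) (CN_relations D n)"

lemma multilinear_generator:
  assumes D: "hom_spaces D"
  shows "multilinear D n (CN D n) (\<lambda>Xs fs. gen D n (Xs, fs))"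
  unfolding multilinear_def
proof (intro allI impI)
  fix Xs fs i assume b: "(Xs, fs) \<in> CN_basis D n" and i: "i \<le> n"
  note V = vspace_hom_at[OF D b i]
  interpret V: vectorspace class_ring "hom_at D Xs i" by (rule V)
  note R = relators_CN[OF D, of n]
  show "lin (hom_at D Xs i) (CN D n) (\<lambda>f. gen D n (Xs, fs[i := f]))"
    unfolding CN_def
  proof (rule linI[OF V vspace_presented[OF R]])
    fix f assume f: "f \<in> carrier (hom_at D Xs i)"
    then show "gen D n (Xs, fs[i := f])
      \<in> carrier (presented_space (CN_basis D n) (CN_relations D n))"
      by (intro generator_closed[OF R] CN_basis_update[OF b])
    fix g assume "g \<in> carrier (hom_at D Xs i)"
    then show "gen D n (Xs, fs[i := f \<oplus>\<^bsub>hom_at D Xs i\<^esub> g])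
      = gen D n (Xs, fs[i := f])
        \<oplus>\<^bsub>presented_space (CN_basis D n) (CN_relations D n)\<^esub>
        gen D n (Xs, fs[i := g])"
      using b i f by (intro generator_add[OF R] CN_basis_update[OF b]) (auto simp: CN_relations_def)
  next
    fix c f assume f: "f \<in> carrier (hom_at D Xs i)"
    then show "gen D n (Xs, fs[i := c \<odot>\<^bsub>hom_at D Xs i\<^esub> f])
      = c \<odot>\<^bsub>presented_space (CN_basis D n) (CN_relations D n)\<^esub>
        gen D n (Xs, fs[i := f])"
      using b i vspaceD(5)[OF V f]
      by (intro generator_smult[OF R] CN_basis_update[OF b]) (auto simp: CN_relations_def)
  qed
qed

text \<open>Universal property of the direct sum of tensor products: slotwise linearity kills both
  families of relators, for each object list separately.\<close>

lemma CN_ext: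
  assumes D: "hom_spaces D" and W: "vspace W" and \<psi>: "multilinear D n W \<psi>"
  shows "lin (CN D n) W (lin_ext W (\<lambda>(Xs, fs). \<psi> Xs fs))"
    and "(Xs, fs) \<in> CN_basis D n \<Longrightarrow>
      lin_ext W (\<lambda>(Xs, fs). \<psi> Xs fs) (gen D n (Xs, fs)) = \<psi> Xs fs"
proof -
  have c: "(case x of (Xs, fs) \<Rightarrow> \<psi> Xs fs) \<in> carrier W" if "x \<in> CN_basis D n" for x
    using multilinear_closed[OF \<psi>] that by (cases x) simp
  have l: "lin (hom_at D Xs i) W (\<lambda>f. \<psi> Xs (fs[i := f]))"
    if "(Xs, fs) \<in> CN_basis D n" "i \<le> n" for Xs fs i
    using \<psi> that by (simp add: multilinear_def)
  have z: "free_ext W (\<lambda>(Xs, fs). \<psi> Xs fs) p = \<zero>\<^bsub>W\<^esub>" if "p \<in> CN_relations D n" for p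
  proof -
    from that consider
      Xs fs i f g where "p = Poly_Mapping.single (Xs, fs[i := f \<oplus>\<^bsub>hom_at D Xs i\<^esub> g]) 1
          - Poly_Mapping.single (Xs, fs[i := f]) 1 - Poly_Mapping.single (Xs, fs[i := g]) 1"
        "(Xs, fs) \<in> CN_basis D n" "i \<le> n" "f \<in> carrier (hom_at D Xs i)" "g \<in> carrier (hom_at D Xs i)"
    | Xs fs i c f where "p = Poly_Mapping.single (Xs, fs[i := c \<odot>\<^bsub>hom_at D Xs i\<^esub> f]) 1
          - Poly_Mapping.single (Xs, fs[i := f]) c"
        "(Xs, fs) \<in> CN_basis D n" "i \<le> n" "f \<in> carrier (hom_at D Xs i)"
      unfolding CN_relations_def by blast
    then show ?thesis
    proof cases
      case (1 Xs fs i f g)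
      note l = linD[OF l[OF 1(2,3)]]
      show ?thesis unfolding 1(1)
        by (rule free_ext_add_relator[OF W]) (use l(3,4) 1 in simp_all)
    next
      case (2 Xs fs i c f)
      note l = linD[OF l[OF 2(2,3)]]
      show ?thesis unfolding 2(1)
        by (rule free_ext_smult_relator[OF W]) (use l(3,5) 2 in simp_all)
    qed
  qed
  show "lin (CN D n) W (lin_ext W (\<lambda>(Xs, fs). \<psi> Xs fs))"
    unfolding CN_def by (rule lin_ext_presented(1)[OF relators_CN[OF D] W c z])
  show "lin_ext W (\<lambda>(Xs, fs). \<psi> Xs fs) (gen D n (Xs, fs)) = \<psi> Xs fs"
    if "(Xs, fs) \<in> CN_basis D n"
    using lin_ext_presented(2)[OF relators_CN[OF D] W c z that] by simp
qed

locale chains =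
  fixes M :: "('k::field, 'm) module" and D :: "('o, 'k, 'f, 'h) H_cat"
  assumes M: "vspace M" and D: "hom_spaces D"
begin

lemma tensor_pair: "tensor_pair M (CN D n)"
  by (intro tensor_pair.intro M vspace_CN[OF D])

lemma vspace_chain_space: "vspace (chain_space M D n)"
  unfolding chain_space_def by (rule tensor_pair.vspace_tensor[OF tensor_pair])

text \<open>The extension is made in two stages: for fixed \<open>m\<close> by
  \<open>CN_ext\<close>, and then in \<open>m\<close> by \<open>lin_lin_ext_param\<close> followed
  by the universal property of the tensor product.\<close>

lemma chain_ext:
  assumes W: "vspace W" and \<psi>: "chain_multilinear M D n W \<psi>"
  shows "lin (chain_space M D n) W (chain_ext W \<psi>)"
    and "m \<in> carrier M \<Longrightarrow> x \<in> CN_basis D n \<Longrightarrow> chain_ext W \<psi> (pure_chain M D n m x) = \<psi> m (fst x) (snd x)"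
proof -
  have \<psi>1: "multilinear D n W (\<psi> m)" if "m \<in> carrier M" for m
    using \<psi> that by (simp add: chain_multilinear_def)
  have \<psi>2: "lin M W (\<lambda>m. \<psi> m Xs fs)" if "(Xs, fs) \<in> CN_basis D n" for Xs fs
    using \<psi> that by (simp add: chain_multilinear_def)
  note c = multilinear_closed[OF \<psi>1]
  note R = relators_CN[OF D, of n]
  have b: "bilinear_map M (CN D n) W
      (\<lambda>v w. case (v, w) of (m, t) \<Rightarrow> lin_ext W (\<lambda>(Xs, fs). \<psi> m Xs fs) t)"
    unfolding bilinear_map_def prod.case
  proof (intro conjI ballI)
    fix m assume "m \<in> carrier M"
    then show "lin (CN D n) W (\<lambda>t. lin_ext W (\<lambda>(Xs, fs). \<psi> m Xs fs) t)"
      by (intro CN_ext D W \<psi>1)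
  next
    fix t assume t: "t \<in> carrier (CN D n)"
    note t' = t[unfolded CN_def]
    show "lin M W (\<lambda>m. lin_ext W (\<lambda>(Xs, fs). \<psi> m Xs fs) t)"
      by (rule lin_lin_ext_param[OF R t' M W]) (use \<psi>2 in auto)
  qed
  show "lin (chain_space M D n) W (chain_ext W \<psi>)"
    unfolding chain_space_def chain_ext_def by (rule tensor_pair.tensor_ext(1)[OF tensor_pair W b])
  assume m: "m \<in> carrier M" and x: "x \<in> CN_basis D n"
  obtain Xs fs where [simp]: "x = (Xs, fs)" by (cases x)
  have g: "gen D n x \<in> carrier (CN D n)"
    unfolding CN_def by (rule generator_closed[OF R x])
  show "chain_ext W \<psi> (pure_chain M D n m x) = \<psi> m (fst x) (snd x)"
    using tensor_pair.tensor_ext(2)[OF tensor_pair W b m g] CN_ext(2)[OF D W \<psi>1[OF m], of Xs fs] x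
    by (simp add: chain_ext_def pure_chain_def)
qed

lemma pure_chain_multilinear:
  "chain_multilinear M D n (chain_space M D n) (\<lambda>m Xs fs. pure_chain M D n m (Xs, fs))"
proof -
  note b = bilinear_mapD[OF tensor_pair.tens_bilinear[OF tensor_pair[of n]]]
  note g = multilinear_generator[OF D, of n]
  show ?thesis
    unfolding chain_multilinear_def multilinear_def pure_chain_def chain_space_def
    by (intro conjI ballI allI impI lin_comp[OF _ b(1)] b(2) multilinear_closed[OF g])
      (use g in \<open>simp_all add: multilinear_def\<close>)
qed

lemma pure_chain_closed:
  "m \<in> carrier M \<Longrightarrow> x \<in> CN_basis D n \<Longrightarrow> pure_chain M D n m x \<in> carrier (chain_space M D n)"
  using multilinear_closed[of D n "chain_space M D n" "\<lambda>Xs fs. pure_chain M D n m (Xs, fs)" "fst x" "snd x"]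
    pure_chain_multilinear[of n] by (simp add: chain_multilinear_def)

text \<open>Generators are exhausted in two stages: tensors m tensor t first, and then, for fixed
  \<open>m\<close>, the generators of \<open>CN D n\<close> in place of \<open>t\<close>.\<close>

lemma lin_chain_eqI:
  assumes f: "lin (chain_space M D n) W f" and g: "lin (chain_space M D n) W g"
    and eq: "\<And>m Xs fs. \<lbrakk>m \<in> carrier M; (Xs, fs) \<in> CN_basis D n\<rbrakk> \<Longrightarrow>
      f (pure_chain M D n m (Xs, fs)) = g (pure_chain M D n m (Xs, fs))"
    and x: "x \<in> carrier (chain_space M D n)"
  shows "f x = g x"
proof (rule tensor_pair.lin_tensor_eqI[OF tensor_pair f[unfolded chain_space_def] g[unfolded chain_space_def] _ x[unfolded chain_space_def]])
  fix m t assume m: "m \<in> carrier M" and t: "t \<in> carrier (CN D n)"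
  note b = bilinear_mapD(1)[OF tensor_pair.tens_bilinear[OF tensor_pair[of n]] m, unfolded CN_def]
  show "f (tens M (CN D n) m t) = g (tens M (CN D n) m t)"
    unfolding CN_def
  proof (rule lin_presented_eqI[OF relators_CN[OF D] lin_comp[OF b] lin_comp[OF b] _ t[unfolded CN_def]])
    fix y assume y: "y \<in> CN_basis D n"
    then show "f (tens M (presented_space (CN_basis D n) (CN_relations D n)) m
          (gen D n y))
        = g (tens M (presented_space (CN_basis D n) (CN_relations D n)) m
          (gen D n y))"
      using eq[OF m, of "fst y" "snd y"] by (simp add: pure_chain_def CN_def)
  qed (use f g in \<open>simp_all add: chain_space_def CN_def\<close>)
qed

end

section \<open>Face maps\<close>

context chains
begin

lemma lin_pure_slot:
  assumes m: "m \<in> carrier M" and b: "(X', gs) \<in> CN_basis D k" and j: "j \<le> k"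
    and u: "lin V (hom_at D X' j) u"
  shows "lin V (chain_space M D k) (\<lambda>f. pure_chain M D k m (X', gs[j := u f]))"
  by (rule lin_comp[OF u])
    (use pure_chain_multilinear[of k] m b j in \<open>simp add: chain_multilinear_def multilinear_def\<close>)

lemma lin_pure_coeff:
  assumes "x \<in> CN_basis D k"
  shows "lin M (chain_space M D k) (\<lambda>m. pure_chain M D k m x)"
  using pure_chain_multilinear[of k] assms by (cases x) (simp add: chain_multilinear_def)

text \<open>If varying one slot of the input changes one slot of the output, and this linearly, then
  the pure chain of the output is multilinear. All the list operations behind faces have this
  property.\<close>

lemma multilinear_pureI:
  assumes m: "m \<in> carrier M"
    and b: "\<And>Xs fs. (Xs, fs) \<in> CN_basis D n \<Longrightarrow> (X' Xs, F Xs fs) \<in> CN_basis D k"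
    and u: "\<And>Xs fs i. \<lbrakk>(Xs, fs) \<in> CN_basis D n; i \<le> n\<rbrakk> \<Longrightarrow>
      \<exists>j\<le>k. \<exists>u. lin (hom_at D Xs i) (hom_at D (X' Xs) j) u \<and> (\<forall>f. F Xs (fs[i := f]) = (F Xs fs)[j := u f])"
  shows "multilinear D n (chain_space M D k) (\<lambda>Xs fs. pure_chain M D k m (X' Xs, F Xs fs))"
  unfolding multilinear_def
proof (intro allI impI)
  fix Xs fs i assume Xs: "(Xs, fs) \<in> CN_basis D n" and i: "i \<le> n"
  obtain j u where "j \<le> k" "lin (hom_at D Xs i) (hom_at D (X' Xs) j) u"
    "\<forall>f. F Xs (fs[i := f]) = (F Xs fs)[j := u f]" using u[OF Xs i] by blast
  then show "lin (hom_at D Xs i) (chain_space M D k) (\<lambda>f. pure_chain M D k m (X' Xs, F Xs (fs[i := f])))"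
    using lin_pure_slot[OF m b[OF Xs]] by simp
qed

end

definition face_obj :: "nat \<Rightarrow> 'o list \<Rightarrow> 'o list" where
  "face_obj i Xs = take (Suc i) Xs @ drop (i + 2) Xs"

text \<open>The merged entry is an argument, so that the same operation serves for morphisms,
  matrices, pairs and tensors, each with its own product.\<close>

definition face_mor :: "nat \<Rightarrow> 'x \<Rightarrow> 'x list \<Rightarrow> 'x list" where
  "face_mor i x fs = take i fs @ x # drop (i + 2) fs"

text \<open>The composite of f^n and f^0 passes through X_0, so X_0 disappears and X_n takes the
  first position.\<close>

definition last_obj :: "nat \<Rightarrow> 'o list \<Rightarrow> 'o list" where
  "last_obj n Xs = Xs ! n # butlast (tl Xs)"

definition last_mor :: "'x \<Rightarrow> 'x list \<Rightarrow> 'x list" where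
  "last_mor x fs = x # butlast (tl fs)"

lemma length_face_obj [simp]: "Suc i < length Xs \<Longrightarrow> length (face_obj i Xs) = length Xs - 1"
  and length_face_mor [simp]: "Suc i < length fs \<Longrightarrow> length (face_mor i x fs) = length fs - 1"
  and length_last_obj [simp]: "1 < length Xs \<Longrightarrow> length (last_obj n Xs) = length Xs - 1"
  and length_last_mor [simp]: "1 < length fs \<Longrightarrow> length (last_mor x fs) = length fs - 1"
  by (auto simp: face_obj_def face_mor_def last_obj_def last_mor_def)

lemma nth_face_obj: "\<lbrakk>Suc i < length Xs; Suc k < length Xs\<rbrakk> \<Longrightarrow>
    face_obj i Xs ! k = (if k \<le> i then Xs ! k else Xs ! Suc k)"
  by (auto simp: face_obj_def nth_append)

lemma nth_face_mor: "\<lbrakk>Suc i < length fs; Suc k < length fs\<rbrakk> \<Longrightarrow>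
    face_mor i x fs ! k = (if k < i then fs ! k else if k = i then x else fs ! Suc k)"
  by (auto simp: face_mor_def nth_append nth_Cons' add.commute[of i] split: nat.split)

lemma nth_last_obj: "Suc k < length Xs \<Longrightarrow>
    last_obj n Xs ! k = (if k = 0 then Xs ! n else Xs ! k)"
  by (auto simp: last_obj_def nth_Cons nth_butlast nth_tl split: nat.split)

lemma nth_last_mor: "Suc k < length fs \<Longrightarrow> last_mor x fs ! k = (if k = 0 then x else fs ! k)"
  by (auto simp: last_mor_def nth_Cons nth_butlast nth_tl split: nat.split)

lemma hom_at_eq:
  assumes "length Xs = Suc n" "i \<le> n"
  shows "hom_at D Xs i = Hom D (if i = n then Xs ! 0 else Xs ! Suc i) (Xs ! i)"
  using assms by (simp add: hom_at_def)

lemma hom_at_face: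
  assumes "length Xs = Suc (Suc n)" "i \<le> n" "k \<le> n"
  shows "hom_at D (face_obj i Xs) k =
    (if k < i then hom_at D Xs k
     else if k = i then Hom D (Xs ! (Suc (Suc i) mod Suc (Suc n))) (Xs ! i)
     else hom_at D Xs (Suc k))"
  using assms by (auto simp: hom_at_eq[of _ n] hom_at_eq[of _ "Suc n"] nth_face_obj)

lemma hom_at_last:
  assumes "length Xs = Suc (Suc n)" "k \<le> n"
  shows "hom_at D (last_obj (Suc n) Xs) k =
    (if k = 0 then Hom D (Xs ! 1) (Xs ! Suc n) else hom_at D Xs k)"
  using assms by (auto simp: hom_at_eq[of _ n] hom_at_eq[of _ "Suc n"] nth_last_obj)

lemma set_face_obj: "set (face_obj i Xs) \<subseteq> set Xs"
  using set_take_subset[of "Suc i" Xs] set_drop_subset[of "i + 2" Xs] by (auto simp: face_obj_def)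

lemma set_last_obj: "n < length Xs \<Longrightarrow> set (last_obj n Xs) \<subseteq> set Xs"
  by (cases "Xs = []") (auto simp: last_obj_def dest!: in_set_butlastD list.set_sel(2)[rotated])

text \<open>Collects what makes the faces linear maps. It is verified for \<open>D\<close> and again
  for the matrix category, so that both complexes are instances of one construction.\<close>

locale hochschild = chains M D
  for M :: "('k::field, 'm) module" and D :: "('o, 'k, 'f, 'h) H_cat" +
  fixes H :: "('k, 'h) module" and S :: "'h \<Rightarrow> 'h" and \<rho> :: "'m \<Rightarrow> ('h \<times> 'm \<Rightarrow>\<^sub>0 'k) set"
  assumes H: "vspace H"
    and comp: "\<lbrakk>X \<in> Obj D; Y \<in> Obj D; Z \<in> Obj D\<rbrakk> \<Longrightarrow>
      bilinear_map (Hom D Y Z) (Hom D X Y) (Hom D X Z) (Comp D X Y Z)"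
    and act: "\<lbrakk>X \<in> Obj D; Y \<in> Obj D\<rbrakk> \<Longrightarrow>
      bilinear_map H (Hom D X Y) (Hom D X Y) (Act D X Y)"
    and Sinv: "lin H H (inv_into (carrier H) S)"
    and \<rho>: "lin M (tensor H M) \<rho>"
begin

abbreviation "C n \<equiv> chain_space M D n"
abbreviation "fc n i \<equiv> face H S M \<rho> D n i"
abbreviation "bd n \<equiv> hochschild_boundary H S M \<rho> D n"
abbreviation "Si \<equiv> inv_into (carrier H) S"
abbreviation "inner_comp n i Xs f g \<equiv> Comp D (Xs ! (Suc (Suc i) mod Suc (Suc n))) (Xs ! Suc i) (Xs ! i) f g"
abbreviation "last_comp n a Xs f g \<equiv>
  Comp D (Xs ! 1) (Xs ! 0) (Xs ! Suc n) (Act D (Xs ! 0) (Xs ! Suc n) (Si a) f) g"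

lemma tensor_HM: "tensor_pair H M"
  by (intro tensor_pair.intro H M)

lemma \<rho>_closed: "m \<in> carrier M \<Longrightarrow> \<rho> m \<in> carrier (tensor H M)"
  by (rule linD(3)[OF \<rho>])

lemma inner_comp_bilinear:
  assumes "(Xs, fs) \<in> CN_basis D (Suc n)" "i \<le> n"
  shows "bilinear_map (hom_at D Xs i) (hom_at D Xs (Suc i)) (hom_at D (face_obj i Xs) i) (inner_comp n i Xs)"
proof -
  note b = CN_basisD[OF assms(1)]
  have "Xs ! (Suc (Suc i) mod Suc (Suc n)) \<in> Obj D"
    using b(1) by (intro b(4)) (simp add: less_Suc_eq_le[symmetric])
  moreover have "hom_at D (face_obj i Xs) i = Hom D (Xs ! (Suc (Suc i) mod Suc (Suc n))) (Xs ! i)"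
    using b(1) assms(2) hom_at_face[of Xs n i i D] by simp
  ultimately show ?thesis
    using comp[of "Xs ! (Suc (Suc i) mod Suc (Suc n))" "Xs ! Suc i" "Xs ! i"] b(1) assms(2) b(4)
    by (simp add: hom_at_def)
qed

lemma last_comp_bilinear:
  assumes "(Xs, fs) \<in> CN_basis D (Suc n)" "a \<in> carrier H"
  shows "bilinear_map (hom_at D Xs (Suc n)) (hom_at D Xs 0) (hom_at D (last_obj (Suc n) Xs) 0) (last_comp n a Xs)"
proof -
  note b = CN_basisD[OF assms(1)]
  have O: "Xs ! 1 \<in> Obj D" "Xs ! 0 \<in> Obj D" "Xs ! Suc n \<in> Obj D" using b(4) by simp_all
  have eq: "hom_at D (last_obj (Suc n) Xs) 0 = Hom D (Xs ! 1) (Xs ! Suc n)"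
    "hom_at D Xs 0 = Hom D (Xs ! 1) (Xs ! 0)" "hom_at D Xs (Suc n) = Hom D (Xs ! 0) (Xs ! Suc n)"
    using b(1) hom_at_last[of Xs n 0 D] by (simp_all add: hom_at_def)
  note c = bilinear_mapD[OF comp[OF O]]
  have a: "lin (Hom D (Xs ! 0) (Xs ! Suc n)) (Hom D (Xs ! 0) (Xs ! Suc n)) (Act D (Xs ! 0) (Xs ! Suc n) (Si a))"
    using bilinear_mapD(1)[OF act[OF O(2,3)] linD(3)[OF Sinv assms(2)]] .
  show ?thesis unfolding eq bilinear_map_def
    by (intro conjI ballI c(1) linD(3)[OF a] lin_comp[OF a] c(2))
qed

lemma face_basis:
  assumes b: "(Xs, fs) \<in> CN_basis D (Suc n)" and i: "i \<le> n" and x: "x \<in> carrier (hom_at D (face_obj i Xs) i)"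
  shows "(face_obj i Xs, face_mor i x fs) \<in> CN_basis D n"
  using CN_basisD[OF b] i x set_face_obj[of i Xs]
  by (auto simp: CN_basis_def nth_face_mor hom_at_face)

lemma last_basis:
  assumes b: "(Xs, fs) \<in> CN_basis D (Suc n)" and x: "x \<in> carrier (hom_at D (last_obj (Suc n) Xs) 0)"
  shows "(last_obj (Suc n) Xs, last_mor x fs) \<in> CN_basis D n"
  using CN_basisD[OF b] x set_last_obj[of "Suc n" Xs]
  by (auto simp: CN_basis_def nth_last_mor hom_at_last)

lemma inner_face_multilinear:
  assumes i: "i \<le> n" and m: "m \<in> carrier M"
  shows "multilinear D (Suc n) (C n) (\<lambda>Xs fs. pure_chain M D n m
    (face_obj i Xs, face_mor i (inner_comp n i Xs (fs ! i) (fs ! Suc i)) fs))"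
proof (rule multilinear_pureI[OF m])
  fix Xs fs assume b: "(Xs, fs) \<in> CN_basis D (Suc n)"
  note c = bilinear_mapD[OF inner_comp_bilinear[OF b i]] and b' = CN_basisD[OF b]
  note fi = b'(5)[of i] b'(5)[of "Suc i"]
  show "(face_obj i Xs, face_mor i (inner_comp n i Xs (fs ! i) (fs ! Suc i)) fs) \<in> CN_basis D n"
    by (rule face_basis[OF b i]) (use c(3) i fi in simp)
  fix l assume l: "l \<le> Suc n"
  let ?F = "\<lambda>fs. face_mor i (inner_comp n i Xs (fs ! i) (fs ! Suc i)) fs"
  let ?G = "\<lambda>j u. j \<le> n \<and> lin (hom_at D Xs l) (hom_at D (face_obj i Xs) j) u
      \<and> (\<forall>f. ?F (fs[l := f]) = (?F fs)[j := u f])"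
  note len = b'(1,2)
  have id: "lin (hom_at D Xs l) (hom_at D Xs l) (\<lambda>f. f)" by (rule lin_id[OF vspace_hom_at[OF D b l]])
  \<comment> \<open>Slots \<open>i\<close> and \<open>Suc i\<close> both end up in the merged slot
    \<open>i\<close>, earlier slots stay, and later ones move down by one.\<close>
  consider "l < i" | "l = i" | "l = Suc i" | "Suc i < l" by linarith
  then have "\<exists>j u. ?G j u"
  proof cases
    case 1
    then have "?G l (\<lambda>f. f)" using i id len
      by (auto intro!: nth_equalityI simp: hom_at_face nth_face_mor nth_list_update)
    then show ?thesis by blast
  next
    case 2
    then have "?G i (\<lambda>f. inner_comp n i Xs f (fs ! Suc i))" using i len c(2) fi
      by (auto intro!: nth_equalityI simp: nth_face_mor nth_list_update)
    then show ?thesis by blast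
  next
    case 3
    then have "?G i (inner_comp n i Xs (fs ! i))" using i len c(1) fi
      by (auto intro!: nth_equalityI simp: nth_face_mor nth_list_update)
    then show ?thesis by blast
  next
    case 4
    then obtain l' where l': "l = Suc l'" by (cases l) auto
    have "?G l' (\<lambda>f. f)" using 4 i id len l l'
      by (auto intro!: nth_equalityI simp: hom_at_face nth_face_mor nth_list_update)
    then show ?thesis by blast
  qed
  then show "\<exists>j\<le>n. \<exists>u. lin (hom_at D Xs l) (hom_at D (face_obj i Xs) j) u
      \<and> (\<forall>f. ?F (fs[l := f]) = (?F fs)[j := u f])" by blast
qed

lemma last_face_multilinear:
  assumes a: "a \<in> carrier H" and m: "m \<in> carrier M"
  shows "multilinear D (Suc n) (C n) (\<lambda>Xs fs. pure_chain M D n m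
    (last_obj (Suc n) Xs, last_mor (last_comp n a Xs (fs ! Suc n) (fs ! 0)) fs))"
proof (rule multilinear_pureI[OF m])
  fix Xs fs assume b: "(Xs, fs) \<in> CN_basis D (Suc n)"
  note c = bilinear_mapD[OF last_comp_bilinear[OF b a]] and b' = CN_basisD[OF b]
  note fi = b'(5)[of 0] b'(5)[of "Suc n"]
  show "(last_obj (Suc n) Xs, last_mor (last_comp n a Xs (fs ! Suc n) (fs ! 0)) fs) \<in> CN_basis D n"
    by (rule last_basis[OF b]) (use c(3) fi in simp)
  fix l assume l: "l \<le> Suc n"
  let ?F = "\<lambda>fs. last_mor (last_comp n a Xs (fs ! Suc n) (fs ! 0)) fs"
  let ?G = "\<lambda>j u. j \<le> n \<and> lin (hom_at D Xs l) (hom_at D (last_obj (Suc n) Xs) j) u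
      \<and> (\<forall>f. ?F (fs[l := f]) = (?F fs)[j := u f])"
  note len = b'(1,2)
  have id: "lin (hom_at D Xs l) (hom_at D Xs l) (\<lambda>f. f)" by (rule lin_id[OF vspace_hom_at[OF D b l]])
  \<comment> \<open>The first and the last slot merge into slot 0; the others keep their index
    because the list is shortened at its end.\<close>
  consider "l = 0" | "l = Suc n" | "0 < l" "l \<le> n" using l by linarith
  then have "\<exists>j u. ?G j u"
  proof cases
    case 1
    then have "?G 0 (last_comp n a Xs (fs ! Suc n))" using len c(1) fi
      by (auto intro!: nth_equalityI simp: nth_last_mor nth_list_update)
    then show ?thesis by blast
  next
    case 2
    then have "?G 0 (\<lambda>f. last_comp n a Xs f (fs ! 0))" using len c(2) fi
      by (auto intro!: nth_equalityI simp: nth_last_mor nth_list_update)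
    then show ?thesis by blast
  next
    case 3
    have "?G l (\<lambda>f. f)" using 3 id len
      by (auto intro!: nth_equalityI simp: hom_at_last nth_last_mor nth_list_update)
    then show ?thesis by blast
  qed
  then show "\<exists>j\<le>n. \<exists>u. lin (hom_at D Xs l) (hom_at D (last_obj (Suc n) Xs) j) u
      \<and> (\<forall>f. ?F (fs[l := f]) = (?F fs)[j := u f])" by blast
qed

lemma inner_face:
  assumes i: "i \<le> n"
  shows "lin (C (Suc n)) (C n) (inner_face M D (Suc n) i)"
    and "m \<in> carrier M \<Longrightarrow> (Xs, fs) \<in> CN_basis D (Suc n) \<Longrightarrow>
      inner_face M D (Suc n) i (pure_chain M D (Suc n) m (Xs, fs))
      = pure_chain M D n m (face_obj i Xs, face_mor i (inner_comp n i Xs (fs ! i) (fs ! Suc i)) fs)"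
proof -
  let ?\<psi> = "\<lambda>m Xs fs. pure_chain M D n m
    (face_obj i Xs, face_mor i (inner_comp n i Xs (fs ! i) (fs ! Suc i)) fs)"
  have \<psi>: "chain_multilinear M D (Suc n) (C n) ?\<psi>"
    unfolding chain_multilinear_def
    using i by (auto intro!: inner_face_multilinear lin_pure_coeff face_basis
        bilinear_mapD(3)[OF inner_comp_bilinear] CN_basisD(5))
  have eq: "inner_face M D (Suc n) i = chain_ext (C n) ?\<psi>"
    by (simp add: inner_face_def face_obj_def face_mor_def)
  show "lin (C (Suc n)) (C n) (inner_face M D (Suc n) i)"
    unfolding eq by (rule chain_ext(1)[OF vspace_chain_space \<psi>])
  show "inner_face M D (Suc n) i (pure_chain M D (Suc n) m (Xs, fs)) = ?\<psi> m Xs fs"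
    if "m \<in> carrier M" "(Xs, fs) \<in> CN_basis D (Suc n)"
    unfolding eq using chain_ext(2)[OF vspace_chain_space \<psi> that] by simp
qed

abbreviation "last_term n Xs fs \<equiv> \<lambda>(a, m0). pure_chain M D n m0
  (last_obj (Suc n) Xs, last_mor (last_comp n a Xs (fs ! Suc n) (fs ! 0)) fs)"

text \<open>Makes the sum over the coaction independent of the representative of
  \<open>\<rho> m\<close>. In \<open>a\<close> the term is a composite of the inverse antipode, the
  action, the composition and slot 0.\<close>

lemma last_term_bilinear:
  assumes b: "(Xs, fs) \<in> CN_basis D (Suc n)"
  shows "bilinear_map H M (C n) (\<lambda>a m0. last_term n Xs fs (a, m0))"
  unfolding bilinear_map_def prod.case
proof (intro conjI ballI)
  fix a assume a: "a \<in> carrier H"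
  show "lin M (C n) (\<lambda>m0. pure_chain M D n m0
      (last_obj (Suc n) Xs, last_mor (last_comp n a Xs (fs ! Suc n) (fs ! 0)) fs))"
    by (intro lin_pure_coeff last_basis[OF b] bilinear_mapD(3)[OF last_comp_bilinear[OF b a]] CN_basisD(5)[OF b])
      simp_all
next
  fix m assume m: "m \<in> carrier M"
  note b' = CN_basisD[OF b]
  have O: "Xs ! 1 \<in> Obj D" "Xs ! 0 \<in> Obj D" "Xs ! Suc n \<in> Obj D" using b'(4) by simp_all
  have eq: "hom_at D (last_obj (Suc n) Xs) 0 = Hom D (Xs ! 1) (Xs ! Suc n)"
    "hom_at D Xs 0 = Hom D (Xs ! 1) (Xs ! 0)" "hom_at D Xs (Suc n) = Hom D (Xs ! 0) (Xs ! Suc n)"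
    using b'(1) hom_at_last[of Xs n 0 D] by (simp_all add: hom_at_def)
  have f: "fs ! 0 \<in> carrier (Hom D (Xs ! 1) (Xs ! 0))" "fs ! Suc n \<in> carrier (Hom D (Xs ! 0) (Xs ! Suc n))"
    using b'(5)[of 0] b'(5)[of "Suc n"] eq by simp_all
  note act' = bilinear_mapD[OF act[OF O(2,3)]] and comp' = bilinear_mapD[OF comp[OF O]]
  have u: "lin H (hom_at D (last_obj (Suc n) Xs) 0) (\<lambda>a. last_comp n a Xs (fs ! Suc n) (fs ! 0))"
    unfolding eq by (rule lin_comp[OF lin_comp[OF Sinv act'(2)[OF f(2)]] comp'(2)[OF f(1)]])
  \<comment> \<open>A complete basis list is required before slot 0 can be varied; the composite for
    a = 0 fills that slot and is overwritten.\<close>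
  have c: "last_comp n \<zero>\<^bsub>H\<^esub> Xs (fs ! Suc n) (fs ! 0) \<in> carrier (hom_at D (last_obj (Suc n) Xs) 0)"
  proof -
    interpret H: vectorspace class_ring H by (rule H)
    show ?thesis by (rule linD(3)[OF u]) simp
  qed
  have "lin H (C n) (\<lambda>a. pure_chain M D n m
      (last_obj (Suc n) Xs, (last_mor (last_comp n \<zero>\<^bsub>H\<^esub> Xs (fs ! Suc n) (fs ! 0)) fs)
        [0 := last_comp n a Xs (fs ! Suc n) (fs ! 0)]))"
    by (rule lin_pure_slot[OF m last_basis[OF b c] _ u]) simp
  then show "lin H (C n) (\<lambda>a. pure_chain M D n m
      (last_obj (Suc n) Xs, last_mor (last_comp n a Xs (fs ! Suc n) (fs ! 0)) fs))"
    by (simp add: last_mor_def)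
qed

text \<open>Linearity in a morphism holds with \<open>\<rho> m\<close> fixed, as linear dependence
  on a parameter; linearity in \<open>m\<close> holds because the bilinear term extends to the
  tensor product, where \<open>\<rho>\<close> takes its values.\<close>

lemma last_face:
  shows "lin (C (Suc n)) (C n) (last_face H S M \<rho> D (Suc n))"
    and "m \<in> carrier M \<Longrightarrow> (Xs, fs) \<in> CN_basis D (Suc n) \<Longrightarrow>
      last_face H S M \<rho> D (Suc n) (pure_chain M D (Suc n) m (Xs, fs))
      = lin_ext (C n) (last_term n Xs fs) (\<rho> m)"
proof -
  interpret HM: tensor_pair H M by (rule tensor_HM)
  note R = HM.relators
  note C = vspace_chain_space[of n]
  let ?\<psi> = "\<lambda>m Xs fs. lin_ext (C n) (last_term n Xs fs) (\<rho> m)"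
  have \<psi>: "chain_multilinear M D (Suc n) (C n) ?\<psi>"
    unfolding chain_multilinear_def
  proof (intro conjI ballI allI impI)
    fix m assume m: "m \<in> carrier M"
    note A = \<rho>_closed[OF m, unfolded tensor_def]
    show "multilinear D (Suc n) (C n) (\<lambda>Xs fs. lin_ext (C n) (last_term n Xs fs) (\<rho> m))"
      unfolding multilinear_def
    proof (intro allI impI)
      fix Xs fs i assume b: "(Xs, fs) \<in> CN_basis D (Suc n)" and i: "i \<le> Suc n"
      show "lin (hom_at D Xs i) (C n) (\<lambda>f. lin_ext (C n) (last_term n Xs (fs[i := f])) (\<rho> m))"
        by (rule lin_lin_ext_param[OF R A vspace_hom_at[OF D b i] C])
          (use last_face_multilinear b i in \<open>auto simp: multilinear_def\<close>)
    qed
  next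
    fix Xs fs assume b: "(Xs, fs) \<in> CN_basis D (Suc n)"
    show "lin M (C n) (\<lambda>m. lin_ext (C n) (last_term n Xs fs) (\<rho> m))"
      by (rule lin_comp[OF \<rho> HM.tensor_ext(1)[OF C last_term_bilinear[OF b]]])
  qed
  have eq: "last_face H S M \<rho> D (Suc n) = chain_ext (C n) ?\<psi>"
    by (simp add: last_face_def last_obj_def last_mor_def)
  show "lin (C (Suc n)) (C n) (last_face H S M \<rho> D (Suc n))"
    unfolding eq by (rule chain_ext(1)[OF C \<psi>])
  show "last_face H S M \<rho> D (Suc n) (pure_chain M D (Suc n) m (Xs, fs)) = ?\<psi> m Xs fs"
    if "m \<in> carrier M" "(Xs, fs) \<in> CN_basis D (Suc n)"
    unfolding eq using chain_ext(2)[OF C \<psi> that] by simp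
qed

lemma lin_face: "lin (C (Suc n)) (C n) (fc (Suc n) i)"
  using inner_face(1)[of i n] last_face(1) by (cases "i < Suc n") (simp_all add: face_def less_Suc_eq_le)

lemma lin_boundary: "lin (C (Suc n)) (C n) (bd (Suc n))"
  unfolding hochschild_boundary_def
  by (simp only: diff_Suc_1) (intro lin_finsum lin_smult lin_face vspace_chain_space finite_atLeastAtMost)

end

section \<open>Presimplicial homotopies\<close>

text \<open>Here \<open>c i j\<close> stands for h_j d_i, \<open>b i j\<close> for d_i h_j, and
  \<open>w i\<close> for the common value of d_i h_i and d_i h_(i-1). The off-diagonal terms cancel
  in pairs and the diagonal telescopes. \<open>sg\<close> replaces the scalar (-1)^k, which a mere
  abelian group does not have.\<close>

lemma presimplicial_homotopy_sum:
  fixes c :: "nat \<Rightarrow> nat \<Rightarrow> 'p::ab_group_add" and w :: "nat \<Rightarrow> 'p"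
  defines "sg \<equiv> \<lambda>k x. if even (k::nat) then x else - x"
  defines "b \<equiv> \<lambda>i j. if i < j then c i (j - 1) else if i = j \<or> i = Suc j then w i else c (i - 1) j"
  shows "(\<Sum>i\<le>Suc n. sg i (\<Sum>j\<le>n. sg j (b i j))) + (\<Sum>j<n. sg j (\<Sum>i\<le>n. sg i (c i j))) = w 0 - w (Suc n)"
proof -
  have sg_sum: "sg k (sum f A) = (\<Sum>x\<in>A. sg k (f x))" for k f and A :: "nat set"
    by (simp add: sg_def sum_negf)
  have sg_sg: "sg i (sg j x) = sg (i + j) x" for i j x by (simp add: sg_def)
  have sg_Suc: "sg (Suc k) x = - sg k x" for k x by (simp add: sg_def)
  \<comment> \<open>Column j of \<open>c\<close> is cut at the diagonal: \<open>A j\<close> collects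
    the rows i \<le> j, which reappear in column j + 1 of \<open>b\<close>, and \<open>B j\<close>
    the rows i > j, which reappear in column j.\<close>
  define A where "A j = (\<Sum>i\<le>j. sg (i + j) (c i j))" for j
  define B where "B j = (\<Sum>i\<in>{Suc j..n}. sg (i + j) (c i j))" for j
  \<comment> \<open>Rows before j contribute -A (j - 1), rows j and j + 1 the difference of two
    values of \<open>w\<close>, and later rows -B j. The minus signs come from one index being
    shifted by one.\<close>
  have col: "(\<Sum>i\<le>Suc n. sg (i + j) (b i j)) = (w j - w (Suc j)) - (if j = 0 then 0 else A (j - 1)) - B j"
    if j: "j \<le> n" for j
  proof -
    have "{..Suc n} = {..<j} \<union> {j, Suc j} \<union> Suc ` {Suc j..n}"
      using j by (auto simp: image_Suc_atLeastAtMost)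
    then have "(\<Sum>i\<le>Suc n. sg (i + j) (b i j)) = (\<Sum>i<j. sg (i + j) (b i j))
       + (\<Sum>i\<in>{j, Suc j}. sg (i + j) (b i j)) + (\<Sum>i\<in>Suc ` {Suc j..n}. sg (i + j) (b i j))"
      by (simp only:) (subst sum.union_disjoint, (auto)[3], subst sum.union_disjoint, auto)
    moreover have "(\<Sum>i<j. sg (i + j) (b i j)) = - (if j = 0 then 0 else A (j - 1))"
    proof (cases j)
      case (Suc j')
      then show ?thesis
        by (simp add: A_def b_def sg_Suc sum_negf lessThan_Suc_atMost)
    qed simp
    moreover have "(\<Sum>i\<in>{j, Suc j}. sg (i + j) (b i j)) = w j - w (Suc j)"
      by (simp add: b_def sg_def)
    moreover have "(\<Sum>i\<in>Suc ` {Suc j..n}. sg (i + j) (b i j)) = - B j"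
      by (subst sum.reindex) (auto simp: B_def b_def sg_Suc sum_negf simp flip: sum_negf intro!: sum.cong)
    ultimately show ?thesis by simp
  qed
  have "(\<Sum>i\<le>Suc n. sg i (\<Sum>j\<le>n. sg j (b i j))) = (\<Sum>j\<le>n. \<Sum>i\<le>Suc n. sg (i + j) (b i j))"
    by (subst sum.swap) (simp add: sg_sum sg_sg)
  also have "\<dots> = (\<Sum>j\<le>n. (w j - w (Suc j)) - (if j = 0 then 0 else A (j - 1)) - B j)"
    by (rule sum.cong) (simp_all only: col atMost_iff)
  also have "\<dots> = (\<Sum>j\<le>n. w j - w (Suc j)) - (\<Sum>j\<le>n. if j = 0 then 0 else A (j - 1)) - (\<Sum>j\<le>n. B j)"
    by (simp add: sum_subtractf)
  also have "(\<Sum>j\<le>n. w j - w (Suc j)) = w 0 - w (Suc n)" by (rule sum_telescope)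
  also have "(\<Sum>j\<le>n. if j = 0 then 0 else A (j - 1)) = (\<Sum>j<n. A j)"
    by (cases n) (simp_all add: sum.atMost_Suc_shift lessThan_Suc_atMost del: sum.atMost_Suc sum.lessThan_Suc)
  \<comment> \<open>The sum \<open>B n\<close> is empty.\<close>
  also have "(\<Sum>j\<le>n. B j) = (\<Sum>j<n. B j)"
    by (simp add: B_def flip: lessThan_Suc_atMost)
  finally have 1: "(\<Sum>i\<le>Suc n. sg i (\<Sum>j\<le>n. sg j (b i j))) = w 0 - w (Suc n) - (\<Sum>j<n. A j) - (\<Sum>j<n. B j)" .
  have "sg j (\<Sum>i\<le>n. sg i (c i j)) = A j + B j" if "j < n" for j
  proof -
    have "{..n} = {..j} \<union> {Suc j..n}" using that by auto
    then have "(\<Sum>i\<le>n. sg (i + j) (c i j)) = A j + B j"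
      unfolding A_def B_def by (simp only:) (subst sum.union_disjoint, auto)
    then show ?thesis by (simp add: sg_sum sg_sg add.commute)
  qed
  then have "(\<Sum>j<n. sg j (\<Sum>i\<le>n. sg i (c i j))) = (\<Sum>j<n. A j) + (\<Sum>j<n. B j)"
    by (simp add: sum.distrib)
  with 1 show ?thesis by simp
qed

lemma finsum_free_space_UNIV:
  fixes f :: "'i \<Rightarrow> ('x \<Rightarrow>\<^sub>0 'k::field)"
  assumes "finite A" shows "finsum (free_space UNIV) f A = sum f A"
proof -
  interpret F: vectorspace class_ring "free_space UNIV :: ('k, 'x \<Rightarrow>\<^sub>0 'k) module" by (rule vspace_free_space)
  show ?thesis using assms
    by (induction A rule: finite_induct) (simp_all add: F.module.M.finsum_insert)
qed

lemma lin_sum_apply: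
  assumes "lin (free_space UNIV) W L" "finite A"
  shows "L (sum f A) = finsum W (\<lambda>x. L (f x)) A"
  using lin_finsum_apply[OF assms, of f] by (simp add: finsum_free_space_UNIV[OF assms(2)])

text \<open>The sum identity is proved for formal symbols, in a type that is an abelian group, and
  carried into the record \<open>W\<close> by the linear map that sends each symbol to its
  value.\<close>

lemma presimplicial_homotopy:
  fixes W :: "('k::field, 'w) module"
  assumes W: "vspace W"
    and a: "\<And>i j. \<lbrakk>i \<le> Suc n; j \<le> n\<rbrakk> \<Longrightarrow> a i j \<in> carrier W"
    and c: "\<And>i j. \<lbrakk>i \<le> n; j < n\<rbrakk> \<Longrightarrow> c i j \<in> carrier W"
    and lower: "\<And>i j. \<lbrakk>i \<le> j; j < n\<rbrakk> \<Longrightarrow> a i (Suc j) = c i j"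
    and diag: "\<And>j. j < n \<Longrightarrow> a (Suc j) (Suc j) = a (Suc j) j"
    and upper: "\<And>i j. \<lbrakk>j < i; i \<le> n\<rbrakk> \<Longrightarrow> a (Suc i) j = c i j"
  shows "finsum W (\<lambda>i. (- 1) ^ i \<odot>\<^bsub>W\<^esub> finsum W (\<lambda>j. (- 1) ^ j \<odot>\<^bsub>W\<^esub> a i j) {..n}) {..Suc n}
    \<oplus>\<^bsub>W\<^esub> finsum W (\<lambda>j. (- 1) ^ j \<odot>\<^bsub>W\<^esub> finsum W (\<lambda>i. (- 1) ^ i \<odot>\<^bsub>W\<^esub> c i j) {..n}) {..<n}
    = a 0 0 \<ominus>\<^bsub>W\<^esub> a (Suc n) n"
proof -
  interpret W: vectorspace class_ring W by (rule W)
  \<comment> \<open>The column index stops at n, so the last symbol cannot be read off the diagonal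
    and stands for d_(n+1) h_n.\<close>
  define w where "w i = (if i \<le> n then a i i else a (Suc n) n)" for i
  \<comment> \<open>Symbols outside the index range are sent to zero, so that every value lies in
    the carrier.\<close>
  define \<phi> where "\<phi> x = (case x of Inl (i, j) \<Rightarrow> if i \<le> n \<and> j < n then c i j else \<zero>\<^bsub>W\<^esub>
    | Inr i \<Rightarrow> w i)" for x :: "nat \<times> nat + nat"
  have \<phi>: "\<phi> x \<in> carrier W" for x
    using a c by (auto simp: \<phi>_def w_def split: sum.splits prod.splits)
  let ?L = "free_ext W \<phi>"
  have L: "lin (free_space UNIV) W ?L" by (rule lin_free_ext[OF W]) (use \<phi> in auto)
  define s :: "nat \<times> nat + nat \<Rightarrow> (nat \<times> nat + nat) \<Rightarrow>\<^sub>0 'k" where "s x = Poly_Mapping.single x 1" for x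
  have Ls: "?L (s x) = \<phi> x" for x
    by (simp add: s_def free_ext_single[OF W] \<phi> vspaceD(6)[OF W])
  define sg where "sg k x = (if even (k::nat) then x else - x)" for k and x :: "(nat \<times> nat + nat) \<Rightarrow>\<^sub>0 'k"
  define b where "b i j = (if i < j then s (Inl (i, j - 1)) else if i = j \<or> i = Suc j then s (Inr i)
    else s (Inl (i - 1, j)))" for i j
  have sg: "?L (sg k x) = (- 1) ^ k \<odot>\<^bsub>W\<^esub> ?L x" for k x
  proof -
    have "sg k x = (- 1) ^ k \<odot>\<^bsub>free_space UNIV\<^esub> x"
      by (rule poly_mapping_eqI) (simp add: sg_def minus_one_power_iff)
    then show ?thesis using linD(5)[OF L, of x] by simp
  qed
  have b: "?L (b i j) = a i j" if ij: "i \<le> Suc n" "j \<le> n" for i j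
  proof -
    consider "i < j" | "i = j" | "i = Suc j" | "Suc j < i" by linarith
    then show ?thesis
    proof cases
      case 1
      then obtain j' where "j = Suc j'" by (cases j) auto
      then show ?thesis using 1 ij lower[of i j'] by (simp add: b_def Ls \<phi>_def)
    next
      case 3
      then show ?thesis using ij diag[of j] by (cases "j = n") (simp_all add: b_def Ls \<phi>_def w_def)
    next
      case 4
      then obtain i' where "i = Suc i'" by (cases i) auto
      then show ?thesis using 4 ij upper[of j i'] by (simp add: b_def Ls \<phi>_def)
    qed (use ij in \<open>simp add: b_def Ls \<phi>_def w_def\<close>)
  qed
  have "finsum W (\<lambda>i. (- 1) ^ i \<odot>\<^bsub>W\<^esub> finsum W (\<lambda>j. (- 1) ^ j \<odot>\<^bsub>W\<^esub> a i j) {..n}) {..Suc n}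
      = ?L (\<Sum>i\<le>Suc n. sg i (\<Sum>j\<le>n. sg j (b i j)))"
    unfolding lin_sum_apply[OF L finite_atMost] sg
    by (intro W.module.M.finsum_cong' Pi_I vspaceD(5)[OF W] W.module.M.finsum_closed refl
        arg_cong2[where f = "smult W"]) (auto simp: b[symmetric] linD(3)[OF L])
  moreover have "finsum W (\<lambda>j. (- 1) ^ j \<odot>\<^bsub>W\<^esub> finsum W (\<lambda>i. (- 1) ^ i \<odot>\<^bsub>W\<^esub> c i j) {..n}) {..<n}
      = ?L (\<Sum>j<n. sg j (\<Sum>i\<le>n. sg i (s (Inl (i, j)))))"
    unfolding lin_sum_apply[OF L finite_atMost] lin_sum_apply[OF L finite_lessThan] sg
    by (intro W.module.M.finsum_cong' Pi_I vspaceD(5)[OF W] W.module.M.finsum_closed refl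
        arg_cong2[where f = "smult W"]) (auto simp: Ls \<phi> \<phi>_def c)
  moreover have "?L p \<oplus>\<^bsub>W\<^esub> ?L q = ?L (p + q)" for p q
    using linD(4)[OF L, of p q] by simp
  moreover have "(\<Sum>i\<le>Suc n. sg i (\<Sum>j\<le>n. sg j (b i j))) + (\<Sum>j<n. sg j (\<Sum>i\<le>n. sg i (s (Inl (i, j)))))
      = sg 0 (s (Inr 0)) + sg 1 (s (Inr (Suc n)))"
    using presimplicial_homotopy_sum[where c = "\<lambda>i j. s (Inl (i, j))" and w = "\<lambda>i. s (Inr i)" and n = n]
    by (simp add: sg_def b_def)
  moreover have "?L (sg 0 (s (Inr 0)) + sg 1 (s (Inr (Suc n)))) = a 0 0 \<ominus>\<^bsub>W\<^esub> a (Suc n) n"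
  proof -
    have "?L (sg 0 (s (Inr 0)) + sg 1 (s (Inr (Suc n)))) = ?L (sg 0 (s (Inr 0))) \<oplus>\<^bsub>W\<^esub> ?L (sg 1 (s (Inr (Suc n))))"
      using linD(4)[OF L] by simp
    then show ?thesis using a[of 0 0] a[of "Suc n" n] unfolding sg
      by (simp add: Ls \<phi>_def w_def vspaceD(6,9)[OF W] W.module.M.minus_eq)
  qed
  ultimately show ?thesis by simp
qed

section \<open>Multilinear extension\<close>

definition list_multilinear ::
  "('k::field, 'v) module list \<Rightarrow> ('k, 'w) module \<Rightarrow> ('v list \<Rightarrow> 'w) \<Rightarrow> bool" where
  "list_multilinear Vs U F \<longleftrightarrow> (\<forall>ts. list_all2 (\<lambda>V t. t \<in> carrier V) Vs ts \<longrightarrow>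
     F ts \<in> carrier U \<and> (\<forall>i<length Vs. lin (Vs ! i) U (\<lambda>t. F (ts[i := t]))))"

text \<open>The recursive form used for inductions. The guard on the head is there because the left
  side says nothing when the carrier of \<open>V\<close> is empty.\<close>

lemma list_multilinear_Cons:
  "list_multilinear (V # Vs) U F \<longleftrightarrow>
    (\<forall>ts. list_all2 (\<lambda>V t. t \<in> carrier V) Vs ts \<longrightarrow> (\<exists>t. t \<in> carrier V) \<longrightarrow> lin V U (\<lambda>t. F (t # ts))) \<and>
    (\<forall>t\<in>carrier V. list_multilinear Vs U (\<lambda>ts. F (t # ts)))"
  (is "?L \<longleftrightarrow> ?A \<and> ?B")
proof
  assume L: ?L
  show "?A \<and> ?B"
  proof (intro conjI allI impI ballI)
    fix ts assume ts: "list_all2 (\<lambda>V t. t \<in> carrier V) Vs ts" "\<exists>t. t \<in> carrier V"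
    then obtain t where "t \<in> carrier V" by blast
    with L ts(1) show "lin V U (\<lambda>t. F (t # ts))"
      unfolding list_multilinear_def by (elim allE[of _ "t # ts"]) (auto dest: spec[of _ 0])
  next
    fix t assume t: "t \<in> carrier V"
    show "list_multilinear Vs U (\<lambda>ts. F (t # ts))"
      unfolding list_multilinear_def
    proof (intro allI impI conjI)
      fix ts assume "list_all2 (\<lambda>V t. t \<in> carrier V) Vs ts"
      then have *: "list_all2 (\<lambda>V t. t \<in> carrier V) (V # Vs) (t # ts)" using t by simp
      show "F (t # ts) \<in> carrier U" using L * unfolding list_multilinear_def by blast
      fix i assume "i < length Vs"
      then show "lin (Vs ! i) U (\<lambda>s. F (t # ts[i := s]))"
        using L[unfolded list_multilinear_def, rule_format, OF *, THEN conjunct2, rule_format, of "Suc i"]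
        by simp
    qed
  qed
next
  assume AB: "?A \<and> ?B"
  show ?L unfolding list_multilinear_def
  proof (intro allI impI)
    fix ts assume "list_all2 (\<lambda>V t. t \<in> carrier V) (V # Vs) ts"
    then obtain t us where ts: "ts = t # us" "t \<in> carrier V" "list_all2 (\<lambda>V t. t \<in> carrier V) Vs us"
      by (auto simp: list_all2_Cons1)
    have A: "lin V U (\<lambda>t. F (t # us))" using AB ts by blast
    have B: "list_multilinear Vs U (\<lambda>ts. F (t # ts))" using AB ts by blast
    show "F ts \<in> carrier U \<and> (\<forall>i<length (V # Vs). lin ((V # Vs) ! i) U (\<lambda>t. F (ts[i := t])))"
      using A B ts unfolding list_multilinear_def by (auto simp: less_Suc_eq_0_disj)
  qed
qed

text \<open>The condition under which a function of lists of pairs factors, slot by slot, through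
  the tensor products with \<open>N\<close>.\<close>

definition list_bilinear :: "('k::field, 'b) module \<Rightarrow> ('k, 'w) module \<Rightarrow> ('k, 'v) module list \<Rightarrow> (('v \<times> 'b) list \<Rightarrow> 'w) \<Rightarrow> bool" where
  "list_bilinear N U Vs \<phi> \<longleftrightarrow> (\<forall>ps. list_all2 (\<lambda>V p. p \<in> carrier V \<times> carrier N) Vs ps \<longrightarrow>
     \<phi> ps \<in> carrier U \<and> (\<forall>i<length Vs. bilinear_map (Vs ! i) N U (\<lambda>f B. \<phi> (ps[i := (f, B)]))))"

context
  fixes N :: "('k::field, 'b) module" and U :: "('k, 'w) module"
  assumes N: "vspace N" and U: "vspace U"
begin

lemma list_bilinear_ConsD:
  assumes "list_bilinear N U (V # Vs) \<phi>"
  shows "p \<in> carrier V \<times> carrier N \<Longrightarrow> list_bilinear N U Vs (\<lambda>ps. \<phi> (p # ps))"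
    and "list_all2 (\<lambda>V p. p \<in> carrier V \<times> carrier N) Vs ps \<Longrightarrow> p \<in> carrier V \<times> carrier N \<Longrightarrow>
      bilinear_map V N U (\<lambda>f B. \<phi> ((f, B) # ps))"
proof -
  show "list_bilinear N U Vs (\<lambda>ps. \<phi> (p # ps))" if p: "p \<in> carrier V \<times> carrier N"
    unfolding list_bilinear_def
  proof (intro allI impI conjI)
    fix ps assume "list_all2 (\<lambda>V p. p \<in> carrier V \<times> carrier N) Vs ps"
    then have *: "list_all2 (\<lambda>V p. p \<in> carrier V \<times> carrier N) (V # Vs) (p # ps)" using p by simp
    show "\<phi> (p # ps) \<in> carrier U" using assms * unfolding list_bilinear_def by blast
    fix i assume "i < length Vs"
    then show "bilinear_map (Vs ! i) N U (\<lambda>f B. \<phi> (p # ps[i := (f, B)]))"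
      using assms[unfolded list_bilinear_def, rule_format, OF *, THEN conjunct2, rule_format, of "Suc i"]
      by simp
  qed
  show "bilinear_map V N U (\<lambda>f B. \<phi> ((f, B) # ps))"
    if "list_all2 (\<lambda>V p. p \<in> carrier V \<times> carrier N) Vs ps" "p \<in> carrier V \<times> carrier N"
  proof -
    have *: "list_all2 (\<lambda>V p. p \<in> carrier V \<times> carrier N) (V # Vs) (p # ps)" using that by simp
    show ?thesis
      using assms[unfolded list_bilinear_def, rule_format, OF *, THEN conjunct2, rule_format, of 0] by simp
  qed
qed

text \<open>The nested extensions choose their representatives from the fixed list
  \<open>ts\<close>, so \<open>lin_lin_ext_param\<close> applies at each level.\<close>

lemma lin_multi_ext_param:
  assumes X: "vspace X" and Vs: "\<forall>V\<in>set Vs. vspace V"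
    and ts: "list_all2 (\<lambda>V t. t \<in> carrier (tensor V N)) Vs ts"
    and l: "\<And>ps. list_all2 (\<lambda>V p. p \<in> carrier V \<times> carrier N) Vs ps \<Longrightarrow> lin X U (\<lambda>x. \<phi> x ps)"
  shows "lin X U (\<lambda>x. multi_ext U (\<phi> x) ts)"
  using Vs ts l
proof (induction Vs arbitrary: ts \<phi>)
  case Nil
  then show ?case by simp
next
  case (Cons V Vs)
  then obtain t us where ts: "ts = t # us" "t \<in> carrier (tensor V N)"
    "list_all2 (\<lambda>V t. t \<in> carrier (tensor V N)) Vs us" by (auto simp: list_all2_Cons1)
  interpret T: tensor_pair V N by (rule tensor_pair.intro) (use Cons.prems(1) N in auto)
  show ?case unfolding ts(1) multi_ext.simps
  proof (rule lin_lin_ext_param[OF T.relators ts(2)[unfolded tensor_def] X U])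
    fix p assume p: "p \<in> carrier V \<times> carrier N"
    show "lin X U (\<lambda>x. multi_ext U (\<lambda>xs. \<phi> x (p # xs)) us)"
    proof (rule Cons.IH)
      show "\<forall>V\<in>set Vs. vspace V" using Cons.prems(1) by simp
      show "lin X U (\<lambda>x. \<phi> x (p # ps))"
        if "list_all2 (\<lambda>V p. p \<in> carrier V \<times> carrier N) Vs ps" for ps
        by (rule Cons.prems(3)) (use that p in simp)
    qed (rule ts(3))
  qed
qed

text \<open>Universal property for lists of tensors, one factor at a time. \<open>\<phi>\<close>
  varies in the induction because a chosen head pair is absorbed into it.\<close>

lemma multi_ext:
  assumes Vs: "\<forall>V\<in>set Vs. vspace V" and \<phi>: "list_bilinear N U Vs \<phi>"
  shows "list_multilinear (map (\<lambda>V. tensor V N) Vs) U (multi_ext U \<phi>)"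
    and "list_all2 (\<lambda>V p. p \<in> carrier V \<times> carrier N) Vs ps \<Longrightarrow>
      multi_ext U \<phi> (map2 (\<lambda>V (f, B). tens V N f B) Vs ps) = \<phi> ps"
proof -
  have "list_multilinear (map (\<lambda>V. tensor V N) Vs) U (multi_ext U \<phi>) \<and>
    (\<forall>ps. list_all2 (\<lambda>V p. p \<in> carrier V \<times> carrier N) Vs ps \<longrightarrow>
      multi_ext U \<phi> (map2 (\<lambda>V (f, B). tens V N f B) Vs ps) = \<phi> ps)"
    using Vs \<phi>
  proof (induction Vs arbitrary: \<phi>)
    case Nil
    then show ?case by (simp add: list_multilinear_def list_bilinear_def)
  next
    case (Cons V Vs)
    have V: "vspace V" and Vs: "\<forall>V\<in>set Vs. vspace V" using Cons.prems(1) by auto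
    interpret T: tensor_pair V N by (rule tensor_pair.intro[OF V N])
    note b = list_bilinear_ConsD[OF Cons.prems(2)]
    note IH = Cons.IH[OF Vs b(1)]
    interpret V: vectorspace class_ring V by (rule V)
    interpret N: vectorspace class_ring N by (rule N)
    \<comment> \<open>Bilinearity in the head is obtained by updating slot 0 of a full list, so some
      head pair must be at hand.\<close>
    have 0: "(\<zero>\<^bsub>V\<^esub>, \<zero>\<^bsub>N\<^esub>) \<in> carrier V \<times> carrier N" by simp
    have bil: "bilinear_map V N U (\<lambda>f B. multi_ext U (\<lambda>xs. \<phi> ((f, B) # xs)) ts)"
      if ts: "list_all2 (\<lambda>V t. t \<in> carrier (tensor V N)) Vs ts" for ts
      unfolding bilinear_map_def
    proof (intro conjI ballI)
      show "lin N U (\<lambda>B. multi_ext U (\<lambda>xs. \<phi> ((f, B) # xs)) ts)" if "f \<in> carrier V" for f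
        by (rule lin_multi_ext_param[OF N Vs ts]) (use bilinear_mapD(1)[OF b(2)[OF _ 0] that] in blast)
      show "lin V U (\<lambda>f. multi_ext U (\<lambda>xs. \<phi> ((f, B) # xs)) ts)" if "B \<in> carrier N" for B
        by (rule lin_multi_ext_param[OF V Vs ts]) (use bilinear_mapD(2)[OF b(2)[OF _ 0] that] in blast)
    qed
    show ?case
    proof (intro conjI allI impI)
      show "list_multilinear (map (\<lambda>V. tensor V N) (V # Vs)) U (multi_ext U \<phi>)"
        unfolding list.map list_multilinear_Cons multi_ext.simps
      proof (intro conjI allI impI ballI)
        fix ts assume "list_all2 (\<lambda>V t. t \<in> carrier V) (map (\<lambda>V. tensor V N) Vs) ts"
        then have ts: "list_all2 (\<lambda>V t. t \<in> carrier (tensor V N)) Vs ts" by (simp add: list_all2_map1)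
        show "lin (tensor V N) U (\<lambda>t. lin_ext U (\<lambda>x. multi_ext U (\<lambda>xs. \<phi> (x # xs)) ts) t)"
          by (rule T.tensor_ext(1)[OF U bil[OF ts]])
      next
        fix t assume t: "t \<in> carrier (tensor V N)"
        note t' = t[unfolded tensor_def]
        show "list_multilinear (map (\<lambda>V. tensor V N) Vs) U
            (\<lambda>ts. lin_ext U (\<lambda>x. multi_ext U (\<lambda>xs. \<phi> (x # xs)) ts) t)"
          unfolding list_multilinear_def
        proof (intro allI impI conjI)
          fix ts assume ts: "list_all2 (\<lambda>V t. t \<in> carrier V) (map (\<lambda>V. tensor V N) Vs) ts"
          note IH' = IH[THEN conjunct1, unfolded list_multilinear_def, rule_format, OF _ ts]
          show "lin_ext U (\<lambda>x. multi_ext U (\<lambda>xs. \<phi> (x # xs)) ts) t \<in> carrier U"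
            by (rule lin_ext_closed[OF T.relators t' U]) (use IH' in blast)
          fix i assume i: "i < length (map (\<lambda>V. tensor V N) Vs)"
          have *: "vspace (map (\<lambda>V. tensor V N) Vs ! i)"
            using i Vs N by (auto intro!: tensor_pair.vspace_tensor tensor_pair.intro)
          show "lin (map (\<lambda>V. tensor V N) Vs ! i) U
              (\<lambda>s. lin_ext U (\<lambda>x. multi_ext U (\<lambda>xs. \<phi> (x # xs)) (ts[i := s])) t)"
            by (rule lin_lin_ext_param[OF T.relators t' * U]) (use IH' i in blast)
        qed
      qed
    next
      fix ps assume "list_all2 (\<lambda>V p. p \<in> carrier V \<times> carrier N) (V # Vs) ps"
      then obtain f B qs where ps: "ps = (f, B) # qs" "f \<in> carrier V" "B \<in> carrier N"
        "list_all2 (\<lambda>V p. p \<in> carrier V \<times> carrier N) Vs qs" by (auto simp: list_all2_Cons1)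
      have ts: "list_all2 (\<lambda>V t. t \<in> carrier (tensor V N)) Vs (map2 (\<lambda>V (f, B). tens V N f B) Vs qs)"
        unfolding list_all2_conv_all_nth
      proof (intro conjI allI impI)
        fix i assume i: "i < length Vs"
        have "vspace (Vs ! i)" using Vs i by simp
        then interpret Ti: tensor_pair "Vs ! i" N by (intro tensor_pair.intro N)
        show "map2 (\<lambda>V (f, B). tens V N f B) Vs qs ! i \<in> carrier (tensor (Vs ! i) N)"
          using i ps(4) list_all2_nthD[OF ps(4) i] Ti.tens_closed by (auto simp: list_all2_lengthD split: prod.splits)
      qed (use ps(4) in \<open>simp add: list_all2_lengthD\<close>)
      have "multi_ext U \<phi> (map2 (\<lambda>V (f, B). tens V N f B) (V # Vs) ps)
        = multi_ext U (\<lambda>xs. \<phi> ((f, B) # xs)) (map2 (\<lambda>V (f, B). tens V N f B) Vs qs)"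
        using T.tensor_ext(2)[OF U bil[OF ts] ps(2,3)] by (simp add: ps(1))
      also have "\<dots> = \<phi> ((f, B) # qs)" using IH ps by blast
      finally show "multi_ext U \<phi> (map2 (\<lambda>V (f, B). tens V N f B) (V # Vs) ps) = \<phi> ps"
        by (simp add: ps(1))
    qed
  qed
  then show "list_multilinear (map (\<lambda>V. tensor V N) Vs) U (multi_ext U \<phi>)"
    and "list_all2 (\<lambda>V p. p \<in> carrier V \<times> carrier N) Vs ps \<Longrightarrow>
      multi_ext U \<phi> (map2 (\<lambda>V (f, B). tens V N f B) Vs ps) = \<phi> ps" by blast+
qed

text \<open>Linearity in the head allows the first tensor to be taken pure; with that head fixed,
  the tail is handled by induction.\<close>

lemma list_multilinear_eqI:
  assumes Vs: "\<forall>V\<in>set Vs. vspace V"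
    and F: "list_multilinear (map (\<lambda>V. tensor V N) Vs) U F"
    and G: "list_multilinear (map (\<lambda>V. tensor V N) Vs) U G"
    and eq: "\<And>ps. list_all2 (\<lambda>V p. p \<in> carrier V \<times> carrier N) Vs ps \<Longrightarrow>
      F (map2 (\<lambda>V (f, B). tens V N f B) Vs ps) = G (map2 (\<lambda>V (f, B). tens V N f B) Vs ps)"
    and ts: "list_all2 (\<lambda>V t. t \<in> carrier (tensor V N)) Vs ts"
  shows "F ts = G ts"
  using assms
proof (induction Vs arbitrary: F G ts)
  case Nil
  then show ?case using Nil.prems(4)[of "[]"] by simp
next
  case (Cons V Vs)
  then obtain t us where ts: "ts = t # us" "t \<in> carrier (tensor V N)"
    "list_all2 (\<lambda>V t. t \<in> carrier (tensor V N)) Vs us" by (auto simp: list_all2_Cons1)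
  have V: "vspace V" and Vs: "\<forall>V\<in>set Vs. vspace V" using Cons.prems(1) by auto
  interpret T: tensor_pair V N by (rule tensor_pair.intro[OF V N])
  note FG = Cons.prems(2,3)[unfolded list.map list_multilinear_Cons]
  have us: "list_all2 (\<lambda>V t. t \<in> carrier V) (map (\<lambda>V. tensor V N) Vs) us"
    using ts(3) by (simp add: list_all2_map1)
  have lins: "lin (tensor V N) U (\<lambda>t. F (t # us))" "lin (tensor V N) U (\<lambda>t. G (t # us))"
    using FG us ts(2) by blast+
  show ?case unfolding ts(1)
  proof (rule T.lin_tensor_eqI[OF lins _ ts(2)])
    fix v B assume vB: "v \<in> carrier V" "B \<in> carrier N"
    note c = T.tens_closed[OF vB]
    show "F (tens V N v B # us) = G (tens V N v B # us)"
    proof (rule Cons.IH[OF Vs _ _ _ ts(3)])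
      show "list_multilinear (map (\<lambda>V. tensor V N) Vs) U (\<lambda>us. F (tens V N v B # us))"
        "list_multilinear (map (\<lambda>V. tensor V N) Vs) U (\<lambda>us. G (tens V N v B # us))"
        using FG c by blast+
      show "F (tens V N v B # map2 (\<lambda>V (f, B). tens V N f B) Vs ps)
          = G (tens V N v B # map2 (\<lambda>V (f, B). tens V N f B) Vs ps)"
        if "list_all2 (\<lambda>V p. p \<in> carrier V \<times> carrier N) Vs ps" for ps
        using Cons.prems(4)[of "(v, B) # ps"] that vB by simp
    qed
  qed
qed

end

section \<open>Chains of the matrix category\<close>

lemma vspace_matrix: "vspace (matrix_space r :: ('k::field, 'k mat) module)"
  by (rule matrix_vs)

lemma vspace_nonempty:
  assumes "vspace V" shows "\<exists>v. v \<in> carrier V"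
proof -
  interpret vectorspace class_ring V by fact
  show ?thesis using module.M.zero_closed by blast
qed

lemma matrix_mult_bilinear:
  "bilinear_map (matrix_space r) (matrix_space r) (matrix_space r :: ('k::field, 'k mat) module) (*)"
  unfolding bilinear_map_def
  by (intro conjI ballI linI vspace_matrix)
    (auto simp: module_mat_simps mult_add_distrib_mat add_mult_distrib_mat mult_smult_distrib mult_smult_assoc_mat)

lemma bilinear_map_comp:
  assumes "bilinear_map U V W \<phi>" "lin U' U f" "lin V' V g"
  shows "bilinear_map U' V' W (\<lambda>u v. \<phi> (f u) (g v))"
  unfolding bilinear_map_def
  by (intro conjI ballI lin_comp[OF assms(3) bilinear_mapD(1)[OF assms(1)]]
      lin_comp[OF assms(2) bilinear_mapD(2)[OF assms(1)]] linD(3)[OF assms(2)] linD(3)[OF assms(3)])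

locale matrix_chains = hochschild M D H S \<rho>
  for M :: "('k::field, 'm) module" and D :: "('o, 'k, 'f, 'h) H_cat"
    and H :: "('k, 'h) module" and S :: "'h \<Rightarrow> 'h" and \<rho> :: "'m \<Rightarrow> ('h \<times> 'm \<Rightarrow>\<^sub>0 'k) set" +
  fixes r :: nat
begin

abbreviation N :: "('k, 'k mat) module" where "N \<equiv> matrix_space r"
abbreviation "MC \<equiv> matrix_category r D"

lemma N: "vspace N" by (rule vspace_matrix)

lemma vspace_Hom: "X \<in> Obj D \<Longrightarrow> Y \<in> Obj D \<Longrightarrow> vspace (Hom D X Y)"
  using D by (simp add: hom_spaces_def)

lemma tensor_Hom: "X \<in> Obj D \<Longrightarrow> Y \<in> Obj D \<Longrightarrow> tensor_pair (Hom D X Y) N"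
  by (intro tensor_pair.intro vspace_Hom N)

lemma MC_simps [simp]:
  "Obj MC = Obj D" "Hom MC X Y = tensor (Hom D X Y) N" "hom_at MC Xs i = tensor (hom_at D Xs i) N"
  by (simp_all add: matrix_category_def Let_def hom_at_def)

lemma hom_spaces_MC: "hom_spaces MC"
  by (auto simp: hom_spaces_def intro: tensor_pair.vspace_tensor tensor_Hom)

lemma Comp_MC:
  assumes O: "X \<in> Obj D" "Y \<in> Obj D" "Z \<in> Obj D"
  shows "bilinear_map (Hom MC Y Z) (Hom MC X Y) (Hom MC X Z) (Comp MC X Y Z)"
    and "\<lbrakk>g \<in> carrier (Hom D Y Z); f \<in> carrier (Hom D X Y); B \<in> carrier N; B' \<in> carrier N\<rbrakk> \<Longrightarrow>
      Comp MC X Y Z (tens (Hom D Y Z) N g B) (tens (Hom D X Y) N f B')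
      = tens (Hom D X Z) N (Comp D X Y Z g f) (B * B')"
proof -
  let ?T = "tensor (Hom D X Z) N" and ?Vs = "[Hom D Y Z, Hom D X Y]"
  interpret T: tensor_pair "Hom D X Z" N by (rule tensor_Hom[OF O(1,3)])
  interpret YZ: tensor_pair "Hom D Y Z" N by (rule tensor_Hom[OF O(2,3)])
  interpret XY: tensor_pair "Hom D X Y" N by (rule tensor_Hom[OF O(1,2)])
  define \<phi> where "\<phi> ps = tens (Hom D X Z) N (Comp D X Y Z (fst (ps ! 0)) (fst (ps ! 1))) (snd (ps ! 0) * snd (ps ! 1))"
    for ps :: "('f \<times> 'k mat) list"
  note U = T.vspace_tensor
  note c = bilinear_mapD[OF comp[OF O]] and m = bilinear_mapD[OF matrix_mult_bilinear[where 'k = 'k, of r]]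
  \<comment> \<open>Composition is the extension for lists of length two, so
    \<open>multi_ext\<close> yields both bilinearity and the value on pure tensors.\<close>
  have eq: "Comp MC X Y Z u v = multi_ext ?T \<phi> [u, v]" for u v
    by (simp add: matrix_category_def Let_def \<phi>_def case_prod_unfold)
  have Vs: "\<forall>V\<in>set ?Vs. vspace V" using vspace_Hom O by simp
  have \<phi>: "list_bilinear N ?T ?Vs \<phi>"
    unfolding list_bilinear_def
  proof (intro allI impI conjI)
    fix ps assume "list_all2 (\<lambda>V p. p \<in> carrier V \<times> carrier N) ?Vs ps"
    then obtain g B f B' where ps: "ps = [(g, B), (f, B')]"
      "g \<in> carrier (Hom D Y Z)" "f \<in> carrier (Hom D X Y)" "B \<in> carrier N" "B' \<in> carrier N"
      by (auto simp: list_all2_Cons1)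
    show "\<phi> ps \<in> carrier ?T" using ps c(3) m(3) T.tens_closed by (auto simp: \<phi>_def)
    fix i assume "i < length ?Vs"
    then consider "i = 0" | "i = 1" by fastforce
    then show "bilinear_map (?Vs ! i) N ?T (\<lambda>f B. \<phi> (ps[i := (f, B)]))"
      by cases (use bilinear_map_comp[OF T.tens_bilinear c(2)[OF ps(3)] m(2)[OF ps(5)]]
          bilinear_map_comp[OF T.tens_bilinear c(1)[OF ps(2)] m(1)[OF ps(4)]] in \<open>simp_all add: ps \<phi>_def\<close>)
  qed
  note M = multi_ext[OF N U Vs \<phi>]
  show "bilinear_map (Hom MC Y Z) (Hom MC X Y) (Hom MC X Z) (Comp MC X Y Z)"
    unfolding bilinear_map_def MC_simps eq
  proof (intro conjI ballI)
    fix u assume u: "u \<in> carrier (tensor (Hom D Y Z) N)"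
    show "lin (tensor (Hom D X Y) N) ?T (\<lambda>v. multi_ext ?T \<phi> [u, v])"
    proof -
      have *: "list_multilinear [tensor (Hom D X Y) N] ?T (\<lambda>ts. multi_ext ?T \<phi> (u # ts))"
        using M(1)[unfolded list.map list_multilinear_Cons[of "tensor (Hom D Y Z) N"]] u by blast
      show ?thesis
        by (rule *[unfolded list_multilinear_Cons, THEN conjunct1, rule_format, of "[]"])
          (use vspace_nonempty[OF XY.vspace_tensor] in simp_all)
    qed
  next
    fix v assume v: "v \<in> carrier (tensor (Hom D X Y) N)"
    have "lin (tensor (Hom D Y Z) N) ?T (\<lambda>u. multi_ext ?T \<phi> (u # [v]))" if "u \<in> carrier (tensor (Hom D Y Z) N)" for u
      using M(1)[unfolded list.map list_multilinear_Cons[of "tensor (Hom D Y Z) N"], THEN conjunct1, rule_format, of "[v]"] v that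
      by auto
    then show "lin (tensor (Hom D Y Z) N) ?T (\<lambda>u. multi_ext ?T \<phi> [u, v])"
      using vspace_nonempty[OF YZ.vspace_tensor] by blast
  qed
  show "Comp MC X Y Z (tens (Hom D Y Z) N g B) (tens (Hom D X Y) N f B')
      = tens (Hom D X Z) N (Comp D X Y Z g f) (B * B')"
    if "g \<in> carrier (Hom D Y Z)" "f \<in> carrier (Hom D X Y)" "B \<in> carrier N" "B' \<in> carrier N"
    unfolding eq using M(2)[of "[(g, B), (f, B')]"] that by (simp add: \<phi>_def del: multi_ext.simps)
qed

lemma Act_MC:
  assumes O: "X \<in> Obj D" "Y \<in> Obj D"
  shows "bilinear_map H (Hom MC X Y) (Hom MC X Y) (Act MC X Y)"
    and "\<lbrakk>a \<in> carrier H; f \<in> carrier (Hom D X Y); B \<in> carrier N\<rbrakk> \<Longrightarrow>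
      Act MC X Y a (tens (Hom D X Y) N f B) = tens (Hom D X Y) N (Act D X Y a f) B"
proof -
  interpret T: tensor_pair "Hom D X Y" N by (rule tensor_Hom[OF O])
  note U = T.vspace_tensor and b = bilinear_mapD[OF act[OF O]] and t = bilinear_mapD[OF T.tens_bilinear]
  have eq: "Act MC X Y a = lin_ext (tensor (Hom D X Y) N) (\<lambda>(f, B). tens (Hom D X Y) N (Act D X Y a f) B)" for a
    by (simp add: matrix_category_def Let_def)
  have bil: "bilinear_map (Hom D X Y) N (tensor (Hom D X Y) N)
      (\<lambda>f B. case (f, B) of (f, B) \<Rightarrow> tens (Hom D X Y) N (Act D X Y a f) B)" if "a \<in> carrier H" for a
    unfolding prod.case by (rule bilinear_map_comp[OF T.tens_bilinear b(1)[OF that] lin_id[OF N]])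
  show "bilinear_map H (Hom MC X Y) (Hom MC X Y) (Act MC X Y)"
    unfolding bilinear_map_def MC_simps
  proof (intro conjI ballI)
    show "lin (tensor (Hom D X Y) N) (tensor (Hom D X Y) N) (Act MC X Y a)" if "a \<in> carrier H" for a
      unfolding eq by (rule T.tensor_ext(1)[OF U bil[OF that]])
    show "lin H (tensor (Hom D X Y) N) (\<lambda>a. Act MC X Y a u)" if u: "u \<in> carrier (tensor (Hom D X Y) N)" for u
      unfolding eq
      by (rule lin_lin_ext_param[OF T.relators u[unfolded tensor_def] H U])
        (auto intro!: lin_comp[OF b(2) t(2)])
  qed
  show "Act MC X Y a (tens (Hom D X Y) N f B) = tens (Hom D X Y) N (Act D X Y a f) B"
    if "a \<in> carrier H" "f \<in> carrier (Hom D X Y)" "B \<in> carrier N"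
    unfolding eq using T.tensor_ext(2)[OF U bil[OF that(1)] that(2,3)] by simp
qed

sublocale MC: hochschild M MC H S \<rho>
proof (intro hochschild.intro hochschild_axioms.intro)
  show "chains M MC" by (intro chains.intro M hom_spaces_MC)
qed (use Comp_MC(1) Act_MC(1) H Sinv \<rho> in simp_all)

text \<open>Calculations take place on pairs, whose components can be read off, while
  \<open>tens_list\<close> passes to the generators of the chain space.\<close>

definition pair_basis :: "nat \<Rightarrow> ('o list \<times> ('f \<times> 'k mat) list) set" where
  "pair_basis n = {(Xs, ps). length Xs = Suc n \<and> length ps = Suc n \<and> set Xs \<subseteq> Obj D \<and>
     (\<forall>i\<le>n. ps ! i \<in> carrier (hom_at D Xs i) \<times> carrier N)}"

definition tens_list :: "'o list \<Rightarrow> ('f \<times> 'k mat) list \<Rightarrow> ('f \<times> 'k mat \<Rightarrow>\<^sub>0 'k) set list" where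
  "tens_list Xs ps = map (\<lambda>i. tens (hom_at D Xs i) N (fst (ps ! i)) (snd (ps ! i))) [0..<length Xs]"

abbreviation "P n m Xs ps \<equiv> pure_chain M MC n m (Xs, tens_list Xs ps)"

abbreviation "hom_list Xs \<equiv> map (hom_at D Xs) [0..<length Xs]"

lemma length_tens_list [simp]: "length (tens_list Xs ps) = length Xs"
  and nth_tens_list: "i < length Xs \<Longrightarrow>
    tens_list Xs ps ! i = tens (hom_at D Xs i) N (fst (ps ! i)) (snd (ps ! i))"
  by (simp_all add: tens_list_def)

lemma pair_basisD:
  assumes "(Xs, ps) \<in> pair_basis n"
  shows "length Xs = Suc n" "length ps = Suc n" "set Xs \<subseteq> Obj D" "i \<le> n \<Longrightarrow> Xs ! i \<in> Obj D"
    "i \<le> n \<Longrightarrow> fst (ps ! i) \<in> carrier (hom_at D Xs i)" "i \<le> n \<Longrightarrow> snd (ps ! i) \<in> carrier_mat r r"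
  using assms by (auto simp: pair_basis_def module_mat_simps mem_Times_iff)

lemma pair_basis_fst: "(Xs, ps) \<in> pair_basis n \<Longrightarrow> (Xs, map fst ps) \<in> CN_basis D n"
  by (auto simp: pair_basis_def CN_basis_def mem_Times_iff)

lemma vspace_hom: "(Xs, ps) \<in> pair_basis n \<Longrightarrow> i \<le> n \<Longrightarrow> vspace (hom_at D Xs i)"
  by (rule vspace_hom_at[OF D pair_basis_fst])

lemma tensor_hom: "(Xs, ps) \<in> pair_basis n \<Longrightarrow> i \<le> n \<Longrightarrow> tensor_pair (hom_at D Xs i) N"
  by (intro tensor_pair.intro N vspace_hom)

lemma tens_list_basis: "(Xs, ps) \<in> pair_basis n \<Longrightarrow> (Xs, tens_list Xs ps) \<in> CN_basis MC n"
  using tensor_pair.tens_closed[OF tensor_hom]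
  by (auto simp: CN_basis_def nth_tens_list pair_basisD module_mat_simps)

lemma P_closed: "m \<in> carrier M \<Longrightarrow> (Xs, ps) \<in> pair_basis n \<Longrightarrow> P n m Xs ps \<in> carrier (MC.C n)"
  by (intro MC.pure_chain_closed tens_list_basis)

lemma pair_basis_update:
  "(Xs, ps) \<in> pair_basis n \<Longrightarrow> p \<in> carrier (hom_at D Xs i) \<times> carrier N \<Longrightarrow> (Xs, ps[i := p]) \<in> pair_basis n"
  by (cases "i < length ps") (auto simp: pair_basis_def nth_list_update)

lemma pair_basis_list_all2:
  "length Xs = Suc n \<Longrightarrow> set Xs \<subseteq> Obj D \<Longrightarrow>
    list_all2 (\<lambda>V p. p \<in> carrier V \<times> carrier N) (hom_list Xs) ps \<longleftrightarrow> (Xs, ps) \<in> pair_basis n"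
  by (auto simp: list_all2_conv_all_nth pair_basis_def less_Suc_eq_le simp del: upt_Suc)

lemma CN_basis_list_all2:
  "length Xs = Suc n \<Longrightarrow> set Xs \<subseteq> Obj D \<Longrightarrow>
    list_all2 (\<lambda>V t. t \<in> carrier (tensor V N)) (hom_list Xs) ts \<longleftrightarrow> (Xs, ts) \<in> CN_basis MC n"
  by (auto simp: list_all2_conv_all_nth CN_basis_def less_Suc_eq_le simp del: upt_Suc)

lemma tens_list_map2:
  "length ps = length Xs \<Longrightarrow> tens_list Xs ps = map2 (\<lambda>V (f, B). tens V N f B) (hom_list Xs) ps"
  by (auto intro!: nth_equalityI simp: nth_tens_list split_beta)

lemma vspace_hom_list:
  assumes "length Xs = Suc n" "set Xs \<subseteq> Obj D"
  shows "\<forall>V\<in>set (hom_list Xs). vspace V"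
proof -
  have "Xs ! i \<in> Obj D" if "i < Suc n" for i using assms that by auto
  then show ?thesis using assms by (auto simp: hom_at_def simp del: upt_Suc intro!: vspace_Hom)
qed

lemma multilinear_list:
  assumes "multilinear MC n U \<psi>" "length Xs = Suc n" "set Xs \<subseteq> Obj D"
  shows "list_multilinear (map (\<lambda>V. tensor V N) (hom_list Xs)) U (\<psi> Xs)"
  unfolding list_multilinear_def
proof (intro allI impI conjI)
  fix ts assume "list_all2 (\<lambda>V t. t \<in> carrier V) (map (\<lambda>V. tensor V N) (hom_list Xs)) ts"
  then have b: "(Xs, ts) \<in> CN_basis MC n"
    using CN_basis_list_all2[OF assms(2,3), of ts] by (simp add: list_all2_map1)
  show "\<psi> Xs ts \<in> carrier U" by (rule multilinear_closed[OF assms(1) b])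
  fix i assume "i < length (map (\<lambda>V. tensor V N) (hom_list Xs))"
  then have i: "i \<le> n" using assms(2) by simp
  show "lin (map (\<lambda>V. tensor V N) (hom_list Xs) ! i) U (\<lambda>t. \<psi> Xs (ts[i := t]))"
    using assms(1)[unfolded multilinear_def, rule_format, OF b i] i assms(2) by (simp del: upt_Suc)
qed

text \<open>Pure chains of pure tensors span: first the chain is made pure, then each of its
  entries. Identities between maps thereby become identities between lists of pairs.\<close>

lemma lin_MC_eqI:
  assumes f: "lin (MC.C n) U f" and g: "lin (MC.C n) U g"
    and eq: "\<And>m Xs ps. \<lbrakk>m \<in> carrier M; (Xs, ps) \<in> pair_basis n\<rbrakk> \<Longrightarrow> f (P n m Xs ps) = g (P n m Xs ps)"
    and x: "x \<in> carrier (MC.C n)"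
  shows "f x = g x"
proof (rule MC.lin_chain_eqI[OF f g _ x])
  fix m Xs ts assume m: "m \<in> carrier M" and b: "(Xs, ts) \<in> CN_basis MC n"
  have Xs: "length Xs = Suc n" "set Xs \<subseteq> Obj D" using CN_basisD(1,3)[OF b] by simp_all
  have "multilinear MC n U (\<lambda>Xs ts. f (pure_chain M MC n m (Xs, ts)))"
    "multilinear MC n U (\<lambda>Xs ts. g (pure_chain M MC n m (Xs, ts)))"
    using MC.pure_chain_multilinear[of n] m unfolding chain_multilinear_def multilinear_def
    by (intro allI impI lin_comp[OF _ f] lin_comp[OF _ g]; blast)+
  note FG = this[THEN multilinear_list, OF Xs]
  show "f (pure_chain M MC n m (Xs, ts)) = g (pure_chain M MC n m (Xs, ts))"
  proof (rule list_multilinear_eqI[OF N linD(2)[OF f] vspace_hom_list[OF Xs] FG])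
    show "list_all2 (\<lambda>V t. t \<in> carrier (tensor V N)) (hom_list Xs) ts"
      using CN_basis_list_all2[OF Xs] b by blast
    fix ps assume ps: "list_all2 (\<lambda>V p. p \<in> carrier V \<times> carrier N) (hom_list Xs) ps"
    then have pb: "(Xs, ps) \<in> pair_basis n" using pair_basis_list_all2[OF Xs] by blast
    show "f (pure_chain M MC n m (Xs, map2 (\<lambda>V (f, B). tens V N f B) (hom_list Xs) ps))
      = g (pure_chain M MC n m (Xs, map2 (\<lambda>V (f, B). tens V N f B) (hom_list Xs) ps))"
      using eq[OF m pb] tens_list_map2[of ps Xs] pair_basisD(1,2)[OF pb] by simp
  qed
qed

text \<open>Counterpart of \<open>lin_MC_eqI\<close> for existence: prescribing values on lists of
  pairs, bilinearly in each slot and linearly in \<open>m\<close>, defines a map. The trace and the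
  maps h_j are obtained from it.\<close>

lemma MC_ext:
  assumes U: "vspace U"
    and b: "\<And>m Xs ps i. \<lbrakk>m \<in> carrier M; (Xs, ps) \<in> pair_basis n; i \<le> n\<rbrakk> \<Longrightarrow>
      bilinear_map (hom_at D Xs i) N U (\<lambda>f B. \<phi> m Xs (ps[i := (f, B)]))"
    and l: "\<And>Xs ps. (Xs, ps) \<in> pair_basis n \<Longrightarrow> lin M U (\<lambda>m. \<phi> m Xs ps)"
  shows "lin (MC.C n) U (chain_ext U (\<lambda>m Xs. multi_ext U (\<phi> m Xs)))"
    and "m \<in> carrier M \<Longrightarrow> (Xs, ps) \<in> pair_basis n \<Longrightarrow>
      chain_ext U (\<lambda>m Xs. multi_ext U (\<phi> m Xs)) (P n m Xs ps) = \<phi> m Xs ps"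
proof -
  have lb: "list_bilinear N U (hom_list Xs) (\<phi> m Xs)"
    if m: "m \<in> carrier M" and Xs: "length Xs = Suc n" "set Xs \<subseteq> Obj D" for m Xs
    unfolding list_bilinear_def
  proof (intro allI impI conjI)
    fix ps assume "list_all2 (\<lambda>V p. p \<in> carrier V \<times> carrier N) (hom_list Xs) ps"
    then have pb: "(Xs, ps) \<in> pair_basis n" using pair_basis_list_all2[OF Xs] by blast
    show "\<phi> m Xs ps \<in> carrier U" by (rule linD(3)[OF l[OF pb] m])
    fix i assume "i < length (hom_list Xs)"
    then show "bilinear_map (hom_list Xs ! i) N U (\<lambda>f B. \<phi> m Xs (ps[i := (f, B)]))"
      using b[OF m pb, of i] Xs by (simp del: upt_Suc)
  qed
  have cm: "chain_multilinear M MC n U (\<lambda>m Xs. multi_ext U (\<phi> m Xs))"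
    unfolding chain_multilinear_def
  proof (intro conjI ballI allI impI)
    fix m assume m: "m \<in> carrier M"
    show "multilinear MC n U (\<lambda>Xs. multi_ext U (\<phi> m Xs))"
      unfolding multilinear_def
    proof (intro allI impI)
      fix Xs ts i assume tb: "(Xs, ts) \<in> CN_basis MC n" and i: "i \<le> n"
      have Xs: "length Xs = Suc n" "set Xs \<subseteq> Obj D" using CN_basisD(1,3)[OF tb] by simp_all
      have ts: "list_all2 (\<lambda>V t. t \<in> carrier V) (map (\<lambda>V. tensor V N) (hom_list Xs)) ts"
        using CN_basis_list_all2[OF Xs] tb by (simp add: list_all2_map1)
      note this = multi_ext(1)[OF N U vspace_hom_list[OF Xs] lb[OF m Xs], unfolded list_multilinear_def,
          rule_format, OF ts, THEN conjunct2, rule_format, of i]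
      then show "lin (hom_at MC Xs i) U (\<lambda>f. multi_ext U (\<phi> m Xs) (ts[i := f]))"
        using i Xs by (simp del: upt_Suc)
    qed
  next
    fix Xs ts assume tb: "(Xs, ts) \<in> CN_basis MC n"
    have Xs: "length Xs = Suc n" "set Xs \<subseteq> Obj D" using CN_basisD(1,3)[OF tb] by simp_all
    show "lin M U (\<lambda>m. multi_ext U (\<phi> m Xs) ts)"
      by (rule lin_multi_ext_param[OF N U M vspace_hom_list[OF Xs]])
        (use CN_basis_list_all2[OF Xs] tb pair_basis_list_all2[OF Xs] l in blast)+
  qed
  note ce = MC.chain_ext[OF U cm]
  show "lin (MC.C n) U (chain_ext U (\<lambda>m Xs. multi_ext U (\<phi> m Xs)))" by (rule ce(1))
  assume m: "m \<in> carrier M" and pb: "(Xs, ps) \<in> pair_basis n"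
  note Xs = pair_basisD(1,3)[OF pb]
  show "chain_ext U (\<lambda>m Xs. multi_ext U (\<phi> m Xs)) (P n m Xs ps) = \<phi> m Xs ps"
    using ce(2)[OF m tens_list_basis[OF pb]] multi_ext(2)[OF N U vspace_hom_list[OF Xs] lb[OF m Xs], of ps]
      pair_basis_list_all2[OF Xs] pb tens_list_map2[of ps Xs] pair_basisD(1,2)[OF pb] by simp
qed

end

section \<open>Matrix products and matrix units\<close>

definition mat_prod :: "nat \<Rightarrow> 'k::field mat list \<Rightarrow> 'k mat" where
  "mat_prod r Bs = foldr (*) Bs (1\<^sub>m r)"

lemma mat_prod_simps [simp]:
  "mat_prod r [] = 1\<^sub>m r" "mat_prod r (B # Bs) = B * mat_prod r Bs"
  by (simp_all add: mat_prod_def)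

lemma mat_prod_carrier: "set Bs \<subseteq> carrier_mat r r \<Longrightarrow> mat_prod r Bs \<in> carrier_mat r r"
  by (induction Bs) auto

lemma mat_prod_append:
  "set Bs \<subseteq> carrier_mat r r \<Longrightarrow> set Cs \<subseteq> carrier_mat r r \<Longrightarrow>
    mat_prod r (Bs @ Cs) = mat_prod r Bs * mat_prod r Cs"
  by (induction Bs) (auto simp: mat_prod_carrier assoc_mult_mat[of _ r r _ r _ r] left_mult_one_mat[of _ r r])

lemma lin_mat_mult_left:
  fixes A :: "'k::field mat"
  assumes "A \<in> carrier_mat r r"
  shows "lin (matrix_space r) (matrix_space r) (\<lambda>B. A * B)"
  using bilinear_mapD(1)[OF matrix_mult_bilinear[of r], of A] assms by (simp add: module_mat_simps)

lemma lin_mat_mult_right: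
  fixes A :: "'k::field mat"
  assumes "A \<in> carrier_mat r r"
  shows "lin (matrix_space r) (matrix_space r) (\<lambda>B. B * A)"
  using bilinear_mapD(2)[OF matrix_mult_bilinear[of r], of A] assms by (simp add: module_mat_simps)

lemma mat_prod_update:
  assumes "set Bs \<subseteq> carrier_mat r r" "i < length Bs" "B \<in> carrier_mat r r"
  shows "mat_prod r (Bs[i := B]) = mat_prod r (take i Bs) * (B * mat_prod r (drop (Suc i) Bs))"
proof -
  have "set (take i Bs) \<subseteq> carrier_mat r r" "set (drop (Suc i) Bs) \<subseteq> carrier_mat r r"
    using assms(1) set_take_subset[of i Bs] set_drop_subset[of "Suc i" Bs] by auto
  then show ?thesis using assms
    by (simp add: upd_conv_take_nth_drop mat_prod_append)
qed

text \<open>With the other factors fixed, the product is a left multiplication after a right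
  multiplication. Both the trace formula and the prefix product in h_j depend on their matrices in
  this way.\<close>

lemma lin_mat_prod_update:
  fixes Bs :: "'k::field mat list"
  assumes "set Bs \<subseteq> carrier_mat r r" "i < length Bs"
  shows "lin (matrix_space r) (matrix_space r) (\<lambda>B. mat_prod r (Bs[i := B]))"
proof -
  have s: "set (take i Bs) \<subseteq> carrier_mat r r" "set (drop (Suc i) Bs) \<subseteq> carrier_mat r r"
    using assms(1) set_take_subset[of i Bs] set_drop_subset[of "Suc i" Bs] by auto
  show ?thesis
    by (rule lin_cong[OF lin_comp[OF lin_mat_mult_right[OF mat_prod_carrier[OF s(2)]]
          lin_mat_mult_left[OF mat_prod_carrier[OF s(1)]]]])
      (use assms in \<open>simp add: mat_prod_update module_mat_simps\<close>)
qed

text \<open>Associativity, in the shape that an inner face produces.\<close>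

lemma mat_prod_merge:
  assumes "set Bs \<subseteq> carrier_mat r r" "Suc i < length Bs"
  shows "mat_prod r (face_mor i (Bs ! i * Bs ! Suc i) Bs) = mat_prod r Bs"
proof -
  have s: "set (take i Bs) \<subseteq> carrier_mat r r" "set (drop (Suc (Suc i)) Bs) \<subseteq> carrier_mat r r"
    using assms(1) set_take_subset[of i Bs] set_drop_subset[of "Suc (Suc i)" Bs] by auto
  have n: "Bs ! i \<in> carrier_mat r r" "Bs ! Suc i \<in> carrier_mat r r" using assms by auto
  have "Bs = take i Bs @ Bs ! i # Bs ! Suc i # drop (Suc (Suc i)) Bs"
    using assms(2) by (simp add: Cons_nth_drop_Suc Suc_lessD)
  then have "mat_prod r Bs = mat_prod r (take i Bs @ Bs ! i # Bs ! Suc i # drop (Suc (Suc i)) Bs)"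
    by (rule arg_cong)
  also have "\<dots> = mat_prod r (take i Bs @ (Bs ! i * Bs ! Suc i) # drop (Suc (Suc i)) Bs)"
    using s n by (simp add: mat_prod_append mat_prod_carrier assoc_mult_mat[of _ r r _ r _ r])
  finally show ?thesis by (simp add: face_mor_def)
qed

lemma lin_mat_trace:
  fixes W :: "('k::field, 'w) module"
  assumes "vspace W" "w \<in> carrier W"
  shows "lin (matrix_space r) W (\<lambda>A. mat_trace A \<odot>\<^bsub>W\<^esub> w)"
  by (rule lin_scale[OF assms vspace_matrix])
    (auto simp: mat_trace_def module_mat_simps sum.distrib sum_distrib_left)

text \<open>The last face carries the final matrix to the front of the product; cyclicity of the
  trace undoes this.\<close>

lemma mat_trace_comm:
  assumes "A \<in> carrier_mat r r" "B \<in> carrier_mat r r"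
  shows "mat_trace (A * B) = mat_trace (B * A)"
proof -
  have "mat_trace (A * B) = (\<Sum>i<r. \<Sum>j<r. A $$ (i, j) * B $$ (j, i))"
    using assms by (auto simp: mat_trace_def scalar_prod_def lessThan_atLeast0 intro!: sum.cong)
  also have "\<dots> = (\<Sum>j<r. \<Sum>i<r. B $$ (j, i) * A $$ (i, j))"
    by (subst sum.swap) (simp add: mult.commute)
  also have "\<dots> = mat_trace (B * A)"
    using assms by (auto simp: mat_trace_def scalar_prod_def lessThan_atLeast0 intro!: sum.cong)
  finally show ?thesis .
qed

definition unit_mat :: "nat \<Rightarrow> nat \<Rightarrow> nat \<Rightarrow> 'k::field mat" where
  "unit_mat r a b = mat r r (\<lambda>(i, j). if i = a \<and> j = b then 1 else 0)"

lemma unit_mat_carrier [simp]: "unit_mat r a b \<in> carrier_mat r r"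
  by (simp add: unit_mat_def)

lemma dim_unit_mat [simp]: "dim_row (unit_mat r a b) = r" "dim_col (unit_mat r a b) = r"
  and unit_mat_entry: "i < r \<Longrightarrow> j < r \<Longrightarrow> unit_mat r a b $$ (i, j) = (if i = a \<and> j = b then 1 else 0)"
  by (simp_all add: unit_mat_def)

lemma E11_eq: "E11 r = unit_mat r 0 0"
  by (simp add: E11_def unit_mat_def)

lemma mult_unit_mat_entry:
  fixes A :: "'k::field mat"
  assumes "A \<in> carrier_mat r r" "i < r" "j < r" "q < r"
  shows "(A * unit_mat r q a) $$ (i, j) = (if j = a then A $$ (i, q) else 0)"
proof -
  have "(A * unit_mat r q a) $$ (i, j) = (\<Sum>k<r. A $$ (i, k) * (if k = q \<and> j = a then 1 else 0))"
    using assms by (simp add: unit_mat_def scalar_prod_def lessThan_atLeast0)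
  also have "\<dots> = (\<Sum>k<r. if k = q then (if j = a then A $$ (i, q) else 0) else 0)"
    by (rule sum.cong) auto
  finally show ?thesis using assms(4) by (simp add: sum.delta)
qed

lemma unit_mat_mult_entry:
  fixes A :: "'k::field mat"
  assumes "A \<in> carrier_mat r r" "i < r" "j < r" "q < r"
  shows "(unit_mat r a q * A) $$ (i, j) = (if i = a then A $$ (q, j) else 0)"
proof -
  have "(unit_mat r a q * A) $$ (i, j) = (\<Sum>k<r. (if i = a \<and> k = q then 1 else 0) * A $$ (k, j))"
    using assms by (simp add: unit_mat_def scalar_prod_def lessThan_atLeast0)
  also have "\<dots> = (\<Sum>k<r. if k = q then (if i = a then A $$ (q, j) else 0) else 0)"
    by (rule sum.cong) auto
  finally show ?thesis using assms(4) by (simp add: sum.delta)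
qed

lemma unit_mat_mult:
  assumes "b < r"
  shows "unit_mat r a b * unit_mat r c d = (if b = c then unit_mat r a d else 0\<^sub>m r r :: 'k::field mat)"
proof (rule eq_matI)
  fix i j assume "i < dim_row (if b = c then unit_mat r a d else 0\<^sub>m r r :: 'k mat)"
    "j < dim_col (if b = c then unit_mat r a d else 0\<^sub>m r r :: 'k mat)"
  then have ij: "i < r" "j < r" by (simp_all split: if_splits)
  show "(unit_mat r a b * unit_mat r c d :: 'k mat) $$ (i, j)
      = (if b = c then unit_mat r a d else 0\<^sub>m r r) $$ (i, j)"
    unfolding unit_mat_mult_entry[OF unit_mat_carrier ij assms] using ij assms by (simp add: unit_mat_entry)
qed simp_all

lemma mat_prod_E11:
  assumes "1 \<le> r"
  shows "mat_prod r (replicate (Suc n) (E11 r :: 'k::field mat)) = E11 r"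
  using assms
  by (induction n) (simp_all add: E11_eq unit_mat_mult right_mult_one_mat[of _ r r])

lemma mat_trace_E11: "1 \<le> r \<Longrightarrow> mat_trace (E11 r :: 'k::field mat) = 1"
  by (simp add: mat_trace_def E11_def sum.delta)

section \<open>Faces of the matrix category on lists of pairs\<close>

context matrix_chains
begin

abbreviation "pair_face n i Xs ps \<equiv>
  face_mor i (inner_comp n i Xs (fst (ps ! i)) (fst (ps ! Suc i)), snd (ps ! i) * snd (ps ! Suc i)) ps"

abbreviation "pair_last n a Xs ps \<equiv>
  last_mor (last_comp n a Xs (fst (ps ! Suc n)) (fst (ps ! 0)), snd (ps ! Suc n) * snd (ps ! 0)) ps"

lemma N_carrier [simp]: "carrier N = carrier_mat r r"
  by (simp add: module_mat_simps)

lemma pair_face_comp: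
  assumes b: "(Xs, ps) \<in> pair_basis (Suc n)" and i: "i \<le> n"
  shows "inner_comp n i Xs (fst (ps ! i)) (fst (ps ! Suc i)) \<in> carrier (hom_at D (face_obj i Xs) i)"
    and "MC.inner_comp n i Xs (tens_list Xs ps ! i) (tens_list Xs ps ! Suc i)
      = tens (hom_at D (face_obj i Xs) i) N (inner_comp n i Xs (fst (ps ! i)) (fst (ps ! Suc i)))
        (snd (ps ! i) * snd (ps ! Suc i))"
proof -
  note b' = pair_basisD[OF b]
  have O: "Xs ! (Suc (Suc i) mod Suc (Suc n)) \<in> Obj D" "Xs ! Suc i \<in> Obj D" "Xs ! i \<in> Obj D"
    using i by (simp_all add: b'(4) less_Suc_eq_le[symmetric])
  show "inner_comp n i Xs (fst (ps ! i)) (fst (ps ! Suc i)) \<in> carrier (hom_at D (face_obj i Xs) i)"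
    by (rule bilinear_mapD(3)[OF inner_comp_bilinear[OF pair_basis_fst[OF b] i]]) (use b' i in simp_all)
  have h: "hom_at D (face_obj i Xs) i = Hom D (Xs ! (Suc (Suc i) mod Suc (Suc n))) (Xs ! i)"
    "hom_at D Xs i = Hom D (Xs ! Suc i) (Xs ! i)"
    "hom_at D Xs (Suc i) = Hom D (Xs ! (Suc (Suc i) mod Suc (Suc n))) (Xs ! Suc i)"
    using b'(1) i hom_at_face[of Xs n i i D] by (simp_all add: hom_at_def)
  show "MC.inner_comp n i Xs (tens_list Xs ps ! i) (tens_list Xs ps ! Suc i)
      = tens (hom_at D (face_obj i Xs) i) N (inner_comp n i Xs (fst (ps ! i)) (fst (ps ! Suc i)))
        (snd (ps ! i) * snd (ps ! Suc i))"
    using Comp_MC(2)[OF O, of "fst (ps ! i)" "fst (ps ! Suc i)" "snd (ps ! i)" "snd (ps ! Suc i)"]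
      b'(1,6) b'(5)[of i] b'(5)[of "Suc i"] i unfolding h by (simp add: nth_tens_list h)
qed

lemma pair_face_basis:
  assumes b: "(Xs, ps) \<in> pair_basis (Suc n)" and i: "i \<le> n"
  shows "(face_obj i Xs, pair_face n i Xs ps) \<in> pair_basis n"
  using pair_basisD[OF b] i set_face_obj[of i Xs] pair_face_comp(1)[OF b i]
  by (auto simp: pair_basis_def nth_face_mor hom_at_face mem_Times_iff intro!: mult_carrier_mat[of _ r r _ r])

lemma pair_last_comp:
  assumes b: "(Xs, ps) \<in> pair_basis (Suc n)" and a: "a \<in> carrier H"
  shows "last_comp n a Xs (fst (ps ! Suc n)) (fst (ps ! 0)) \<in> carrier (hom_at D (last_obj (Suc n) Xs) 0)"
    and "MC.last_comp n a Xs (tens_list Xs ps ! Suc n) (tens_list Xs ps ! 0)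
      = tens (hom_at D (last_obj (Suc n) Xs) 0) N (last_comp n a Xs (fst (ps ! Suc n)) (fst (ps ! 0)))
        (snd (ps ! Suc n) * snd (ps ! 0))"
proof -
  note b' = pair_basisD[OF b]
  have O: "Xs ! 1 \<in> Obj D" "Xs ! 0 \<in> Obj D" "Xs ! Suc n \<in> Obj D" using b'(4) by simp_all
  show "last_comp n a Xs (fst (ps ! Suc n)) (fst (ps ! 0)) \<in> carrier (hom_at D (last_obj (Suc n) Xs) 0)"
    by (rule bilinear_mapD(3)[OF last_comp_bilinear[OF pair_basis_fst[OF b] a]]) (use b' in simp_all)
  have h: "hom_at D (last_obj (Suc n) Xs) 0 = Hom D (Xs ! 1) (Xs ! Suc n)"
    "hom_at D Xs 0 = Hom D (Xs ! 1) (Xs ! 0)" "hom_at D Xs (Suc n) = Hom D (Xs ! 0) (Xs ! Suc n)"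
    using b'(1) hom_at_last[of Xs n 0 D] by (simp_all add: hom_at_def)
  have Sa: "Si a \<in> carrier H" by (rule linD(3)[OF Sinv a])
  have f: "fst (ps ! Suc n) \<in> carrier (Hom D (Xs ! 0) (Xs ! Suc n))" "fst (ps ! 0) \<in> carrier (Hom D (Xs ! 1) (Xs ! 0))"
    using b'(5)[of "Suc n"] b'(5)[of 0] h by simp_all
  have f': "Act D (Xs ! 0) (Xs ! Suc n) (Si a) (fst (ps ! Suc n)) \<in> carrier (Hom D (Xs ! 0) (Xs ! Suc n))"
    by (rule bilinear_mapD(3)[OF act[OF O(2,3)] Sa f(1)])
  show "MC.last_comp n a Xs (tens_list Xs ps ! Suc n) (tens_list Xs ps ! 0)
      = tens (hom_at D (last_obj (Suc n) Xs) 0) N (last_comp n a Xs (fst (ps ! Suc n)) (fst (ps ! 0)))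
        (snd (ps ! Suc n) * snd (ps ! 0))"
    using Act_MC(2)[OF O(2,3) Sa f(1), of "snd (ps ! Suc n)"]
      Comp_MC(2)[OF O f' f(2), of "snd (ps ! Suc n)" "snd (ps ! 0)"] b'(1,6)
    unfolding h by (simp add: nth_tens_list h)
qed

lemma pair_last_basis:
  assumes b: "(Xs, ps) \<in> pair_basis (Suc n)" and a: "a \<in> carrier H"
  shows "(last_obj (Suc n) Xs, pair_last n a Xs ps) \<in> pair_basis n"
  using pair_basisD[OF b] set_last_obj[of "Suc n" Xs] pair_last_comp(1)[OF b a]
  by (auto simp: pair_basis_def nth_last_mor hom_at_last mem_Times_iff intro!: mult_carrier_mat[of _ r r _ r])

text \<open>Composition in the matrix category is componentwise on pure tensors, so the face of a
  list of pure tensors is again such a list.\<close>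

lemma MC_inner_face:
  assumes m: "m \<in> carrier M" and b: "(Xs, ps) \<in> pair_basis (Suc n)" and i: "i \<le> n"
  shows "inner_face M MC (Suc n) i (P (Suc n) m Xs ps) = P n m (face_obj i Xs) (pair_face n i Xs ps)"
proof -
  have "tens_list (face_obj i Xs) (pair_face n i Xs ps)
      = face_mor i (MC.inner_comp n i Xs (tens_list Xs ps ! i) (tens_list Xs ps ! Suc i)) (tens_list Xs ps)"
    using pair_basisD(1,2)[OF b] i unfolding pair_face_comp(2)[OF b i]
    by (auto intro!: nth_equalityI simp: nth_tens_list nth_face_mor hom_at_face)
  then show ?thesis
    using MC.inner_face(2)[OF i m tens_list_basis[OF b]] by simp
qed

text \<open>H acts on the morphism and leaves the matrix alone, so each summand of the coaction is
  again a list of pure tensors. The rewriting holds for \<open>a\<close> in the carrier of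
  \<open>H\<close>, and the congruence for \<open>lin_ext\<close> tests only those.\<close>

lemma MC_last_face:
  assumes m: "m \<in> carrier M" and b: "(Xs, ps) \<in> pair_basis (Suc n)"
  shows "last_face H S M \<rho> MC (Suc n) (P (Suc n) m Xs ps)
    = lin_ext (MC.C n) (\<lambda>(a, m0). P n m0 (last_obj (Suc n) Xs) (pair_last n a Xs ps)) (\<rho> m)"
proof -
  interpret HM: tensor_pair H M by (rule tensor_HM)
  have eq: "tens_list (last_obj (Suc n) Xs) (pair_last n a Xs ps)
      = last_mor (MC.last_comp n a Xs (tens_list Xs ps ! Suc n) (tens_list Xs ps ! 0)) (tens_list Xs ps)"
    if "a \<in> carrier H" for a
    using pair_basisD(1,2)[OF b] unfolding pair_last_comp(2)[OF b that]
    by (auto intro!: nth_equalityI simp: nth_tens_list nth_last_mor hom_at_last)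
  have "lin_ext (MC.C n) (MC.last_term n Xs (tens_list Xs ps)) (\<rho> m)
      = lin_ext (MC.C n) (\<lambda>(a, m0). P n m0 (last_obj (Suc n) Xs) (pair_last n a Xs ps)) (\<rho> m)"
  proof (rule lin_ext_cong[OF HM.relators \<rho>_closed[OF m, unfolded tensor_def] MC.vspace_chain_space])
    fix x assume "x \<in> carrier H \<times> carrier M"
    then obtain a m0 where x: "x = (a, m0)" "a \<in> carrier H" "m0 \<in> carrier M" by auto
    show "MC.last_term n Xs (tens_list Xs ps) x
        = (case x of (a, m0) \<Rightarrow> P n m0 (last_obj (Suc n) Xs) (pair_last n a Xs ps))"
      by (simp only: x(1) prod.case eq[OF x(2)])
    show "(case x of (a, m0) \<Rightarrow> P n m0 (last_obj (Suc n) Xs) (pair_last n a Xs ps)) \<in> carrier (MC.C n)"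
      unfolding x(1) prod.case by (rule P_closed[OF x(3) pair_last_basis[OF b x(2)]])
  qed
  then show ?thesis
    using MC.last_face(2)[OF m tens_list_basis[OF b]] by simp
qed

end

section \<open>The boundary as an alternating sum of faces\<close>

context hochschild
begin

text \<open>Stated with a linear map in front, so that it covers both the expansion of the boundary
  itself and terms such as h_j b.\<close>

lemma lin_boundary_apply:
  assumes g: "lin (C n) W g" and x: "x \<in> carrier (C (Suc n))"
  shows "g (bd (Suc n) x)
    = finsum W (\<lambda>i. (- 1) ^ i \<odot>\<^bsub>W\<^esub> g (fc (Suc n) i x)) {..Suc n}"
proof -
  interpret W: vectorspace class_ring W by (rule linD(2)[OF g])
  note f = linD(3)[OF lin_face x]
  show ?thesis
    unfolding hochschild_boundary_def diff_Suc_1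
    by (subst lin_finsum_apply[OF g])
      (auto simp: linD(5)[OF g] f vspaceD(5)[OF vspace_chain_space] vspaceD(5)[OF linD(2)[OF g]] linD(3)[OF g]
        atMost_atLeast0 intro!: W.module.M.finsum_cong')
qed

lemma boundary_eq:
  assumes "x \<in> carrier (C (Suc n))"
  shows "bd (Suc n) x
    = finsum (C n) (\<lambda>i. (- 1) ^ i \<odot>\<^bsub>C n\<^esub> fc (Suc n) i x) {..Suc n}"
  using lin_boundary_apply[OF lin_id[OF vspace_chain_space] assms] .

end

lemma boundary_commute:
  assumes "hochschild M D H S \<rho>" "hochschild M D' H S \<rho>"
    and g: "lin (chain_space M D n) (chain_space M D' n) g"
    and g': "lin (chain_space M D (Suc n)) (chain_space M D' (Suc n)) g'"
    and x: "x \<in> carrier (chain_space M D (Suc n))"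
    and comm: "\<And>i. i \<le> Suc n \<Longrightarrow> g (face H S M \<rho> D (Suc n) i x) = face H S M \<rho> D' (Suc n) i (g' x)"
  shows "g (hochschild_boundary H S M \<rho> D (Suc n) x) = hochschild_boundary H S M \<rho> D' (Suc n) (g' x)"
proof -
  interpret A: hochschild M D H S \<rho> by fact
  interpret B: hochschild M D' H S \<rho> by fact
  interpret W: vectorspace class_ring "B.C n" by (rule B.vspace_chain_space)
  note y = linD(3)[OF g' x]
  show ?thesis
    unfolding A.lin_boundary_apply[OF g x] B.boundary_eq[OF y]
    by (rule W.module.M.finsum_cong')
      (auto simp: comm vspaceD(5)[OF B.vspace_chain_space] linD(3)[OF B.lin_face y])
qed

section \<open>Inclusion and trace are morphisms of complexes\<close>

context matrix_chains
begin

abbreviation "pair_E11 fs \<equiv> map (\<lambda>f. (f, E11 r :: 'k mat)) fs"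

lemma pair_E11_basis: "(Xs, fs) \<in> CN_basis D n \<Longrightarrow> (Xs, pair_E11 fs) \<in> pair_basis n"
  by (auto simp: pair_basis_def CN_basis_def E11_eq)

lemma inc_map:
  shows "lin (C n) (MC.C n) (inc_map M D r n)"
    and "m \<in> carrier M \<Longrightarrow> (Xs, fs) \<in> CN_basis D n \<Longrightarrow>
      inc_map M D r n (pure_chain M D n m (Xs, fs)) = P n m Xs (pair_E11 fs)"
proof -
  let ?\<psi> = "\<lambda>m Xs fs. pure_chain M MC n m
    (Xs, map (\<lambda>i. tens (hom_at D Xs i) N (fs ! i) (E11 r)) [0..<Suc n])"
  have eq: "?\<psi> m Xs fs = P n m Xs (pair_E11 fs)" if "(Xs, fs) \<in> CN_basis D n" for m Xs fs
    using CN_basisD(1,2)[OF that] by (auto simp: tens_list_def simp del: upt_Suc intro!: arg_cong[where f = "pure_chain M MC n m"])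
  have cm: "chain_multilinear M D n (MC.C n) ?\<psi>"
    unfolding chain_multilinear_def multilinear_def
  proof (intro conjI ballI allI impI)
    fix m Xs fs i assume m: "m \<in> carrier M" and b: "(Xs, fs) \<in> CN_basis D n" and i: "i \<le> n"
    interpret T: tensor_pair "hom_at D Xs i" N by (rule tensor_hom[OF pair_E11_basis[OF b] i])
    have u: "lin (hom_at D Xs i) (hom_at MC Xs i) (\<lambda>f. tens (hom_at D Xs i) N f (E11 r))"
      using bilinear_mapD(2)[OF T.tens_bilinear, of "E11 r"] by (simp add: E11_eq)
    show "lin (hom_at D Xs i) (MC.C n) (\<lambda>f. ?\<psi> m Xs (fs[i := f]))"
    proof (rule lin_cong[OF MC.lin_pure_slot[OF m tens_list_basis[OF pair_E11_basis[OF b]] i u]])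
      fix f
      have "(tens_list Xs (pair_E11 fs))[i := tens (hom_at D Xs i) N f (E11 r)]
        = map (\<lambda>j. tens (hom_at D Xs j) N (fs[i := f] ! j) (E11 r)) [0..<Suc n]"
        using CN_basisD(1,2)[OF b] i
        by (auto intro!: nth_equalityI simp: nth_tens_list nth_list_update simp del: upt_Suc)
      then show "P' n m (Xs, (tens_list Xs (pair_E11 fs))[i := tens (hom_at D Xs i) N f (E11 r)]) = P' n m
          (Xs, map (\<lambda>j. tens (hom_at D Xs j) N (fs[i := f] ! j) (E11 r)) [0..<Suc n])" for P'
        by simp
    qed
  next
    fix Xs fs assume b: "(Xs, fs) \<in> CN_basis D n"
    show "lin M (MC.C n) (\<lambda>m. ?\<psi> m Xs fs)"
      unfolding eq[OF b] by (rule MC.lin_pure_coeff[OF tens_list_basis[OF pair_E11_basis[OF b]]])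
  qed
  show "lin (C n) (MC.C n) (inc_map M D r n)"
    unfolding inc_map_def by (rule chain_ext(1)[OF MC.vspace_chain_space cm])
  show "inc_map M D r n (pure_chain M D n m (Xs, fs)) = P n m Xs (pair_E11 fs)"
    if "m \<in> carrier M" "(Xs, fs) \<in> CN_basis D n"
    unfolding inc_map_def chain_ext(2)[OF MC.vspace_chain_space cm that] using eq[OF that(2)] by simp
qed

abbreviation "trace_term n m Xs ps \<equiv>
  mat_trace (mat_prod r (map snd ps)) \<odot>\<^bsub>C n\<^esub> pure_chain M D n m (Xs, map fst ps)"

lemma snd_carrier: "(Xs, ps) \<in> pair_basis n \<Longrightarrow> set (map snd ps) \<subseteq> carrier_mat r r"
  by (auto simp: set_conv_nth less_Suc_eq_le pair_basisD(2) dest: pair_basisD(6))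

text \<open>In one slot the morphism enters the pure chain and the matrix enters the scalar, so the
  term is a product of two separately linear dependences.\<close>

lemma trace_map:
  shows "lin (MC.C n) (C n) (trace_map M D r n)"
    and "m \<in> carrier M \<Longrightarrow> (Xs, ps) \<in> pair_basis n \<Longrightarrow>
      trace_map M D r n (P n m Xs ps) = trace_term n m Xs ps"
proof -
  have eq: "trace_map M D r n = chain_ext (C n) (\<lambda>m Xs. multi_ext (C n) (trace_term n m Xs))"
    by (simp add: trace_map_def mat_prod_def)
  note V = vspace_chain_space[of n]
  have b: "bilinear_map (hom_at D Xs i) N (C n) (\<lambda>f B. trace_term n m Xs (ps[i := (f, B)]))"
    if m: "m \<in> carrier M" and b: "(Xs, ps) \<in> pair_basis n" and i: "i \<le> n" for m Xs ps i
    unfolding bilinear_map_def map_update fst_conv snd_conv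
  proof (intro conjI ballI)
    note fb = pair_basis_fst[OF b] and ib = vspace_hom[OF b i]
    show "lin (hom_at D Xs i) (C n) (\<lambda>f. mat_trace (mat_prod r ((map snd ps)[i := B]))
        \<odot>\<^bsub>C n\<^esub> pure_chain M D n m (Xs, (map fst ps)[i := f]))" for B
      by (rule lin_smult[OF lin_pure_slot[OF m fb i lin_id[OF ib]]])
    show "lin N (C n) (\<lambda>B. mat_trace (mat_prod r ((map snd ps)[i := B]))
        \<odot>\<^bsub>C n\<^esub> pure_chain M D n m (Xs, (map fst ps)[i := f]))" if f: "f \<in> carrier (hom_at D Xs i)" for f
    proof (rule lin_comp[OF lin_mat_prod_update lin_mat_trace[OF V]])
      show "pure_chain M D n m (Xs, (map fst ps)[i := f]) \<in> carrier (C n)"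
        by (rule pure_chain_closed[OF m CN_basis_update[OF fb f]])
    qed (use snd_carrier[OF b] pair_basisD[OF b] i in auto)
  qed
  have l: "lin M (C n) (\<lambda>m. trace_term n m Xs ps)" if "(Xs, ps) \<in> pair_basis n" for Xs ps
    by (rule lin_smult[OF lin_pure_coeff[OF pair_basis_fst[OF that]]])
  show "lin (MC.C n) (C n) (trace_map M D r n)"
    unfolding eq by (rule MC_ext(1)[OF V b l])
  show "trace_map M D r n (P n m Xs ps) = trace_term n m Xs ps"
    if "m \<in> carrier M" "(Xs, ps) \<in> pair_basis n"
    unfolding eq by (rule MC_ext(2)[OF V b l that])
qed

text \<open>E_11 is idempotent, so merging two entries of an included list gives an included entry
  again.\<close>

lemma pair_face_E11:
  assumes "(Xs, fs) \<in> CN_basis D (Suc n)" "i \<le> n" "1 \<le> r"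
  shows "pair_face n i Xs (pair_E11 fs) = pair_E11 (face_mor i (inner_comp n i Xs (fs ! i) (fs ! Suc i)) fs)"
  using CN_basisD(1,2)[OF assms(1)] assms(2,3)
  by (simp add: face_mor_def take_map drop_map E11_eq unit_mat_mult)

lemma pair_last_E11:
  assumes "(Xs, fs) \<in> CN_basis D (Suc n)" "1 \<le> r"
  shows "pair_last n a Xs (pair_E11 fs) = pair_E11 (last_mor (last_comp n a Xs (fs ! Suc n) (fs ! 0)) fs)"
  using CN_basisD(1,2)[OF assms(1)] assms(2)
  by (simp add: last_mor_def map_tl map_butlast E11_eq unit_mat_mult)

lemma face_inner: "i \<le> n \<Longrightarrow> face H S M \<rho> D' (Suc n) i = inner_face M D' (Suc n) i"
  and face_last: "face H S M \<rho> D' (Suc n) (Suc n) = last_face H S M \<rho> D' (Suc n)"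
  by (simp_all add: face_def)

text \<open>For the last face the inclusion is moved inside the sum over the coaction; there the
  claim holds summand by summand, because E_11 E_11 = E_11.\<close>

lemma inc_face:
  assumes r: "1 \<le> r" and i: "i \<le> Suc n" and x: "x \<in> carrier (C (Suc n))"
  shows "inc_map M D r n (fc (Suc n) i x) = MC.fc (Suc n) i (inc_map M D r (Suc n) x)"
proof (rule lin_chain_eqI[OF lin_comp[OF lin_face inc_map(1)] lin_comp[OF inc_map(1) MC.lin_face] _ x])
  fix m Xs fs assume m: "m \<in> carrier M" and b: "(Xs, fs) \<in> CN_basis D (Suc n)"
  note b' = CN_basisD[OF b] and pb = pair_E11_basis[OF b]
  interpret HM: tensor_pair H M by (rule tensor_HM)
  note R = HM.relators and \<rho>m = \<rho>_closed[OF m, unfolded tensor_def]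
  show "inc_map M D r n (fc (Suc n) i (pure_chain M D (Suc n) m (Xs, fs)))
    = MC.fc (Suc n) i (inc_map M D r (Suc n) (pure_chain M D (Suc n) m (Xs, fs)))"
  proof (cases "i \<le> n")
    case True
    note 1 = True face_inner[OF True]
    have "(face_obj i Xs, face_mor i (inner_comp n i Xs (fs ! i) (fs ! Suc i)) fs) \<in> CN_basis D n"
      by (rule face_basis[OF b 1(1) bilinear_mapD(3)[OF inner_comp_bilinear[OF b 1(1)]]]) (use b' 1 in simp_all)
    then show ?thesis
      using m b unfolding 1(2) inc_map(2)[OF m b] MC_inner_face[OF m pb 1(1)] pair_face_E11[OF b 1(1) r]
      by (simp add: inner_face(2)[OF 1(1)] inc_map(2))
  next
    case False
    then have "i = Suc n" using i by simp
    note 2 = this face_last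
    have lb: "(last_obj (Suc n) Xs, last_mor (last_comp n a Xs (fs ! Suc n) (fs ! 0)) fs) \<in> CN_basis D n"
      if "a \<in> carrier H" for a
      by (rule last_basis[OF b bilinear_mapD(3)[OF last_comp_bilinear[OF b that]]]) (use b' in simp_all)
    have c: "last_term n Xs fs y \<in> carrier (C n)" if "y \<in> carrier H \<times> carrier M" for y
      using that lb pure_chain_closed by (cases y) simp
    have "inc_map M D r n (lin_ext (C n) (last_term n Xs fs) (\<rho> m))
        = lin_ext (MC.C n) (\<lambda>y. inc_map M D r n (last_term n Xs fs y)) (\<rho> m)"
      by (rule lin_lin_ext[OF R \<rho>m inc_map(1) c])
    also have "\<dots> = lin_ext (MC.C n) (\<lambda>(a, m0). P n m0 (last_obj (Suc n) Xs)
        (pair_E11 (last_mor (last_comp n a Xs (fs ! Suc n) (fs ! 0)) fs))) (\<rho> m)"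
    proof (rule lin_ext_cong[OF R \<rho>m MC.vspace_chain_space])
      fix y assume "y \<in> carrier H \<times> carrier M"
      then obtain a m0 where y: "y = (a, m0)" "a \<in> carrier H" "m0 \<in> carrier M" by auto
      show "inc_map M D r n (last_term n Xs fs y) = (case y of (a, m0) \<Rightarrow>
          P n m0 (last_obj (Suc n) Xs) (pair_E11 (last_mor (last_comp n a Xs (fs ! Suc n) (fs ! 0)) fs)))"
        by (simp only: y(1) prod.case inc_map(2)[OF y(3) lb[OF y(2)]])
      show "(case y of (a, m0) \<Rightarrow> P n m0 (last_obj (Suc n) Xs)
          (pair_E11 (last_mor (last_comp n a Xs (fs ! Suc n) (fs ! 0)) fs))) \<in> carrier (MC.C n)"
        unfolding y(1) prod.case by (rule P_closed[OF y(3) pair_E11_basis[OF lb[OF y(2)]]])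
    qed
    finally show ?thesis
      unfolding 2 inc_map(2)[OF m b] last_face(2)[OF m b] MC_last_face[OF m pb] pair_last_E11[OF b r] .
  qed
qed

text \<open>Inner faces preserve the product of the matrices; the last face preserves its trace,
  which is then the same scalar in all summands of the coaction and can be taken out.\<close>

lemma trace_face:
  assumes i: "i \<le> Suc n" and x: "x \<in> carrier (MC.C (Suc n))"
  shows "trace_map M D r n (MC.fc (Suc n) i x) = fc (Suc n) i (trace_map M D r (Suc n) x)"
proof (rule lin_MC_eqI[OF lin_comp[OF MC.lin_face trace_map(1)] lin_comp[OF trace_map(1) lin_face] _ x])
  fix m Xs ps assume m: "m \<in> carrier M" and b: "(Xs, ps) \<in> pair_basis (Suc n)"
  note b' = pair_basisD[OF b] and fb = pair_basis_fst[OF b]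
  let ?t = "mat_trace (mat_prod r (map snd ps))"
  interpret HM: tensor_pair H M by (rule tensor_HM)
  note R = HM.relators and \<rho>m = \<rho>_closed[OF m, unfolded tensor_def]
  have pc: "pure_chain M D (Suc n) m (Xs, map fst ps) \<in> carrier (C (Suc n))"
    by (rule pure_chain_closed[OF m fb])
  show "trace_map M D r n (MC.fc (Suc n) i (P (Suc n) m Xs ps))
    = fc (Suc n) i (trace_map M D r (Suc n) (P (Suc n) m Xs ps))"
  proof (cases "i \<le> n")
    case True
    note 1 = True face_inner[OF True]
    have "map snd (pair_face n i Xs ps) = face_mor i (map snd ps ! i * map snd ps ! Suc i) (map snd ps)"
      using b'(1,2) 1(1) by (simp add: face_mor_def take_map drop_map)
    then have "mat_prod r (map snd (pair_face n i Xs ps)) = mat_prod r (map snd ps)"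
      using mat_prod_merge[OF snd_carrier[OF b], of i] b'(2) 1(1) by simp
    moreover have "map fst (pair_face n i Xs ps)
        = face_mor i (inner_comp n i Xs (map fst ps ! i) (map fst ps ! Suc i)) (map fst ps)"
      using b'(1,2) 1(1) by (simp add: face_mor_def take_map drop_map)
    ultimately show ?thesis
      unfolding 1(2) MC_inner_face[OF m b 1(1)] trace_map(2)[OF m pair_face_basis[OF b 1(1)]]
        trace_map(2)[OF m b] linD(5)[OF inner_face(1)[OF 1(1)] pc] inner_face(2)[OF 1(1) m fb] by simp
  next
    case False
    then have "i = Suc n" using i by simp
    note 2 = this face_last
    \<comment> \<open>Splitting off both the first and the last pair exhibits the two products as
      B^n (B^0 Q) and (B^0 Q) B^n.\<close>
    have prod: "mat_trace (mat_prod r (map snd (pair_last n a Xs ps))) = ?t" for a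
    proof -
      obtain p0 qs p1 where ps: "ps = p0 # qs @ [p1]" "length qs = n"
      proof -
        from b'(2) obtain p0 ps' where "ps = p0 # ps'" "length ps' = Suc n" by (cases ps) auto
        moreover from this(2) obtain qs p1 where "ps' = qs @ [p1]" by (metis Zero_not_Suc append_butlast_last_id list.size(3))
        ultimately show ?thesis using that by simp
      qed
      have c: "snd p0 \<in> carrier_mat r r" "snd p1 \<in> carrier_mat r r" "set (map snd qs) \<subseteq> carrier_mat r r"
        using snd_carrier[OF b] by (auto simp: ps)
      note q = mat_prod_carrier[OF c(3)]
      have "mat_prod r (map snd (pair_last n a Xs ps)) = snd p1 * (snd p0 * mat_prod r (map snd qs))"
        using c q by (simp add: ps last_mor_def nth_append assoc_mult_mat[of _ r r _ r _ r])
      moreover have "mat_prod r (map snd ps) = (snd p0 * mat_prod r (map snd qs)) * snd p1"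
        using c q by (simp add: ps mat_prod_append assoc_mult_mat[of _ r r _ r _ r] right_mult_one_mat[of _ r r])
      ultimately show ?thesis
        using mat_trace_comm[OF c(2), of "snd p0 * mat_prod r (map snd qs)"] c q by simp
    qed
    have fsts: "map fst (pair_last n a Xs ps)
        = last_mor (last_comp n a Xs (map fst ps ! Suc n) (map fst ps ! 0)) (map fst ps)" for a
      using b'(1,2) by (simp add: last_mor_def map_tl map_butlast)
    have lb: "(last_obj (Suc n) Xs, last_mor (last_comp n a Xs (map fst ps ! Suc n) (map fst ps ! 0)) (map fst ps))
        \<in> CN_basis D n" if "a \<in> carrier H" for a
      using pair_basis_fst[OF pair_last_basis[OF b that]] unfolding fsts .
    have c: "last_term n Xs (map fst ps) y \<in> carrier (C n)" if "y \<in> carrier H \<times> carrier M" for y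
      using that lb pure_chain_closed by (cases y) simp
    have c': "(case y of (a, m0) \<Rightarrow> P n m0 (last_obj (Suc n) Xs) (pair_last n a Xs ps)) \<in> carrier (MC.C n)"
      if "y \<in> carrier H \<times> carrier M" for y
      using that P_closed pair_last_basis[OF b] by (cases y) simp
    have "trace_map M D r n (last_face H S M \<rho> MC (Suc n) (P (Suc n) m Xs ps))
      = lin_ext (C n) (\<lambda>y. trace_map M D r n
          (case y of (a, m0) \<Rightarrow> P n m0 (last_obj (Suc n) Xs) (pair_last n a Xs ps))) (\<rho> m)"
      unfolding MC_last_face[OF m b] by (rule lin_lin_ext[OF R \<rho>m trace_map(1) c'])
    also have "\<dots> = lin_ext (C n) (\<lambda>y. ?t \<odot>\<^bsub>C n\<^esub> last_term n Xs (map fst ps) y) (\<rho> m)"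
    proof (rule lin_ext_cong[OF R \<rho>m vspace_chain_space])
      fix y assume y': "y \<in> carrier H \<times> carrier M"
      then obtain a m0 where y: "y = (a, m0)" "a \<in> carrier H" "m0 \<in> carrier M" by auto
      show "trace_map M D r n (case y of (a, m0) \<Rightarrow> P n m0 (last_obj (Suc n) Xs) (pair_last n a Xs ps))
        = ?t \<odot>\<^bsub>C n\<^esub> last_term n Xs (map fst ps) y"
        by (simp only: y(1) prod.case trace_map(2)[OF y(3) pair_last_basis[OF b y(2)]] prod fsts)
      show "?t \<odot>\<^bsub>C n\<^esub> last_term n Xs (map fst ps) y \<in> carrier (C n)"
        by (rule vspaceD(5)[OF vspace_chain_space c[OF y']])
    qed
    also have "\<dots> = ?t \<odot>\<^bsub>C n\<^esub> lin_ext (C n) (last_term n Xs (map fst ps)) (\<rho> m)"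
      by (rule lin_ext_smult[OF R \<rho>m vspace_chain_space c])
    finally show ?thesis
      unfolding 2 trace_map(2)[OF m b] linD(5)[OF last_face(1) pc] last_face(2)[OF m fb] .
  qed
qed

lemma trace_inc:
  assumes "1 \<le> r" and x: "x \<in> carrier (C n)"
  shows "trace_map M D r n (inc_map M D r n x) = x"
proof (rule lin_chain_eqI[OF lin_comp[OF inc_map(1) trace_map(1)] lin_id[OF vspace_chain_space] _ x])
  fix m Xs fs assume m: "m \<in> carrier M" and b: "(Xs, fs) \<in> CN_basis D n"
  have "map snd (pair_E11 fs) = replicate (Suc n) (E11 r)"
    using CN_basisD(2)[OF b] by (simp add: list_eq_iff_nth_eq nth_Cons split: nat.split)
  then have "mat_trace (mat_prod r (map snd (pair_E11 fs))) = 1"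
    by (simp only: mat_prod_E11[OF assms(1)] mat_trace_E11[OF assms(1)])
  moreover have "map fst (pair_E11 fs) = fs" by (simp add: comp_def)
  ultimately show "trace_map M D r n (inc_map M D r n (pure_chain M D n m (Xs, fs))) = pure_chain M D n m (Xs, fs)"
    using inc_map(2)[OF m b] trace_map(2)[OF m pair_E11_basis[OF b]]
      vspaceD(6)[OF vspace_chain_space pure_chain_closed[OF m b]] by simp
qed

end

section \<open>The homotopy\<close>

lemma finsum_swap:
  assumes W: "vspace W" and "finite A" and B: "finite B"
    and f: "\<And>a b. a \<in> A \<Longrightarrow> b \<in> B \<Longrightarrow> f a b \<in> carrier W"
  shows "finsum W (\<lambda>a. finsum W (f a) B) A = finsum W (\<lambda>b. finsum W (\<lambda>a. f a b) A) B"
  using assms(2) f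
proof (induction A rule: finite_induct)
  interpret W: vectorspace class_ring W by (rule W)
  case empty
  then show ?case by (simp add: W.module.M.finsum_zero)
next
  interpret W: vectorspace class_ring W by (rule W)
  case (insert x A)
  have c: "finsum W (f a) B \<in> carrier W" if "a \<in> insert x A" for a
    using insert.prems that by (intro W.module.M.finsum_closed) auto
  have c': "finsum W (\<lambda>a. f a b) A \<in> carrier W" if "b \<in> B" for b
    using insert.prems that by (intro W.module.M.finsum_closed) auto
  have "finsum W (\<lambda>a. finsum W (f a) B) (insert x A)
      = finsum W (f x) B \<oplus>\<^bsub>W\<^esub> finsum W (\<lambda>a. finsum W (f a) B) A"
    using insert.hyps c by (intro W.module.M.finsum_insert) auto
  also have "finsum W (\<lambda>a. finsum W (f a) B) A = finsum W (\<lambda>b. finsum W (\<lambda>a. f a b) A) B"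
    by (rule insert.IH) (use insert.prems in simp)
  also have "finsum W (f x) B \<oplus>\<^bsub>W\<^esub> \<dots> = finsum W (\<lambda>b. f x b \<oplus>\<^bsub>W\<^esub> finsum W (\<lambda>a. f a b) A) B"
    by (rule W.module.M.finsum_addf[symmetric]) (use insert.prems c' in auto)
  also have "\<dots> = finsum W (\<lambda>b. finsum W (\<lambda>a. f a b) (insert x A)) B"
  proof (rule W.module.M.finsum_cong')
    fix b assume b: "b \<in> B"
    show "f x b \<oplus>\<^bsub>W\<^esub> finsum W (\<lambda>a. f a b) A = finsum W (\<lambda>a. f a b) (insert x A)"
      using insert.hyps insert.prems b by (intro W.module.M.finsum_insert[symmetric]) auto
  qed (use insert.prems in \<open>auto intro!: W.module.M.finsum_closed\<close>)
  finally show ?case .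
qed

text \<open>Reduces sums in the matrix record to ordinary sums of scalars, one entry at a
  time.\<close>

lemma finsum_matrix:
  fixes A :: "'i \<Rightarrow> 'k::field mat"
  assumes "finite I" "\<And>i. i \<in> I \<Longrightarrow> A i \<in> carrier_mat r r"
  shows "finsum (matrix_space r) A I \<in> carrier_mat r r"
    and "a < r \<Longrightarrow> b < r \<Longrightarrow> finsum (matrix_space r) A I $$ (a, b) = (\<Sum>i\<in>I. A i $$ (a, b))"
proof -
  interpret N: vectorspace class_ring "matrix_space r :: ('k, 'k mat) module" by (rule vspace_matrix)
  have "finsum (matrix_space r) A I \<in> carrier_mat r r \<and>
    (\<forall>a<r. \<forall>b<r. finsum (matrix_space r) A I $$ (a, b) = (\<Sum>i\<in>I. A i $$ (a, b)))"
    using assms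
  proof (induction I rule: finite_induct)
    case empty
    then show ?case by (simp add: module_mat_simps)
  next
    case (insert i I)
    then have "finsum (matrix_space r) A (insert i I) = A i + finsum (matrix_space r) A I"
      by (subst N.module.M.finsum_insert) (auto simp: module_mat_simps)
    then show ?case using insert by auto
  qed
  then show "finsum (matrix_space r) A I \<in> carrier_mat r r"
    and "a < r \<Longrightarrow> b < r \<Longrightarrow> finsum (matrix_space r) A I $$ (a, b) = (\<Sum>i\<in>I. A i $$ (a, b))"
    by auto
qed

text \<open>Multiplying by E_qa on the right moves column q of \<open>B\<close> to column a; the sum
  writes that column in matrix units.\<close>

lemma mult_unit_mat:
  fixes B :: "'k::field mat"
  assumes B: "B \<in> carrier_mat r r" and q: "q < r"
  shows "B * unit_mat r q a = finsum (matrix_space r) (\<lambda>p. B $$ (p, q) \<cdot>\<^sub>m unit_mat r p a) {..<r}"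
proof -
  note F = finsum_matrix[of "{..<r}" "\<lambda>p. B $$ (p, q) \<cdot>\<^sub>m unit_mat r p a" r]
  have e: "(\<Sum>p<r. (B $$ (p, q) \<cdot>\<^sub>m unit_mat r p a) $$ (i, j)) = (B * unit_mat r q a) $$ (i, j)" if "i < r" "j < r" for i j
  proof -
    have "(\<Sum>p<r. (B $$ (p, q) \<cdot>\<^sub>m unit_mat r p a) $$ (i, j)) = (\<Sum>p<r. if p = i then (if j = a then B $$ (i, q) else 0) else 0)"
      using that by (intro sum.cong) (auto simp: unit_mat_def)
    then show ?thesis using that by (simp add: sum.delta mult_unit_mat_entry[OF B _ _ q])
  qed
  show ?thesis
    by (rule eq_matI) (use B F e in auto)
qed

lemma unit_mat_mult_right:
  fixes B :: "'k::field mat"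
  assumes B: "B \<in> carrier_mat r r" and q: "q < r"
  shows "unit_mat r a q * B = finsum (matrix_space r) (\<lambda>p. B $$ (q, p) \<cdot>\<^sub>m unit_mat r a p) {..<r}"
proof -
  note F = finsum_matrix[of "{..<r}" "\<lambda>p. B $$ (q, p) \<cdot>\<^sub>m unit_mat r a p" r]
  have e: "(\<Sum>p<r. (B $$ (q, p) \<cdot>\<^sub>m unit_mat r a p) $$ (i, j)) = (unit_mat r a q * B) $$ (i, j)" if "i < r" "j < r" for i j
  proof -
    have "(\<Sum>p<r. (B $$ (q, p) \<cdot>\<^sub>m unit_mat r a p) $$ (i, j)) = (\<Sum>p<r. if p = j then (if i = a then B $$ (q, j) else 0) else 0)"
      using that by (intro sum.cong) (auto simp: unit_mat_def)
    then show ?thesis using that by (simp add: sum.delta unit_mat_mult_entry[OF B _ _ q])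
  qed
  show ?thesis
    by (rule eq_matI) (use B F e in auto)
qed

text \<open>This product arises when the last face brings the inserted E_1q in front of the product
  B E_q1. Summed over q it gives trace(B) E_11, the matrix part of inclusion after trace.\<close>

lemma unit_mat_sandwich:
  fixes B :: "'k::field mat"
  assumes B: "B \<in> carrier_mat r r" and q: "q < r"
  shows "unit_mat r 0 q * (B * unit_mat r q 0) = B $$ (q, q) \<cdot>\<^sub>m E11 r"
proof (rule eq_matI)
  have BE: "B * unit_mat r q 0 \<in> carrier_mat r r" using B by (rule mult_carrier_mat) simp
  fix i j assume "i < dim_row (B $$ (q, q) \<cdot>\<^sub>m E11 r :: 'k mat)" "j < dim_col (B $$ (q, q) \<cdot>\<^sub>m E11 r :: 'k mat)"
  then have ij: "i < r" "j < r" by (simp_all add: E11_def)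
  then show "(unit_mat r 0 q * (B * unit_mat r q 0)) $$ (i, j) = (B $$ (q, q) \<cdot>\<^sub>m E11 r) $$ (i, j)"
    unfolding unit_mat_mult_entry[OF BE ij q] mult_unit_mat_entry[OF B q ij(2) q] by (simp add: E11_def)
qed (use B in \<open>auto simp: unit_mat_def E11_def\<close>)

lemma sum_unit_mat: "finsum (matrix_space r) (\<lambda>q. unit_mat r q q :: 'k::field mat) {..<r} = 1\<^sub>m r"
proof (rule eq_matI)
  note F = finsum_matrix[of "{..<r}" "\<lambda>q. unit_mat r q q :: 'k mat" r]
  fix i j assume "i < dim_row (1\<^sub>m r :: 'k mat)" "j < dim_col (1\<^sub>m r :: 'k mat)"
  then have ij: "i < r" "j < r" by simp_all
  have "(\<Sum>q<r. (unit_mat r q q :: 'k mat) $$ (i, j)) = (\<Sum>q<r. if q = i then (if i = j then 1 else 0) else 0)"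
    using ij by (intro sum.cong) (auto simp: unit_mat_def)
  also have "\<dots> = (if i = j then 1 else 0)" using ij by (simp add: sum.delta)
  finally show "finsum (matrix_space r) (\<lambda>q. unit_mat r q q :: 'k mat) {..<r} $$ (i, j) = 1\<^sub>m r $$ (i, j)"
    using F(2) ij by simp
qed (use finsum_matrix(1)[of "{..<r}" "\<lambda>q. unit_mat r q q :: 'k mat" r] in auto)

text \<open>This makes \<open>d\<^sub>j h\<^sub>j = d\<^sub>j h\<^sub>j\<^sub>-\<^sub>1\<close>.\<close>

lemma bilinear_unit_mat_swap:
  fixes G :: "'k::field mat \<Rightarrow> 'k mat \<Rightarrow> 'w"
  assumes G: "bilinear_map (matrix_space r) (matrix_space r) W G" and W: "vspace W"
    and B: "B \<in> carrier_mat r r"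
  shows "finsum W (\<lambda>q. G (B * unit_mat r q 0) (unit_mat r 0 q)) {..<r}
    = finsum W (\<lambda>q. G (unit_mat r q 0) (unit_mat r 0 q * B)) {..<r}"
proof -
  interpret W: vectorspace class_ring W by (rule W)
  note g = bilinear_mapD[OF G, unfolded module_mat_simps]
  \<comment> \<open>Expanding in matrix units turns either side into the double sum of B_pq G(E_p1,
    E_1q); the two sides differ by the order of summation.\<close>
  have l: "G (B * unit_mat r q 0) (unit_mat r 0 q)
      = finsum W (\<lambda>p. B $$ (p, q) \<odot>\<^bsub>W\<^esub> G (unit_mat r p 0) (unit_mat r 0 q)) {..<r}" if q: "q < r" for q
  proof -
    have "G (B * unit_mat r q 0) (unit_mat r 0 q)
        = finsum W (\<lambda>p. G (B $$ (p, q) \<cdot>\<^sub>m unit_mat r p 0) (unit_mat r 0 q)) {..<r}"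
      unfolding mult_unit_mat[OF B q]
      by (rule lin_finsum_apply[OF g(2)]) (auto simp: module_mat_simps)
    then show ?thesis using linD(5)[OF g(2)] by (simp add: module_mat_simps)
  qed
  have r: "G (unit_mat r q 0) (unit_mat r 0 q * B)
      = finsum W (\<lambda>p. B $$ (q, p) \<odot>\<^bsub>W\<^esub> G (unit_mat r q 0) (unit_mat r 0 p)) {..<r}" if q: "q < r" for q
  proof -
    have "G (unit_mat r q 0) (unit_mat r 0 q * B)
        = finsum W (\<lambda>p. G (unit_mat r q 0) (B $$ (q, p) \<cdot>\<^sub>m unit_mat r 0 p)) {..<r}"
      unfolding unit_mat_mult_right[OF B q]
      by (rule lin_finsum_apply[OF g(1)]) (auto simp: module_mat_simps)
    then show ?thesis using linD(5)[OF g(1)] by (simp add: module_mat_simps)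
  qed
  have c: "B $$ (p, q) \<odot>\<^bsub>W\<^esub> G (unit_mat r p 0) (unit_mat r 0 q) \<in> carrier W" for p q
    by (intro vspaceD(5)[OF W] g(3)) simp_all
  have "finsum W (\<lambda>q. G (B * unit_mat r q 0) (unit_mat r 0 q)) {..<r}
    = finsum W (\<lambda>q. finsum W (\<lambda>p. B $$ (p, q) \<odot>\<^bsub>W\<^esub> G (unit_mat r p 0) (unit_mat r 0 q)) {..<r}) {..<r}"
    by (rule W.module.M.finsum_cong') (use c in \<open>auto simp: l intro!: W.module.M.finsum_closed\<close>)
  also have "\<dots> = finsum W (\<lambda>p. finsum W (\<lambda>q. B $$ (p, q) \<odot>\<^bsub>W\<^esub> G (unit_mat r p 0) (unit_mat r 0 q)) {..<r}) {..<r}"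
    by (rule finsum_swap[OF W]) (use c in auto)
  also have "\<dots> = finsum W (\<lambda>q. G (unit_mat r q 0) (unit_mat r 0 q * B)) {..<r}"
  proof (rule W.module.M.finsum_cong')
    fix q assume "q \<in> {..<r}"
    then show "finsum W (\<lambda>p. B $$ (q, p) \<odot>\<^bsub>W\<^esub> G (unit_mat r q 0) (unit_mat r 0 p)) {..<r}
      = G (unit_mat r q 0) (unit_mat r 0 q * B)" using r by simp
  next
    show "(\<lambda>q. G (unit_mat r q 0) (unit_mat r 0 q * B)) \<in> {..<r} \<rightarrow> carrier W"
      using B by (auto intro!: g(3) mult_carrier_mat[of _ r r _ r])
  qed simp
  finally show ?thesis .
qed

section \<open>Insertion of an identity and the maps h_j\<close>

definition insert_obj :: "nat \<Rightarrow> 'o list \<Rightarrow> 'o list" where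
  "insert_obj j Xs = map (\<lambda>k. if k \<le> j then Xs ! k else if k = Suc j then Xs ! (Suc j mod length Xs)
     else Xs ! (k - 1)) [0..<Suc (length Xs)]"

lemma length_insert_obj [simp]: "length (insert_obj j Xs) = Suc (length Xs)"
  by (simp add: insert_obj_def)

lemma nth_insert_obj: "k \<le> length Xs \<Longrightarrow> insert_obj j Xs ! k =
    (if k \<le> j then Xs ! k else if k = Suc j then Xs ! (Suc j mod length Xs) else Xs ! (k - 1))"
  by (simp add: insert_obj_def del: upt_Suc)

text \<open>The inserted object is the source of f^j, so f^j keeps its morphism space and the new
  slot holds endomorphisms. For j = n that source is X_0, which is why indices are read modulo the
  length.\<close>

lemma hom_at_insert:
  assumes "length Xs = Suc n" "j \<le> n" "k \<le> Suc n"
  shows "hom_at D (insert_obj j Xs) k = (if k \<le> j then hom_at D Xs k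
    else if k = Suc j then Hom D (Xs ! (Suc j mod Suc n)) (Xs ! (Suc j mod Suc n)) else hom_at D Xs (k - 1))"
proof -
  consider "k < j" | "k = j" | "k = Suc j" | "Suc j < k" by linarith
  then show ?thesis
  proof cases
    case 4
    then obtain k' where "k = Suc k'" by (cases k) auto
    then show ?thesis using assms 4
      by (auto simp: hom_at_eq[of _ n] hom_at_eq[of _ "Suc n"] nth_insert_obj)
  qed (use assms in \<open>auto simp: hom_at_eq[of _ n] hom_at_eq[of _ "Suc n"] nth_insert_obj\<close>)
qed

text \<open>The \<open>q\<close>-th summand of \<open>h\<^sub>j\<close>; matrix indices start at \<open>0\<close>, so \<open>E\<^sub>q\<^sub>1\<close> is \<open>unit_mat r q 0\<close>.\<close>

definition insert_pair ::
  "('o, 'k::field, 'f, 'h) H_cat \<Rightarrow> nat \<Rightarrow> nat \<Rightarrow> nat \<Rightarrow> 'o list \<Rightarrow> ('f \<times> 'k mat) list \<Rightarrow> ('f \<times> 'k mat) list" where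
  "insert_pair D r j q Xs ps = map (\<lambda>k.
     if k = 0 then (fst (ps ! 0), mat_prod r (take (Suc j) (map snd ps)) * unit_mat r q 0)
     else if k \<le> j then (fst (ps ! k), E11 r)
     else if k = Suc j then (Ident D (Xs ! (Suc j mod length Xs)), unit_mat r 0 q)
     else ps ! (k - 1)) [0..<Suc (length ps)]"

lemma length_insert_pair [simp]: "length (insert_pair D r j q Xs ps) = Suc (length ps)"
  by (simp add: insert_pair_def)

lemma nth_insert_pair: "k \<le> length ps \<Longrightarrow> insert_pair D r j q Xs ps ! k =
    (if k = 0 then (fst (ps ! 0), mat_prod r (take (Suc j) (map snd ps)) * unit_mat r q 0)
     else if k \<le> j then (fst (ps ! k), E11 r)
     else if k = Suc j then (Ident D (Xs ! (Suc j mod length Xs)), unit_mat r 0 q)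
     else ps ! (k - 1))"
  by (simp add: insert_pair_def del: upt_Suc)

text \<open>\<open>act_ident\<close> is stated for the inverse antipode of \<open>a\<close>, since
  that is the element which the last face lets act on the inserted identity.\<close>

locale matrix_homotopy = matrix_chains M D H S \<rho> r
  for M :: "('k::field, 'm) module" and D :: "('o, 'k, 'f, 'h) H_cat"
    and H :: "('k, 'h) module" and S :: "'h \<Rightarrow> 'h" and \<rho> :: "'m \<Rightarrow> ('h \<times> 'm \<Rightarrow>\<^sub>0 'k) set" and r +
  fixes \<epsilon> :: "'h \<Rightarrow> 'k"
  assumes r: "1 \<le> r"
    and ident: "X \<in> Obj D \<Longrightarrow> Ident D X \<in> carrier (Hom D X X)"
    and ident_left: "\<lbrakk>X \<in> Obj D; Y \<in> Obj D; f \<in> carrier (Hom D X Y)\<rbrakk> \<Longrightarrow> Comp D X Y Y (Ident D Y) f = f"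
    and ident_right: "\<lbrakk>X \<in> Obj D; Y \<in> Obj D; f \<in> carrier (Hom D X Y)\<rbrakk> \<Longrightarrow> Comp D X X Y f (Ident D X) = f"
    and act_ident: "\<lbrakk>X \<in> Obj D; a \<in> carrier H\<rbrakk> \<Longrightarrow>
      Act D X X (inv_into (carrier H) S a) (Ident D X) = \<epsilon> a \<odot>\<^bsub>Hom D X X\<^esub> Ident D X"
    and counit: "m \<in> carrier M \<Longrightarrow> lin_ext M (\<lambda>(a, m0). \<epsilon> a \<odot>\<^bsub>M\<^esub> m0) (\<rho> m) = m"
begin

lemma mat_prod_take: "(Xs, ps) \<in> pair_basis n \<Longrightarrow> mat_prod r (take j (map snd ps)) \<in> carrier_mat r r"
  using snd_carrier set_take_subset[of j "map snd ps"] by (intro mat_prod_carrier) blast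

lemma insert_basis:
  assumes b: "(Xs, ps) \<in> pair_basis n" and j: "j \<le> n"
  shows "(insert_obj j Xs, insert_pair D r j q Xs ps) \<in> pair_basis (Suc n)"
proof -
  note b' = pair_basisD[OF b]
  have "Suc j mod Suc n \<le> n" by (simp add: less_Suc_eq_le[symmetric])
  note O = b'(4)[OF this]
  have "insert_obj j Xs ! k \<in> Obj D" if "k \<le> Suc n" for k
    using that b'(1) j O by (auto simp: nth_insert_obj intro!: b'(4))
  then have "set (insert_obj j Xs) \<subseteq> Obj D"
    using b'(1) by (auto simp: in_set_conv_nth less_Suc_eq_le)
  moreover have "insert_pair D r j q Xs ps ! k \<in> carrier (hom_at D (insert_obj j Xs) k) \<times> carrier_mat r r"
    if "k \<le> Suc n" for k
    using that b'(1,2) b'(5)[of k] b'(5)[of "k - 1"] b'(6)[of "k - 1"] j ident[OF O] mult_carrier_mat[OF mat_prod_take[OF b] unit_mat_carrier]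
    by (auto simp: nth_insert_pair hom_at_insert E11_eq mem_Times_iff)
  ultimately show ?thesis using b'(1,2) by (simp add: pair_basis_def)
qed

text \<open>A pure chain is linear in the tensor in its slot j, and a pure tensor is bilinear in its
  two components.\<close>

lemma P_slot:
  assumes m: "m \<in> carrier M" and b: "(Xs, qs) \<in> pair_basis k" and j: "j \<le> k"
  shows "bilinear_map (hom_at D Xs j) N (MC.C k) (\<lambda>f B. P k m Xs (qs[j := (f, B)]))"
proof -
  interpret T: tensor_pair "hom_at D Xs j" N by (rule tensor_hom[OF b j])
  have eq: "tens_list Xs (qs[j := (f, B)]) = (tens_list Xs qs)[j := tens (hom_at D Xs j) N f B]" for f B
    using pair_basisD(1,2)[OF b] j by (auto intro!: nth_equalityI simp: nth_tens_list nth_list_update)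
  have l: "lin (tensor (hom_at D Xs j) N) (MC.C k) (\<lambda>t. pure_chain M MC k m (Xs, (tens_list Xs qs)[j := t]))"
    by (rule MC.lin_pure_slot[OF m tens_list_basis[OF b] j]) (simp add: lin_id[OF T.vspace_tensor])
  show ?thesis unfolding eq bilinear_map_def
    by (intro conjI ballI lin_comp[OF bilinear_mapD(1)[OF T.tens_bilinear] l]
        lin_comp[OF bilinear_mapD(2)[OF T.tens_bilinear] l])
qed

text \<open>The place where slot i goes depends on i. Beyond j the whole pair moves to slot i + 1.
  Up to j its matrix joins the prefix product in slot 0 while its morphism stays in slot i, so for 0
  < i \<le> j the two components part.\<close>

lemma insert_bilinear:
  assumes m: "m \<in> carrier M" and b: "(Xs, ps) \<in> pair_basis n" and j: "j \<le> n" and i: "i \<le> n"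
  shows "bilinear_map (hom_at D Xs i) N (MC.C (Suc n))
    (\<lambda>f B. P (Suc n) m (insert_obj j Xs) (insert_pair D r j q Xs (ps[i := (f, B)])))"
proof -
  note b' = pair_basisD[OF b]
  note ib = insert_basis[OF b j, of q]
  let ?qs = "insert_pair D r j q Xs ps" and ?Bs = "take (Suc j) (map snd ps)"
  have Bs: "set ?Bs \<subseteq> carrier_mat r r" using snd_carrier[OF b] set_take_subset[of "Suc j" "map snd ps"] by blast
  have lp: "lin N N (\<lambda>B. mat_prod r (?Bs[i := B]) * unit_mat r q 0)" if "i \<le> j"
    by (rule lin_comp[OF lin_mat_prod_update[OF Bs] lin_mat_mult_right]) (use that b'(2) i j in simp_all)
  have E: "E11 r \<in> carrier N" by (simp add: E11_eq)
  consider "i = 0" | "0 < i" "i \<le> j" | "j < i" by linarith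
  then show ?thesis
  proof cases
    case 1
    have eq: "insert_pair D r j q Xs (ps[i := (f, B)])
        = ?qs[0 := (f, mat_prod r (?Bs[i := B]) * unit_mat r q 0)]" for f B
      using 1 b'(1,2) j by (auto intro!: nth_equalityI simp: nth_insert_pair nth_list_update map_update take_update_swap)
    have h: "hom_at D Xs i = hom_at D (insert_obj j Xs) 0" using 1 b'(1) j by (simp add: hom_at_insert)
    have "i \<le> j" using 1 by simp
    then show ?thesis unfolding eq h
      by (rule bilinear_map_comp[OF P_slot[OF m ib le0] lin_id[OF vspace_hom[OF ib le0]] lp])
  next
    \<comment> \<open>Morphism and matrix now sit in different slots, so each is varied with the
      other held fixed, and the two updates commute.\<close>
    case 2
    have eq: "insert_pair D r j q Xs (ps[i := (f, B)])
        = ?qs[0 := (fst (ps ! 0), mat_prod r (?Bs[i := B]) * unit_mat r q 0), i := (f, E11 r)]" for f B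
      using 2 b'(1,2) j by (auto intro!: nth_equalityI simp: nth_insert_pair nth_list_update map_update take_update_swap)
    have h: "hom_at D Xs i = hom_at D (insert_obj j Xs) i" "hom_at D Xs 0 = hom_at D (insert_obj j Xs) 0"
      using 2 b'(1) j by (simp_all add: hom_at_insert)
    have f0: "fst (ps ! 0) \<in> carrier (hom_at D (insert_obj j Xs) 0)" using b'(5)[of 0] h by simp
    show ?thesis unfolding eq bilinear_map_def
    proof (intro conjI ballI)
      fix B assume B: "B \<in> carrier N"
      have "(insert_obj j Xs, ?qs[0 := (fst (ps ! 0), mat_prod r (?Bs[i := B]) * unit_mat r q 0)]) \<in> pair_basis (Suc n)"
        using linD(3)[OF lp B] 2 f0 by (intro pair_basis_update[OF ib]) simp
      from bilinear_mapD(2)[OF P_slot[OF m this, of i] E]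
      show "lin (hom_at D Xs i) (MC.C (Suc n)) (\<lambda>f. P (Suc n) m (insert_obj j Xs)
          (?qs[0 := (fst (ps ! 0), mat_prod r (?Bs[i := B]) * unit_mat r q 0), i := (f, E11 r)]))"
        using i h by simp
    next
      fix f assume f: "f \<in> carrier (hom_at D Xs i)"
      have "(insert_obj j Xs, ?qs[i := (f, E11 r)]) \<in> pair_basis (Suc n)"
        using f h E by (intro pair_basis_update[OF ib]) simp
      from lin_comp[OF lp bilinear_mapD(1)[OF P_slot[OF m this, of 0] f0]]
      show "lin N (MC.C (Suc n)) (\<lambda>B. P (Suc n) m (insert_obj j Xs)
          (?qs[0 := (fst (ps ! 0), mat_prod r (?Bs[i := B]) * unit_mat r q 0), i := (f, E11 r)]))"
        using 2 list_update_swap[of 0 i ?qs] by simp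
    qed
  next
    case 3
    have eq: "insert_pair D r j q Xs (ps[i := (f, B)]) = ?qs[Suc i := (f, B)]" for f B
    proof (rule nth_equalityI)
      fix k assume "k < length (insert_pair D r j q Xs (ps[i := (f, B)]))"
      then show "insert_pair D r j q Xs (ps[i := (f, B)]) ! k = ?qs[Suc i := (f, B)] ! k"
        using 3 b'(1,2) i j
        by (cases k) (auto simp: nth_insert_pair nth_list_update map_update take_update_cancel)
    qed simp
    have "hom_at D Xs i = hom_at D (insert_obj j Xs) (Suc i)" using 3 i b'(1) j by (simp add: hom_at_insert)
    then show ?thesis unfolding eq using P_slot[OF m ib, of "Suc i"] i by simp
  qed
qed

definition homotopy_term where
  "homotopy_term n j m Xs ps =
    finsum (MC.C (Suc n)) (\<lambda>q. P (Suc n) m (insert_obj j Xs) (insert_pair D r j q Xs ps)) {..<r}"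

definition homotopy where
  "homotopy n j = chain_ext (MC.C (Suc n)) (\<lambda>m Xs. multi_ext (MC.C (Suc n)) (homotopy_term n j m Xs))"

text \<open>Each summand is bilinear in every pair by \<open>insert_bilinear\<close>, and finite
  sums over q preserve this.\<close>

lemma homotopy:
  assumes j: "j \<le> n"
  shows "lin (MC.C n) (MC.C (Suc n)) (homotopy n j)"
    and "m \<in> carrier M \<Longrightarrow> (Xs, ps) \<in> pair_basis n \<Longrightarrow> homotopy n j (P n m Xs ps) = homotopy_term n j m Xs ps"
proof -
  note V = MC.vspace_chain_space[of "Suc n"]
  have b: "bilinear_map (hom_at D Xs i) N (MC.C (Suc n)) (\<lambda>f B. homotopy_term n j m Xs (ps[i := (f, B)]))"
    if m: "m \<in> carrier M" and b: "(Xs, ps) \<in> pair_basis n" and i: "i \<le> n" for m Xs ps i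
    unfolding homotopy_term_def bilinear_map_def
    by (intro conjI ballI lin_finsum V N vspace_hom[OF b i] finite_lessThan
        bilinear_mapD(1)[OF insert_bilinear[OF m b j i]] bilinear_mapD(2)[OF insert_bilinear[OF m b j i]])
  have l: "lin M (MC.C (Suc n)) (\<lambda>m. homotopy_term n j m Xs ps)" if b: "(Xs, ps) \<in> pair_basis n" for Xs ps
    unfolding homotopy_term_def
    by (intro lin_finsum V M finite_lessThan MC.lin_pure_coeff tens_list_basis insert_basis[OF b j])
  show "lin (MC.C n) (MC.C (Suc n)) (homotopy n j)"
    unfolding homotopy_def by (rule MC_ext(1)[OF V b l])
  show "homotopy n j (P n m Xs ps) = homotopy_term n j m Xs ps"
    if "m \<in> carrier M" "(Xs, ps) \<in> pair_basis n"
    unfolding homotopy_def by (rule MC_ext(2)[OF V b l that])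
qed

end

section \<open>Faces of object lists after an insertion\<close>

lemma face_obj_insert_lower:
  assumes "length Xs = Suc (Suc n)" "i \<le> j" "j \<le> n"
  shows "face_obj i (insert_obj (Suc j) Xs) = insert_obj j (face_obj i Xs)"
proof (rule nth_equalityI)
  fix k assume "k < length (face_obj i (insert_obj (Suc j) Xs))"
  then have k: "k < Suc (Suc n)" using assms by simp
  show "face_obj i (insert_obj (Suc j) Xs) ! k = insert_obj j (face_obj i Xs) ! k"
    using assms k by (cases k; cases "j = n") (auto simp: nth_face_obj nth_insert_obj)
qed (use assms in simp)

lemma face_obj_insert_upper:
  assumes "length Xs = Suc (Suc n)" "j < i" "i \<le> n"
  shows "face_obj (Suc i) (insert_obj j Xs) = insert_obj j (face_obj i Xs)"
proof (rule nth_equalityI)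
  fix k assume "k < length (face_obj (Suc i) (insert_obj j Xs))"
  then have k: "k < Suc (Suc n)" using assms by simp
  show "face_obj (Suc i) (insert_obj j Xs) ! k = insert_obj j (face_obj i Xs) ! k"
    using assms k by (cases k) (auto simp: nth_face_obj nth_insert_obj)
qed (use assms in simp)

lemma last_obj_insert:
  assumes "length Xs = Suc (Suc n)" "j \<le> n"
  shows "last_obj (Suc (Suc n)) (insert_obj j Xs) = insert_obj j (last_obj (Suc n) Xs)"
proof (rule nth_equalityI)
  fix k assume "k < length (last_obj (Suc (Suc n)) (insert_obj j Xs))"
  then have k: "k < Suc (Suc n)" using assms by simp
  show "last_obj (Suc (Suc n)) (insert_obj j Xs) ! k = insert_obj j (last_obj (Suc n) Xs) ! k"
    using assms k by (cases k; cases "j = n") (auto simp: nth_last_obj nth_insert_obj)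
qed (use assms in simp)

text \<open>The inserted object is a copy of its successor, so removing either of the two restores
  the list. For j = n the successor is X_0 at the front, and its removal belongs to the last
  face.\<close>

lemma face_obj_insert_same:
  assumes "length Xs = Suc n" "j \<le> n"
  shows "face_obj j (insert_obj j Xs) = Xs"
    and "j < n \<Longrightarrow> face_obj (Suc j) (insert_obj j Xs) = Xs"
proof -
  show "face_obj j (insert_obj j Xs) = Xs"
  proof (rule nth_equalityI)
    fix k assume "k < length (face_obj j (insert_obj j Xs))"
    then show "face_obj j (insert_obj j Xs) ! k = Xs ! k"
      using assms by (auto simp: nth_face_obj nth_insert_obj)
  qed (use assms in simp)
  show "face_obj (Suc j) (insert_obj j Xs) = Xs" if "j < n"
  proof (rule nth_equalityI)
    fix k assume "k < length (face_obj (Suc j) (insert_obj j Xs))"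
    then show "face_obj (Suc j) (insert_obj j Xs) ! k = Xs ! k"
      using assms that by (cases "k = Suc j") (auto simp: nth_face_obj nth_insert_obj)
  qed (use assms that in simp)
qed

lemma last_obj_insert_same:
  assumes "length Xs = Suc n"
  shows "last_obj (Suc n) (insert_obj n Xs) = Xs"
proof (rule nth_equalityI)
  fix k assume "k < length (last_obj (Suc n) (insert_obj n Xs))"
  then show "last_obj (Suc n) (insert_obj n Xs) ! k = Xs ! k"
    using assms by (auto simp: nth_last_obj nth_insert_obj)
qed (use assms in simp)

section \<open>Faces of lists of pairs after an insertion\<close>

context matrix_homotopy
begin

lemma mult_E11_right: "A \<in> carrier_mat r r \<Longrightarrow> A * unit_mat r q 0 * E11 r = A * unit_mat r q 0"
  using r by (simp add: assoc_mult_mat[of _ r r _ r _ r] E11_eq unit_mat_mult)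

lemma E11_mult: "E11 r * unit_mat r 0 q = unit_mat r 0 q"
  using r by (simp add: E11_eq unit_mat_mult)

text \<open>The summand of d_i h_(j+1) = h_j d_i: the merge takes place before the inserted
  identity, where matrices other than the prefix product are E_11, and it leaves the prefix product
  unchanged.\<close>

lemma pair_face_insert_lower:
  assumes b: "(Xs, ps) \<in> pair_basis (Suc n)" and ij: "i \<le> j" "j \<le> n"
  shows "pair_face (Suc n) i (insert_obj (Suc j) Xs) (insert_pair D r (Suc j) q Xs ps)
    = insert_pair D r j q (face_obj i Xs) (pair_face n i Xs ps)" (is "?L = ?R")
proof -
  note b' = pair_basisD[OF b]
  have comp_eq: "inner_comp (Suc n) i (insert_obj (Suc j) Xs) = inner_comp n i Xs"
    using b'(1) ij by (cases "i = j"; cases "j = n") (auto simp: nth_insert_obj)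
  \<comment> \<open>After the merge the prefix is one entry shorter, so j + 1 merged factors
    correspond to j + 2 original ones.\<close>
  have prod: "mat_prod r (take (Suc j) (map snd (pair_face n i Xs ps))) = mat_prod r (take (Suc (Suc j)) (map snd ps))"
  proof -
    let ?Bs = "take (Suc (Suc j)) (map snd ps)"
    have "take (Suc j) (map snd (pair_face n i Xs ps)) = face_mor i (?Bs ! i * ?Bs ! Suc i) ?Bs"
      using b'(2) ij by (auto intro!: nth_equalityI simp: nth_face_mor)
    moreover have "set ?Bs \<subseteq> carrier_mat r r"
      using snd_carrier[OF b] set_take_subset[of "Suc (Suc j)" "map snd ps"] by blast
    ultimately show ?thesis using mat_prod_merge[of ?Bs r i] b'(2) ij by simp
  qed
  have Y: "face_obj i Xs ! (Suc j mod Suc n) = Xs ! (Suc (Suc j) mod Suc (Suc n))"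
    using b'(1) ij by (cases "j = n") (auto simp: nth_face_obj)
  note E = mult_E11_right[OF mat_prod_take[OF b]]
  show ?thesis
  proof (rule nth_equalityI)
    fix k assume "k < length ?L"
    then have k: "k < Suc (Suc n)" using b'(2) ij by simp
    consider "k < i" | "k = i" | "i < k" by linarith
    then show "?L ! k = ?R ! k"
    proof cases
      case 1
      then show ?thesis using k b'(1,2) ij
        by (auto simp: nth_face_mor nth_insert_pair prod Y)
    next
      \<comment> \<open>In the merged slot the matrices multiply as E_q1 E_11 = E_q1 for i = 0 and
        as E_11 E_11 = E_11 otherwise.\<close>
      case 2
      then show ?thesis using k b'(1,2) ij comp_eq prod
        by (auto simp: nth_face_mor nth_insert_pair E E11_mult[of 0, folded E11_eq])
    next
      case 3
      then show ?thesis using k b'(1,2) ij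
        by (cases k) (auto simp: nth_face_mor nth_insert_pair prod Y)
    qed
  qed (use b' ij in simp)
qed

text \<open>The summand of d_(i+1) h_j = h_j d_i: the merge takes place behind the inserted identity
  and does not touch the prefix product.\<close>

lemma pair_face_insert_upper:
  assumes b: "(Xs, ps) \<in> pair_basis (Suc n)" and ij: "j < i" "i \<le> n"
  shows "pair_face (Suc n) (Suc i) (insert_obj j Xs) (insert_pair D r j q Xs ps)
    = insert_pair D r j q (face_obj i Xs) (pair_face n i Xs ps)" (is "?L = ?R")
proof -
  note b' = pair_basisD[OF b]
  have comp_eq: "inner_comp (Suc n) (Suc i) (insert_obj j Xs) = inner_comp n i Xs"
    using b'(1) ij by (cases "i = n") (auto simp: nth_insert_obj)
  have prod: "take (Suc j) (map snd (pair_face n i Xs ps)) = take (Suc j) (map snd ps)"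
    using b'(2) ij by (auto intro!: nth_equalityI simp: nth_face_mor)
  have Y: "face_obj i Xs ! (Suc j mod Suc n) = Xs ! (Suc j mod Suc (Suc n))"
    using b'(1) ij by (auto simp: nth_face_obj)
  show ?thesis
  proof (rule nth_equalityI)
    fix k assume "k < length ?L"
    then have k: "k < Suc (Suc n)" using b'(2) ij by simp
    show "?L ! k = ?R ! k"
      using k b'(1,2) ij comp_eq Y by (cases k) (auto simp: nth_face_mor nth_insert_pair prod)
  qed (use b' ij in simp)
qed

text \<open>As j \<le> n, the last pair lies behind the insertion and is carried over intact. Its
  matrix multiplies the prefix product from the left, whether before or after the insertion, and
  \<open>a\<close> acts on the same morphism.\<close>

lemma pair_last_insert:
  assumes b: "(Xs, ps) \<in> pair_basis (Suc n)" and j: "j \<le> n"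
  shows "pair_last (Suc n) a (insert_obj j Xs) (insert_pair D r j q Xs ps)
    = insert_pair D r j q (last_obj (Suc n) Xs) (pair_last n a Xs ps)" (is "?L = ?R")
proof -
  note b' = pair_basisD[OF b]
  have comp_eq: "last_comp (Suc n) a (insert_obj j Xs) f g = last_comp n a Xs f g" for f g
    using b'(1) j by (cases "j = 0") (auto simp: nth_insert_obj)
  have c: "snd (ps ! Suc n) \<in> carrier_mat r r" "snd (ps ! 0) \<in> carrier_mat r r" using b'(6) by simp_all
  obtain p0 ps' where ps: "ps = p0 # ps'" using b'(2) by (cases ps) auto
  have s: "set (take j (map snd ps')) \<subseteq> carrier_mat r r"
    using snd_carrier[OF b] set_take_subset[of j "map snd ps'"] by (auto simp: ps)
  have "take (Suc j) (map snd (pair_last n a Xs ps)) = snd (ps ! Suc n) * snd (ps ! 0) # take j (map snd ps')"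
    using b'(2) j by (auto simp: last_mor_def ps map_butlast take_butlast)
  then have prod: "mat_prod r (take (Suc j) (map snd (pair_last n a Xs ps))) * unit_mat r q 0
      = snd (ps ! Suc n) * (mat_prod r (take (Suc j) (map snd ps)) * unit_mat r q 0)"
    using c mat_prod_carrier[OF s] by (simp add: ps assoc_mult_mat[of _ r r _ r _ r])
  have Y: "last_obj (Suc n) Xs ! (Suc j mod Suc n) = Xs ! (Suc j mod Suc (Suc n))"
    using b'(1) j by (cases "j = n") (auto simp: nth_last_obj)
  show ?thesis
  proof (rule nth_equalityI)
    fix k assume "k < length ?L"
    then have k: "k < Suc (Suc n)" using b'(2) j by simp
    show "?L ! k = ?R ! k"
      using k b'(1,2) j comp_eq[of "fst (ps ! Suc n)" "fst (ps ! 0)"] prod Y by (cases k) (auto simp: nth_last_mor nth_insert_pair)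
  qed (use b' j in simp)
qed

text \<open>The shape common to d_(j+1) h_(j+1) and d_(j+1) h_j: all morphisms are the original
  ones, and the two terms differ in the matrices \<open>u\<close> and \<open>v\<close>
  alone.\<close>

definition diag_pair :: "nat \<Rightarrow> 'k mat \<Rightarrow> 'k mat \<Rightarrow> ('f \<times> 'k mat) list \<Rightarrow> ('f \<times> 'k mat) list" where
  "diag_pair j u v ps = map (\<lambda>k. if k = 0 then (fst (ps ! 0), u) else if k \<le> j then (fst (ps ! k), E11 r)
     else if k = Suc j then (fst (ps ! k), v) else ps ! k) [0..<length ps]"

lemma length_diag_pair [simp]: "length (diag_pair j u v ps) = length ps"
  by (simp add: diag_pair_def)

lemma nth_diag_pair: "k < length ps \<Longrightarrow> diag_pair j u v ps ! k =
    (if k = 0 then (fst (ps ! 0), u) else if k \<le> j then (fst (ps ! k), E11 r)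
     else if k = Suc j then (fst (ps ! k), v) else ps ! k)"
  by (simp add: diag_pair_def)

lemma diag_pair_bilinear:
  assumes m: "m \<in> carrier M" and b: "(Xs, ps) \<in> pair_basis n" and j: "j < n"
  shows "bilinear_map N N (MC.C n) (\<lambda>u v. P n m Xs (diag_pair j u v ps))"
proof -
  note b' = pair_basisD[OF b]
  \<comment> \<open>The zero matrices hold the places of slots 0 and j + 1 until the updates
    overwrite them.\<close>
  define qs where "qs = diag_pair j (0\<^sub>m r r) (0\<^sub>m r r) ps"
  have qb: "(Xs, qs) \<in> pair_basis n"
    using b' by (auto simp: qs_def pair_basis_def nth_diag_pair E11_eq mem_Times_iff)
  have eq: "diag_pair j u v ps = qs[0 := (fst (ps ! 0), u), Suc j := (fst (ps ! Suc j), v)]" for u v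
  proof (rule nth_equalityI)
    fix k assume "k < length (diag_pair j u v ps)"
    then show "diag_pair j u v ps ! k = qs[0 := (fst (ps ! 0), u), Suc j := (fst (ps ! Suc j), v)] ! k"
      using b'(2) j by (cases "k = 0"; cases "k = Suc j") (simp_all add: nth_diag_pair qs_def)
  qed (simp add: qs_def)
  have eq': "diag_pair j u v ps = qs[Suc j := (fst (ps ! Suc j), v), 0 := (fst (ps ! 0), u)]" for u v
    unfolding eq by (rule list_update_swap) simp
  have f: "fst (ps ! 0) \<in> carrier (hom_at D Xs 0)" "fst (ps ! Suc j) \<in> carrier (hom_at D Xs (Suc j))"
    using b'(5) j by simp_all
  show ?thesis unfolding bilinear_map_def
  proof (intro conjI ballI)
    fix u assume u: "u \<in> carrier N"
    have "(Xs, qs[0 := (fst (ps ! 0), u)]) \<in> pair_basis n"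
      using u f by (intro pair_basis_update[OF qb]) simp
    from bilinear_mapD(1)[OF P_slot[OF m this, of "Suc j"] f(2)]
    show "lin N (MC.C n) (\<lambda>v. P n m Xs (diag_pair j u v ps))" using j unfolding eq by simp
  next
    fix v assume v: "v \<in> carrier N"
    have "(Xs, qs[Suc j := (fst (ps ! Suc j), v)]) \<in> pair_basis n"
      using v f by (intro pair_basis_update[OF qb]) simp
    from bilinear_mapD(1)[OF P_slot[OF m this, of 0] f(1)]
    show "lin N (MC.C n) (\<lambda>u. P n m Xs (diag_pair j u v ps))" unfolding eq' by simp
  qed
qed

lemma hom_objects:
  assumes b: "(Xs, ps) \<in> pair_basis n" and j: "j \<le> n"
  shows "Xs ! (Suc j mod Suc n) \<in> Obj D" "Xs ! j \<in> Obj D"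
    "fst (ps ! j) \<in> carrier (Hom D (Xs ! (Suc j mod Suc n)) (Xs ! j))"
proof -
  note b' = pair_basisD[OF b]
  have "Suc j mod Suc n \<le> n" by (simp add: less_Suc_eq_le[symmetric])
  then show "Xs ! (Suc j mod Suc n) \<in> Obj D" "Xs ! j \<in> Obj D" using b'(4) j by blast+
  show "fst (ps ! j) \<in> carrier (Hom D (Xs ! (Suc j mod Suc n)) (Xs ! j))"
    using b'(5)[OF j] b'(1) by (simp add: hom_at_def)
qed

text \<open>The inserted identity is absorbed by f^(j+1), in the first case from the right, with
  E_11 E_1q = E_1q, and in the second from the left. The matrix B^(j+1) is then in \<open>u\<close>
  the first time and in \<open>v\<close> the second.\<close>

lemma pair_face_insert_diag:
  assumes b: "(Xs, ps) \<in> pair_basis n" and j: "j < n"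
  shows "pair_face n (Suc j) (insert_obj (Suc j) Xs) (insert_pair D r (Suc j) q Xs ps)
    = diag_pair j (mat_prod r (take (Suc (Suc j)) (map snd ps)) * unit_mat r q 0) (unit_mat r 0 q) ps"
      (is "?L1 = ?R1")
    and "pair_face n (Suc j) (insert_obj j Xs) (insert_pair D r j q Xs ps)
    = diag_pair j (mat_prod r (take (Suc j) (map snd ps)) * unit_mat r q 0)
        (unit_mat r 0 q * snd (ps ! Suc j)) ps" (is "?L2 = ?R2")
proof -
  note b' = pair_basisD[OF b]
  have "Suc j \<le> n" using j by simp
  note O = hom_objects[OF b this]
  note O' = hom_objects[OF b less_imp_le[OF j]]
  have comp1: "inner_comp n (Suc j) (insert_obj (Suc j) Xs) (fst (ps ! Suc j)) (Ident D (Xs ! (Suc (Suc j) mod Suc n)))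
      = fst (ps ! Suc j)"
    using b'(1) j ident_right[OF O] by (cases "Suc j = n") (auto simp: nth_insert_obj)
  have comp2: "inner_comp n (Suc j) (insert_obj j Xs) (Ident D (Xs ! (Suc j mod Suc n))) (fst (ps ! Suc j))
      = fst (ps ! Suc j)"
    using b'(1) j ident_left[OF O] by (cases "Suc j = n") (auto simp: nth_insert_obj)
  show "?L1 = ?R1"
  proof (rule nth_equalityI)
    fix k assume "k < length ?L1"
    then have k: "k < Suc n" using b'(2) j by simp
    show "?L1 ! k = ?R1 ! k"
      using k b'(1,2) j comp1 by (cases k) (auto simp: nth_face_mor nth_insert_pair nth_diag_pair E11_mult)
  qed (use b' j in simp)
  show "?L2 = ?R2"
  proof (rule nth_equalityI)
    fix k assume "k < length ?L2"
    then have k: "k < Suc n" using b'(2) j by simp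
    show "?L2 ! k = ?R2 ! k"
      using k b'(1,2) j comp2 by (cases k) (auto simp: nth_face_mor nth_insert_pair nth_diag_pair)
  qed (use b' j in simp)
qed

text \<open>The identity disappears into f^0, and the matrices become B^0 E_q1 E_1q = B^0
  E_qq.\<close>

lemma pair_face_insert_first:
  assumes b: "(Xs, ps) \<in> pair_basis n" and q: "q < r"
  shows "pair_face n 0 (insert_obj 0 Xs) (insert_pair D r 0 q Xs ps)
    = ps[0 := (fst (ps ! 0), snd (ps ! 0) * unit_mat r q q)]" (is "?L = ?R")
proof -
  note b' = pair_basisD[OF b]
  note O = hom_objects[OF b, of 0, OF le0]
  have comp: "inner_comp n 0 (insert_obj 0 Xs) (fst (ps ! 0)) (Ident D (Xs ! (Suc 0 mod Suc n))) = fst (ps ! 0)"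
    using b'(1) ident_right[OF O] by (cases "n = 0") (auto simp: nth_insert_obj)
  obtain p0 ps' where ps: "ps = p0 # ps'" using b'(2) by (cases ps) auto
  have c: "snd p0 \<in> carrier_mat r r" using b'(6)[of 0] by (simp add: ps)
  have prod: "mat_prod r (take (Suc 0) (map snd ps)) * unit_mat r q 0 * unit_mat r 0 q = snd (ps ! 0) * unit_mat r q q"
    using c q by (simp add: ps assoc_mult_mat[of _ r r _ r _ r] unit_mat_mult right_mult_one_mat[of _ r r])
  show ?thesis
  proof (rule nth_equalityI)
    fix k assume "k < length ?L"
    then have k: "k < Suc n" using b'(2) by simp
    show "?L ! k = ?R ! k"
      using k b'(1,2) comp prod by (cases k) (auto simp: nth_face_mor nth_insert_pair)
  qed (use b' in simp)
qed

text \<open>Here the last face acts on the inserted identity, which contributes the scalar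
  \<epsilon>(a), while the matrices form the product treated in \<open>unit_mat_sandwich\<close>.
  All remaining slots already carry E_11.\<close>

lemma pair_last_insert_last:
  assumes b: "(Xs, ps) \<in> pair_basis n" and q: "q < r" and a: "a \<in> carrier H"
  shows "pair_last n a (insert_obj n Xs) (insert_pair D r n q Xs ps)
    = (pair_E11 (map fst ps))[0 := (\<epsilon> a \<odot>\<^bsub>hom_at D Xs 0\<^esub> fst (ps ! 0),
        mat_prod r (map snd ps) $$ (q, q) \<cdot>\<^sub>m E11 r)]" (is "?L = ?R")
proof -
  note b' = pair_basisD[OF b]
  note O = hom_objects[OF b, of 0, OF le0]
  have "last_comp n a (insert_obj n Xs) (Ident D (Xs ! 0)) (fst (ps ! 0))
      = Comp D (Xs ! (Suc 0 mod Suc n)) (Xs ! 0) (Xs ! 0) (\<epsilon> a \<odot>\<^bsub>Hom D (Xs ! 0) (Xs ! 0)\<^esub> Ident D (Xs ! 0)) (fst (ps ! 0))"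
    using b'(1) act_ident[OF O(2) a] by (cases "n = 0") (auto simp: nth_insert_obj)
  also have "\<dots> = \<epsilon> a \<odot>\<^bsub>hom_at D Xs 0\<^esub> fst (ps ! 0)"
    using linD(5)[OF bilinear_mapD(2)[OF comp[OF O(1,2,2)] O(3)] ident[OF O(2)], of "\<epsilon> a"] ident_left[OF O] b'(1)
    by (simp add: hom_at_def)
  finally have comp: "last_comp n a (insert_obj n Xs) (Ident D (Xs ! 0)) (fst (ps ! 0)) = \<dots>" .
  have prod: "unit_mat r 0 q * (mat_prod r (map snd ps) * unit_mat r q 0) = mat_prod r (map snd ps) $$ (q, q) \<cdot>\<^sub>m E11 r"
    by (rule unit_mat_sandwich[OF mat_prod_carrier[OF snd_carrier[OF b]] q])
  have nth: "insert_pair D r n q Xs ps ! Suc n = (Ident D (Xs ! 0), unit_mat r 0 q)"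
    "insert_pair D r n q Xs ps ! 0 = (fst (ps ! 0), mat_prod r (map snd ps) * unit_mat r q 0)"
    using b'(1,2) by (simp_all add: nth_insert_pair)
  show ?thesis unfolding nth fst_conv snd_conv comp prod
  proof (rule nth_equalityI)
    fix k assume "k < length (last_mor (\<epsilon> a \<odot>\<^bsub>hom_at D Xs 0\<^esub> fst (ps ! 0),
        mat_prod r (map snd ps) $$ (q, q) \<cdot>\<^sub>m E11 r) (insert_pair D r n q Xs ps))"
    then have k: "k < Suc n" using b'(2) by simp
    then show "last_mor (\<epsilon> a \<odot>\<^bsub>hom_at D Xs 0\<^esub> fst (ps ! 0),
        mat_prod r (map snd ps) $$ (q, q) \<cdot>\<^sub>m E11 r) (insert_pair D r n q Xs ps) ! k = ?R ! k"
      using b'(1,2) by (cases k) (auto simp: nth_last_mor nth_insert_pair)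
  qed (use b' in simp)
qed

end

lemma finsum_smult_left:
  assumes W: "vspace W" and w: "w \<in> carrier W" and "finite A"
  shows "finsum W (\<lambda>i. c i \<odot>\<^bsub>W\<^esub> w) A = sum c A \<odot>\<^bsub>W\<^esub> w"
proof -
  interpret W: vectorspace class_ring W by (rule W)
  show ?thesis using assms(3)
    by (induction A rule: finite_induct) (simp_all add: W.module.M.finsum_insert vspaceD(2,5,7)[OF W w])
qed

section \<open>The presimplicial identities\<close>

context matrix_homotopy
begin

lemma inner_homotopy_term:
  assumes m: "m \<in> carrier M" and b: "(Xs, ps) \<in> pair_basis n" and j: "j \<le> n" and i: "i \<le> n"
  shows "MC.fc (Suc n) i (homotopy_term n j m Xs ps) = finsum (MC.C n)
    (\<lambda>q. P n m (face_obj i (insert_obj j Xs)) (pair_face n i (insert_obj j Xs) (insert_pair D r j q Xs ps))) {..<r}"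
proof -
  interpret W: vectorspace class_ring "MC.C n" by (rule MC.vspace_chain_space)
  note ib = insert_basis[OF b j]
  have "MC.fc (Suc n) i (homotopy_term n j m Xs ps)
    = finsum (MC.C n) (\<lambda>q. MC.fc (Suc n) i (P (Suc n) m (insert_obj j Xs) (insert_pair D r j q Xs ps))) {..<r}"
    unfolding homotopy_term_def
    by (rule lin_finsum_apply[OF MC.lin_face]) (auto intro!: P_closed[OF m ib])
  also have "\<dots> = finsum (MC.C n)
    (\<lambda>q. P n m (face_obj i (insert_obj j Xs)) (pair_face n i (insert_obj j Xs) (insert_pair D r j q Xs ps))) {..<r}"
    unfolding face_inner[OF i] MC_inner_face[OF m ib i] ..
  finally show ?thesis .
qed

text \<open>Holds for each q separately, by the identities for the two lists.\<close>

lemma homotopy_lower: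
  assumes ij: "i \<le> j" "j \<le> n" and x: "x \<in> carrier (MC.C (Suc n))"
  shows "MC.fc (Suc (Suc n)) i (homotopy (Suc n) (Suc j) x) = homotopy n j (MC.fc (Suc n) i x)"
proof -
  have j': "Suc j \<le> Suc n" and i': "i \<le> Suc n" and i: "i \<le> n" using ij by simp_all
  show ?thesis
  proof (rule lin_MC_eqI[OF lin_comp[OF homotopy(1)[OF j'] MC.lin_face] lin_comp[OF MC.lin_face homotopy(1)[OF ij(2)]] _ x])
    fix m Xs ps assume m: "m \<in> carrier M" and b: "(Xs, ps) \<in> pair_basis (Suc n)"
    show "MC.fc (Suc (Suc n)) i (homotopy (Suc n) (Suc j) (P (Suc n) m Xs ps))
      = homotopy n j (MC.fc (Suc n) i (P (Suc n) m Xs ps))"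
      unfolding homotopy(2)[OF j' m b] inner_homotopy_term[OF m b j' i'] face_inner[OF i] MC_inner_face[OF m b i]
        homotopy(2)[OF ij(2) m pair_face_basis[OF b i]] pair_face_insert_lower[OF b ij]
        face_obj_insert_lower[OF pair_basisD(1)[OF b] ij]
      unfolding homotopy_term_def ..
  qed
qed

lemma homotopy_upper:
  assumes ij: "j < i" "i \<le> n" and x: "x \<in> carrier (MC.C (Suc n))"
  shows "MC.fc (Suc (Suc n)) (Suc i) (homotopy (Suc n) j x) = homotopy n j (MC.fc (Suc n) i x)"
proof -
  have j: "j \<le> n" and j': "j \<le> Suc n" and i': "Suc i \<le> Suc n" using ij by simp_all
  show ?thesis
  proof (rule lin_MC_eqI[OF lin_comp[OF homotopy(1)[OF j'] MC.lin_face] lin_comp[OF MC.lin_face homotopy(1)[OF j]] _ x])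
    fix m Xs ps assume m: "m \<in> carrier M" and b: "(Xs, ps) \<in> pair_basis (Suc n)"
    show "MC.fc (Suc (Suc n)) (Suc i) (homotopy (Suc n) j (P (Suc n) m Xs ps))
      = homotopy n j (MC.fc (Suc n) i (P (Suc n) m Xs ps))"
      unfolding homotopy(2)[OF j' m b] inner_homotopy_term[OF m b j' i'] face_inner[OF ij(2)] MC_inner_face[OF m b ij(2)]
        homotopy(2)[OF j m pair_face_basis[OF b ij(2)]] pair_face_insert_upper[OF b ij]
        face_obj_insert_upper[OF pair_basisD(1)[OF b] ij]
      unfolding homotopy_term_def ..
  qed
qed

lemma last_homotopy_term:
  assumes m: "m \<in> carrier M" and b: "(Xs, ps) \<in> pair_basis n" and j: "j \<le> n"
  shows "last_face H S M \<rho> MC (Suc n) (homotopy_term n j m Xs ps) = finsum (MC.C n) (\<lambda>q.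
    lin_ext (MC.C n) (\<lambda>(a, m0). P n m0 (last_obj (Suc n) (insert_obj j Xs))
      (pair_last n a (insert_obj j Xs) (insert_pair D r j q Xs ps))) (\<rho> m)) {..<r}"
proof -
  note ib = insert_basis[OF b j]
  have "last_face H S M \<rho> MC (Suc n) (homotopy_term n j m Xs ps)
    = finsum (MC.C n) (\<lambda>q. last_face H S M \<rho> MC (Suc n) (P (Suc n) m (insert_obj j Xs) (insert_pair D r j q Xs ps))) {..<r}"
    unfolding homotopy_term_def
    by (rule lin_finsum_apply[OF MC.last_face(1)]) (auto intro!: P_closed[OF m ib])
  then show ?thesis unfolding MC_last_face[OF m ib] .
qed

text \<open>The two sides sum over q and over the coaction in opposite orders. After
  \<open>lin_ext_finsum\<close> exchanges the sums, \<open>pair_last_insert\<close> identifies the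
  summands.\<close>

lemma homotopy_upper_last:
  assumes j: "j \<le> n" and x: "x \<in> carrier (MC.C (Suc n))"
  shows "MC.fc (Suc (Suc n)) (Suc (Suc n)) (homotopy (Suc n) j x)
    = homotopy n j (MC.fc (Suc n) (Suc n) x)"
proof -
  have j': "j \<le> Suc n" using j by simp
  show ?thesis
  proof (rule lin_MC_eqI[OF lin_comp[OF homotopy(1)[OF j'] MC.lin_face] lin_comp[OF MC.lin_face homotopy(1)[OF j]] _ x])
    fix m Xs ps assume m: "m \<in> carrier M" and b: "(Xs, ps) \<in> pair_basis (Suc n)"
    interpret HM: tensor_pair H M by (rule tensor_HM)
    note R = HM.relators and \<rho>m = \<rho>_closed[OF m, unfolded tensor_def]
    note V = MC.vspace_chain_space
    let ?X = "insert_obj j (last_obj (Suc n) Xs)"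
    let ?g = "\<lambda>q a. insert_pair D r j q (last_obj (Suc n) Xs) (pair_last n a Xs ps)"
    have c: "(case y of (a, m0) \<Rightarrow> P (Suc n) m0 ?X (?g q a)) \<in> carrier (MC.C (Suc n))"
      if "y \<in> carrier H \<times> carrier M" for y q
      using that P_closed[OF _ insert_basis[OF pair_last_basis[OF b] j]] by (cases y) simp
    have c': "(case y of (a, m0) \<Rightarrow> P n m0 (last_obj (Suc n) Xs) (pair_last n a Xs ps)) \<in> carrier (MC.C n)"
      if "y \<in> carrier H \<times> carrier M" for y
      using that P_closed[OF _ pair_last_basis[OF b]] by (cases y) simp
    interpret W: vectorspace class_ring "MC.C (Suc n)" by (rule V)
    have "homotopy n j (last_face H S M \<rho> MC (Suc n) (P (Suc n) m Xs ps))
      = lin_ext (MC.C (Suc n)) (\<lambda>y. homotopy n j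
          (case y of (a, m0) \<Rightarrow> P n m0 (last_obj (Suc n) Xs) (pair_last n a Xs ps))) (\<rho> m)"
      unfolding MC_last_face[OF m b] by (rule lin_lin_ext[OF R \<rho>m homotopy(1)[OF j] c'])
    also have "\<dots> = lin_ext (MC.C (Suc n)) (\<lambda>y. finsum (MC.C (Suc n))
          (\<lambda>q. case y of (a, m0) \<Rightarrow> P (Suc n) m0 ?X (?g q a)) {..<r}) (\<rho> m)"
    proof (rule lin_ext_cong[OF R \<rho>m V])
      fix y assume "y \<in> carrier H \<times> carrier M"
      then obtain a m0 where y: "y = (a, m0)" "a \<in> carrier H" "m0 \<in> carrier M" by auto
      show "homotopy n j (case y of (a, m0) \<Rightarrow> P n m0 (last_obj (Suc n) Xs) (pair_last n a Xs ps))
        = finsum (MC.C (Suc n)) (\<lambda>q. case y of (a, m0) \<Rightarrow> P (Suc n) m0 ?X (?g q a)) {..<r}"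
        unfolding y(1) prod.case homotopy(2)[OF j y(3) pair_last_basis[OF b y(2)]] homotopy_term_def ..
    next
      fix y assume y: "y \<in> carrier H \<times> carrier M"
      show "finsum (MC.C (Suc n)) (\<lambda>q. case y of (a, m0) \<Rightarrow> P (Suc n) m0 ?X (?g q a)) {..<r} \<in> carrier (MC.C (Suc n))"
        by (rule W.module.M.finsum_closed) (use c[OF y] in blast)
    qed
    also have "\<dots> = finsum (MC.C (Suc n)) (\<lambda>q. lin_ext (MC.C (Suc n))
          (\<lambda>y. case y of (a, m0) \<Rightarrow> P (Suc n) m0 ?X (?g q a)) (\<rho> m)) {..<r}"
      by (rule lin_ext_finsum[OF R \<rho>m V finite_lessThan c])
    finally show "MC.fc (Suc (Suc n)) (Suc (Suc n)) (homotopy (Suc n) j (P (Suc n) m Xs ps))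
      = homotopy n j (MC.fc (Suc n) (Suc n) (P (Suc n) m Xs ps))"
      unfolding face_last homotopy(2)[OF j' m b] last_homotopy_term[OF m b j'] pair_last_insert[OF b j]
        last_obj_insert[OF pair_basisD(1)[OF b] j] by simp
  qed
qed

text \<open>Individual summands differ; equality holds only after summation over q.\<close>

lemma homotopy_diag:
  assumes j: "j < n" and x: "x \<in> carrier (MC.C n)"
  shows "MC.fc (Suc n) (Suc j) (homotopy n (Suc j) x) = MC.fc (Suc n) (Suc j) (homotopy n j x)"
proof -
  have j1: "Suc j \<le> n" and j0: "j \<le> n" using j by simp_all
  show ?thesis
  proof (rule lin_MC_eqI[OF lin_comp[OF homotopy(1)[OF j1] MC.lin_face] lin_comp[OF homotopy(1)[OF j0] MC.lin_face] _ x])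
    fix m Xs ps assume m: "m \<in> carrier M" and b: "(Xs, ps) \<in> pair_basis n"
    note b' = pair_basisD[OF b]
    let ?Z = "mat_prod r (take (Suc j) (map snd ps))" and ?B = "snd (ps ! Suc j)"
    let ?G = "\<lambda>u v. P n m Xs (diag_pair j u v ps)"
    have Z: "?Z \<in> carrier_mat r r" by (rule mat_prod_take[OF b])
    have B: "?B \<in> carrier_mat r r" using b'(6) j1 by simp
    have s: "set (take (Suc j) (map snd ps)) \<subseteq> carrier_mat r r"
      using snd_carrier[OF b] set_take_subset[of "Suc j" "map snd ps"] by blast
    have "take (Suc (Suc j)) (map snd ps) = take (Suc j) (map snd ps) @ [?B]"
      using b'(2) j by (simp add: take_Suc_conv_app_nth)
    then have "mat_prod r (take (Suc (Suc j)) (map snd ps)) = ?Z * ?B"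
      using s B by (simp add: mat_prod_append right_mult_one_mat[of _ r r])
    then have ZB: "mat_prod r (take (Suc (Suc j)) (map snd ps)) * unit_mat r q 0 = ?Z * (?B * unit_mat r q 0)" for q
      using Z B by (simp add: assoc_mult_mat[of _ r r _ r _ r])
    \<comment> \<open>The prefix \<open>?Z\<close> is common to both sides and is built into the
      bilinear map, so that only B^(j+1) has to pass from one argument to the other.\<close>
    have G: "bilinear_map N N (MC.C n) (\<lambda>u v. ?G (?Z * u) v)"
      by (rule bilinear_map_comp[OF diag_pair_bilinear[OF m b j] lin_mat_mult_left[OF Z] lin_id[OF N]])
    show "MC.fc (Suc n) (Suc j) (homotopy n (Suc j) (P n m Xs ps))
      = MC.fc (Suc n) (Suc j) (homotopy n j (P n m Xs ps))"
      unfolding homotopy(2)[OF j1 m b] homotopy(2)[OF j0 m b] inner_homotopy_term[OF m b j1 j1]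
        inner_homotopy_term[OF m b j0 j1] face_obj_insert_same(1)[OF b'(1) j1] face_obj_insert_same(2)[OF b'(1) j0 j]
        pair_face_insert_diag[OF b j] ZB
      by (rule bilinear_unit_mat_swap[OF G MC.vspace_chain_space B])
  qed
qed

lemma homotopy_first:
  assumes x: "x \<in> carrier (MC.C n)"
  shows "MC.fc (Suc n) 0 (homotopy n 0 x) = x"
proof (rule lin_MC_eqI[OF lin_comp[OF homotopy(1)[OF le0] MC.lin_face] lin_id[OF MC.vspace_chain_space] _ x])
  fix m Xs ps assume m: "m \<in> carrier M" and b: "(Xs, ps) \<in> pair_basis n"
  note b' = pair_basisD[OF b]
  interpret W: vectorspace class_ring "MC.C n" by (rule MC.vspace_chain_space)
  let ?g = "\<lambda>B. P n m Xs (ps[0 := (fst (ps ! 0), snd (ps ! 0) * B)])"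
  have f0: "fst (ps ! 0) \<in> carrier (hom_at D Xs 0)" and B0: "snd (ps ! 0) \<in> carrier_mat r r"
    using b'(5)[of 0] b'(6)[of 0] by simp_all
  have g: "lin N (MC.C n) ?g"
    by (rule lin_comp[OF lin_mat_mult_left[OF B0] bilinear_mapD(1)[OF P_slot[OF m b le0] f0]])
  \<comment> \<open>The q-th summand is one linear function of a matrix, evaluated at E_qq, so the
    sum is its value at the identity matrix.\<close>
  have "MC.fc (Suc n) 0 (homotopy n 0 (P n m Xs ps)) = finsum (MC.C n) (\<lambda>q. ?g (unit_mat r q q)) {..<r}"
    unfolding homotopy(2)[OF le0 m b] inner_homotopy_term[OF m b le0 le0] face_obj_insert_same(1)[OF b'(1) le0]
    by (rule W.module.M.finsum_cong') (use linD(3)[OF g] pair_face_insert_first[OF b] in auto)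
  also have "\<dots> = ?g (finsum N (\<lambda>q. unit_mat r q q) {..<r})"
    by (rule lin_finsum_apply[OF g, symmetric]) auto
  also have "\<dots> = P n m Xs ps"
    unfolding sum_unit_mat right_mult_one_mat[OF B0] by simp
  finally show "MC.fc (Suc n) 0 (homotopy n 0 (P n m Xs ps)) = P n m Xs ps" .
qed

text \<open>The scalar \<epsilon>(a) is moved from the morphism to the module element, where the
  counit axiom collapses the coaction to \<open>m\<close>. The sum of the diagonal entries over q is
  the trace.\<close>

lemma homotopy_last:
  assumes x: "x \<in> carrier (MC.C n)"
  shows "MC.fc (Suc n) (Suc n) (homotopy n n x) = inc_map M D r n (trace_map M D r n x)"
proof (rule lin_MC_eqI[OF lin_comp[OF homotopy(1)[OF order_refl] MC.lin_face] lin_comp[OF trace_map(1) inc_map(1)] _ x])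
  fix m Xs ps assume m: "m \<in> carrier M" and b: "(Xs, ps) \<in> pair_basis n"
  note b' = pair_basisD[OF b] and fb = pair_basis_fst[OF b]
  note Eb = pair_E11_basis[OF fb]
  interpret HM: tensor_pair H M by (rule tensor_HM)
  note R = HM.relators and \<rho>m = \<rho>_closed[OF m, unfolded tensor_def]
  note V = MC.vspace_chain_space[of n]
  interpret W: vectorspace class_ring "MC.C n" by (rule V)
  let ?Z = "mat_prod r (map snd ps)"
  let ?E = "\<lambda>m. P n m Xs (pair_E11 (map fst ps))"
  have lE: "lin M (MC.C n) ?E" by (rule MC.lin_pure_coeff[OF tens_list_basis[OF Eb]])
  note E = linD[OF lE]
  have f0: "fst (ps ! 0) \<in> carrier (hom_at D Xs 0)" using b'(5)[of 0] by simp
  have Er: "E11 r \<in> carrier N" by (simp add: E11_eq)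
  have h0: "vspace (hom_at D Xs 0)" by (rule vspace_hom[OF b le0])
  have E0: "(pair_E11 (map fst ps))[0 := (fst (ps ! 0), E11 r)] = pair_E11 (map fst ps)"
    using b'(2) by (cases ps) auto
  \<comment> \<open>Both scalars leave slot 0 by bilinearity: \<open>d\<close> stays in front of the
    chain, and \<open>c\<close> goes to the coefficient.\<close>
  have slot_eq: "P n m0 Xs ((pair_E11 (map fst ps))[0 := (c \<odot>\<^bsub>hom_at D Xs 0\<^esub> fst (ps ! 0), d \<cdot>\<^sub>m E11 r)])
      = d \<odot>\<^bsub>MC.C n\<^esub> ?E (c \<odot>\<^bsub>M\<^esub> m0)" if m0: "m0 \<in> carrier M" for m0 c d
  proof -
    note s = bilinear_mapD[OF P_slot[OF m0 Eb le0]]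
    have "P n m0 Xs ((pair_E11 (map fst ps))[0 := (c \<odot>\<^bsub>hom_at D Xs 0\<^esub> fst (ps ! 0), d \<cdot>\<^sub>m E11 r)])
      = d \<odot>\<^bsub>MC.C n\<^esub> P n m0 Xs ((pair_E11 (map fst ps))[0 := (c \<odot>\<^bsub>hom_at D Xs 0\<^esub> fst (ps ! 0), E11 r)])"
      by (rule linD(5)[OF s(1)[OF vspaceD(5)[OF h0 f0]] Er, unfolded module_mat_simps])
    also have "P n m0 Xs ((pair_E11 (map fst ps))[0 := (c \<odot>\<^bsub>hom_at D Xs 0\<^esub> fst (ps ! 0), E11 r)])
      = c \<odot>\<^bsub>MC.C n\<^esub> P n m0 Xs ((pair_E11 (map fst ps))[0 := (fst (ps ! 0), E11 r)])"
      by (rule linD(5)[OF s(2)[OF Er] f0])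
    also have "\<dots> = ?E (c \<odot>\<^bsub>M\<^esub> m0)" unfolding E0 by (rule E(5)[OF m0, symmetric])
    finally show ?thesis .
  qed
  have cM: "(case y of (a, m0) \<Rightarrow> \<epsilon> a \<odot>\<^bsub>M\<^esub> m0) \<in> carrier M" if "y \<in> carrier H \<times> carrier M" for y
    using that vspaceD(5)[OF M] by (cases y) simp
  have q: "lin_ext (MC.C n) (\<lambda>(a, m0). P n m0 (last_obj (Suc n) (insert_obj n Xs))
      (pair_last n a (insert_obj n Xs) (insert_pair D r n q Xs ps))) (\<rho> m) = ?Z $$ (q, q) \<odot>\<^bsub>MC.C n\<^esub> ?E m"
    if q: "q < r" for q
  proof -
    have "lin_ext (MC.C n) (\<lambda>(a, m0). P n m0 (last_obj (Suc n) (insert_obj n Xs))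
        (pair_last n a (insert_obj n Xs) (insert_pair D r n q Xs ps))) (\<rho> m)
      = lin_ext (MC.C n) (\<lambda>y. ?Z $$ (q, q) \<odot>\<^bsub>MC.C n\<^esub> ?E (case y of (a, m0) \<Rightarrow> \<epsilon> a \<odot>\<^bsub>M\<^esub> m0)) (\<rho> m)"
    proof (rule lin_ext_cong[OF R \<rho>m V])
      fix y assume y': "y \<in> carrier H \<times> carrier M"
      then obtain a m0 where y: "y = (a, m0)" "a \<in> carrier H" "m0 \<in> carrier M" by auto
      show "(case y of (a, m0) \<Rightarrow> P n m0 (last_obj (Suc n) (insert_obj n Xs))
          (pair_last n a (insert_obj n Xs) (insert_pair D r n q Xs ps)))
        = ?Z $$ (q, q) \<odot>\<^bsub>MC.C n\<^esub> ?E (case y of (a, m0) \<Rightarrow> \<epsilon> a \<odot>\<^bsub>M\<^esub> m0)"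
        unfolding y(1) prod.case last_obj_insert_same[OF b'(1)] pair_last_insert_last[OF b q y(2)] slot_eq[OF y(3)] ..
      show "?Z $$ (q, q) \<odot>\<^bsub>MC.C n\<^esub> ?E (case y of (a, m0) \<Rightarrow> \<epsilon> a \<odot>\<^bsub>M\<^esub> m0) \<in> carrier (MC.C n)"
        by (rule vspaceD(5)[OF V E(3)[OF cM[OF y']]])
    qed
    also have "\<dots> = ?Z $$ (q, q) \<odot>\<^bsub>MC.C n\<^esub> ?E (lin_ext M (\<lambda>(a, m0). \<epsilon> a \<odot>\<^bsub>M\<^esub> m0) (\<rho> m))"
      by (rule lin_lin_ext[OF R \<rho>m lin_smult[OF lE] cM, symmetric])
    finally show ?thesis unfolding counit[OF m] .
  qed
  have Em: "?E m \<in> carrier (MC.C n)" by (rule E(3)[OF m])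
  have "MC.fc (Suc n) (Suc n) (homotopy n n (P n m Xs ps))
    = finsum (MC.C n) (\<lambda>q. ?Z $$ (q, q) \<odot>\<^bsub>MC.C n\<^esub> ?E m) {..<r}"
    unfolding face_last homotopy(2)[OF order_refl m b] last_homotopy_term[OF m b order_refl]
    by (rule W.module.M.finsum_cong') (use q vspaceD(5)[OF V Em] in auto)
  also have "\<dots> = (\<Sum>q<r. ?Z $$ (q, q)) \<odot>\<^bsub>MC.C n\<^esub> ?E m"
    by (rule finsum_smult_left[OF V Em finite_lessThan])
  also have "(\<Sum>q<r. ?Z $$ (q, q)) = mat_trace ?Z"
    using mat_prod_carrier[OF snd_carrier[OF b]] by (simp add: mat_trace_def)
  also have "mat_trace ?Z \<odot>\<^bsub>MC.C n\<^esub> ?E m = inc_map M D r n (trace_map M D r n (P n m Xs ps))"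
    unfolding trace_map(2)[OF m b] linD(5)[OF inc_map(1) pure_chain_closed[OF m fb]] inc_map(2)[OF m fb] ..
  finally show "MC.fc (Suc n) (Suc n) (homotopy n n (P n m Xs ps))
    = inc_map M D r n (trace_map M D r n (P n m Xs ps))" .
qed

section \<open>The total homotopy\<close>

definition total_homotopy where
  "total_homotopy n x = finsum (MC.C (Suc n)) (\<lambda>j. (- 1) ^ j \<odot>\<^bsub>MC.C (Suc n)\<^esub> homotopy n j x) {..n}"

lemma lin_total_homotopy: "lin (MC.C n) (MC.C (Suc n)) (total_homotopy n)"
  unfolding total_homotopy_def
  by (intro lin_finsum MC.vspace_chain_space finite_atMost lin_smult homotopy(1)) simp

text \<open>Brings b h into the double sum from which \<open>presimplicial_homotopy\<close>
  starts.\<close>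

lemma boundary_total_homotopy:
  assumes x: "x \<in> carrier (MC.C n)"
  shows "MC.bd (Suc n) (total_homotopy n x) = finsum (MC.C n)
    (\<lambda>i. (- 1) ^ i \<odot>\<^bsub>MC.C n\<^esub> finsum (MC.C n)
      (\<lambda>j. (- 1) ^ j \<odot>\<^bsub>MC.C n\<^esub> MC.fc (Suc n) i (homotopy n j x)) {..n}) {..Suc n}"
proof -
  interpret W: vectorspace class_ring "MC.C n" by (rule MC.vspace_chain_space)
  note V = vspaceD(5)[OF MC.vspace_chain_space]
  have h: "homotopy n j x \<in> carrier (MC.C (Suc n))" if "j \<le> n" for j
    by (rule linD(3)[OF homotopy(1)[OF that] x])
  note f = linD(3)[OF MC.lin_face h]
  have "MC.fc (Suc n) i (total_homotopy n x)
      = finsum (MC.C n) (\<lambda>j. (- 1) ^ j \<odot>\<^bsub>MC.C n\<^esub> MC.fc (Suc n) i (homotopy n j x)) {..n}" for i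
  proof -
    have "MC.fc (Suc n) i (total_homotopy n x) = finsum (MC.C n)
      (\<lambda>j. MC.fc (Suc n) i ((- 1) ^ j \<odot>\<^bsub>MC.C (Suc n)\<^esub> homotopy n j x)) {..n}"
      unfolding total_homotopy_def by (rule lin_finsum_apply[OF MC.lin_face]) (use V h in auto)
    also have "\<dots> = finsum (MC.C n) (\<lambda>j. (- 1) ^ j \<odot>\<^bsub>MC.C n\<^esub> MC.fc (Suc n) i (homotopy n j x)) {..n}"
      by (rule W.module.M.finsum_cong') (use V f linD(5)[OF MC.lin_face h] in auto)
    finally show ?thesis .
  qed
  then show ?thesis
    unfolding MC.boundary_eq[OF linD(3)[OF lin_total_homotopy x]] by simp
qed

lemma total_homotopy_0:
  assumes x: "x \<in> carrier (MC.C 0)"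
  shows "MC.bd (Suc 0) (total_homotopy 0 x)
    = x \<ominus>\<^bsub>MC.C 0\<^esub> inc_map M D r 0 (trace_map M D r 0 x)"
proof -
  interpret W: vectorspace class_ring "MC.C 0" by (rule MC.vspace_chain_space)
  have c: "MC.fc (Suc 0) i (homotopy 0 j x) \<in> carrier (MC.C 0)" if "j \<le> 0" for i j
    by (rule linD(3)[OF MC.lin_face linD(3)[OF homotopy(1)[OF that] x]])
  have d: "MC.bd (Suc 0) (total_homotopy 0 x) \<in> carrier (MC.C 0)"
    by (rule linD(3)[OF MC.lin_boundary linD(3)[OF lin_total_homotopy x]])
  \<comment> \<open>In degree 0 there are no terms h_j d_i: the range j < 0 is empty, and zeros fill
    the place of \<open>c\<close>.\<close>
  note p = presimplicial_homotopy[OF MC.vspace_chain_space, where n = 0 and c = "\<lambda>i j. \<zero>\<^bsub>MC.C 0\<^esub>"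
      and a = "\<lambda>i j. MC.fc (Suc 0) i (homotopy 0 j x)", OF c]
  show ?thesis
    using p d unfolding boundary_total_homotopy[OF x, symmetric] homotopy_first[OF x] homotopy_last[OF x]
    by simp
qed

lemma total_homotopy_Suc:
  assumes x: "x \<in> carrier (MC.C (Suc n))"
  shows "MC.bd (Suc (Suc n)) (total_homotopy (Suc n) x)
      \<oplus>\<^bsub>MC.C (Suc n)\<^esub> total_homotopy n (MC.bd (Suc n) x)
    = x \<ominus>\<^bsub>MC.C (Suc n)\<^esub> inc_map M D r (Suc n) (trace_map M D r (Suc n) x)"
proof -
  note V = MC.vspace_chain_space
  interpret W: vectorspace class_ring "MC.C (Suc n)" by (rule V)
  have c: "homotopy n j (MC.fc (Suc n) i x) \<in> carrier (MC.C (Suc n))" if "j \<le> n" for i j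
    by (rule linD(3)[OF homotopy(1)[OF that] linD(3)[OF MC.lin_face x]])
  have c': "homotopy n j (MC.fc (Suc n) i x) \<in> carrier (MC.C (Suc n))" if "j < Suc n" for i j
    using c that by simp
  have hd: "homotopy n j (MC.bd (Suc n) x)
      = finsum (MC.C (Suc n)) (\<lambda>i. (- 1) ^ i \<odot>\<^bsub>MC.C (Suc n)\<^esub> homotopy n j (MC.fc (Suc n) i x)) {..Suc n}"
    if "j \<le> n" for j
    by (rule MC.lin_boundary_apply[OF homotopy(1)[OF that] x])
  have "total_homotopy n (MC.bd (Suc n) x) = finsum (MC.C (Suc n))
      (\<lambda>j. (- 1) ^ j \<odot>\<^bsub>MC.C (Suc n)\<^esub> finsum (MC.C (Suc n))
        (\<lambda>i. (- 1) ^ i \<odot>\<^bsub>MC.C (Suc n)\<^esub> homotopy n j (MC.fc (Suc n) i x)) {..Suc n}) {..<Suc n}"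
    unfolding total_homotopy_def lessThan_Suc_atMost
    by (rule W.module.M.finsum_cong')
      (auto simp: hd intro!: vspaceD(5)[OF V] W.module.M.finsum_closed c)
  note this[symmetric]
  moreover note boundary_total_homotopy[OF x, symmetric]
  moreover have "MC.fc (Suc (Suc n)) i (homotopy (Suc n) j x) \<in> carrier (MC.C (Suc n))"
    if "j \<le> Suc n" for i j
    by (rule linD(3)[OF MC.lin_face linD(3)[OF homotopy(1)[OF that] x]])
  \<comment> \<open>Two facts are joined here, since i \<le> n concerns inner faces and i = n + 1
    the last face.\<close>
  moreover have "MC.fc (Suc (Suc n)) (Suc i) (homotopy (Suc n) j x) = homotopy n j (MC.fc (Suc n) i x)"
    if "j < i" "i \<le> Suc n" for i j
    using that homotopy_upper[OF that(1) _ x] homotopy_upper_last[OF _ x, of j] by (cases "i \<le> n") (auto simp: le_Suc_eq)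
  ultimately show ?thesis
    using presimplicial_homotopy[OF V, where n = "Suc n" and a = "\<lambda>i j. MC.fc (Suc (Suc n)) i (homotopy (Suc n) j x)"
        and c = "\<lambda>i j. homotopy n j (MC.fc (Suc n) i x)", OF _ c'] 
      homotopy_lower[OF _ _ x] homotopy_diag[OF _ x] homotopy_first[OF x] homotopy_last[OF x]
    by simp
qed

end

section \<open>The inverse of the antipode and its counit\<close>

lemma lin_inv_into:
  assumes f: "lin V V f" and bij: "bij_betw f (carrier V) (carrier V)"
  shows "lin V V (inv_into (carrier V) f)"
proof -
  note f' = linD[OF f]
  interpret V: vectorspace class_ring V by (rule f')
  let ?g = "inv_into (carrier V) f"
  have g: "?g v \<in> carrier V" "f (?g v) = v" if "v \<in> carrier V" for v
    using bij that by (auto simp: bij_betw_def inv_into_into f_inv_into_f)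
  have gf: "?g (f v) = v" if "v \<in> carrier V" for v
    using bij that by (simp add: bij_betw_def inv_into_f_f)
  show ?thesis
  proof (rule linI[OF f'(1,1) g(1)])
    fix v w assume "v \<in> carrier V" "w \<in> carrier V"
    then show "?g (v \<oplus>\<^bsub>V\<^esub> w) = ?g v \<oplus>\<^bsub>V\<^esub> ?g w"
      using gf[of "?g v \<oplus>\<^bsub>V\<^esub> ?g w"] by (simp add: f'(4) g)
  next
    fix c v assume "v \<in> carrier V"
    then show "?g (c \<odot>\<^bsub>V\<^esub> v) = c \<odot>\<^bsub>V\<^esub> ?g v"
      using gf[of "c \<odot>\<^bsub>V\<^esub> ?g v"] by (simp add: f'(5) g vspaceD(5)[OF f'(1)])
  qed
qed

context hopf_algebra
begin

text \<open>Apply \<open>\<epsilon>\<close> to \<open>S(h\<^sub>1) h\<^sub>2 = \<epsilon>(h) 1\<close>; it is linear, and the counit axiom absorbs \<open>\<epsilon>(h\<^sub>2)\<close>.\<close>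

lemma counit_antipode:
  assumes h: "h \<in> carrier H"
  shows "\<epsilon> (S h) = \<epsilon> h"
proof -
  interpret R: ring H by (rule ring_H)
  note V = vectorspace_H
  interpret HH: tensor_pair H H by (rule tensor_pair.intro[OF V V])
  note A = linD(3)[OF coproduct_linear h, unfolded tensor_def]
  note S = linD[OF antipode_linear] and mc = bilinear_mapD(3)[OF mult_bilinear]
  \<comment> \<open>The counit takes values in the type \<open>'k\<close>, so it is treated as the
    linear map x -> \<epsilon>(x) 1 into \<open>H\<close>.\<close>
  have e: "lin H H (\<lambda>x. \<epsilon> x \<odot>\<^bsub>H\<^esub> \<one>\<^bsub>H\<^esub>)"
    by (rule lin_scale[OF V R.one_closed V counit_add counit_smult])
  have eS: "lin H H (\<lambda>x. \<epsilon> (S x) \<odot>\<^bsub>H\<^esub> \<one>\<^bsub>H\<^esub>)" by (rule lin_comp[OF antipode_linear e])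
  have "\<epsilon> h \<odot>\<^bsub>H\<^esub> \<one>\<^bsub>H\<^esub> = \<epsilon> (lin_ext H (\<lambda>(x, y). S x \<otimes>\<^bsub>H\<^esub> y) (\<Delta> h)) \<odot>\<^bsub>H\<^esub> \<one>\<^bsub>H\<^esub>"
    by (simp add: antipode_left[OF h] counit_smult counit_one)
  also have "\<dots> = lin_ext H (\<lambda>p. \<epsilon> (case p of (x, y) \<Rightarrow> S x \<otimes>\<^bsub>H\<^esub> y) \<odot>\<^bsub>H\<^esub> \<one>\<^bsub>H\<^esub>) (\<Delta> h)"
    by (rule lin_lin_ext[OF HH.relators A e]) (use S mc in auto)
  \<comment> \<open>Termwise, \<epsilon>(S(x) y) = \<epsilon>(S(x)) \<epsilon>(y) =
    \<epsilon>(S(\<epsilon>(y) x)), which is ready for the right counit axiom.\<close>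
  also have "\<dots> = lin_ext H (\<lambda>p. \<epsilon> (S (case p of (x, y) \<Rightarrow> \<epsilon> y \<odot>\<^bsub>H\<^esub> x)) \<odot>\<^bsub>H\<^esub> \<one>\<^bsub>H\<^esub>) (\<Delta> h)"
    by (rule lin_ext_cong[OF HH.relators A V])
      (auto simp: S(3,5) counit_mult counit_smult vspaceD(5)[OF V] mult.commute)
  also have "\<dots> = \<epsilon> (S (lin_ext H (\<lambda>(x, y). \<epsilon> y \<odot>\<^bsub>H\<^esub> x) (\<Delta> h))) \<odot>\<^bsub>H\<^esub> \<one>\<^bsub>H\<^esub>"
    by (rule lin_lin_ext[OF HH.relators A eS, symmetric]) (use vspaceD(5)[OF V] in auto)
  also have "\<dots> = \<epsilon> (S h) \<odot>\<^bsub>H\<^esub> \<one>\<^bsub>H\<^esub>" by (simp add: counit_right[OF h])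
  \<comment> \<open>One more application of the counit, with \<epsilon>(1) = 1, strips off the
    factor 1.\<close>
  finally have "\<epsilon> (\<epsilon> h \<odot>\<^bsub>H\<^esub> \<one>\<^bsub>H\<^esub>) = \<epsilon> (\<epsilon> (S h) \<odot>\<^bsub>H\<^esub> \<one>\<^bsub>H\<^esub>)" by simp
  then show ?thesis by (simp add: counit_smult counit_one)
qed

end

theorem proposition6p5:
  fixes H :: "('k::field_char_0, 'h) module"
    and \<Delta> :: "'h \<Rightarrow> ('h \<times> 'h \<Rightarrow>\<^sub>0 'k) set"
    and \<epsilon> :: "'h \<Rightarrow> 'k"
    and S :: "'h \<Rightarrow> 'h"
    and D :: "('o, 'k, 'f, 'h) H_cat"
    and M :: "('k, 'm) module"
    and ract :: "'m \<Rightarrow> 'h \<Rightarrow> 'm"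
    and \<rho> :: "'m \<Rightarrow> ('h \<times> 'm \<Rightarrow>\<^sub>0 'k) set"
    and r :: nat
  assumes "hopf_algebra H \<Delta> \<epsilon> S"
    and "bij_betw S (carrier H) (carrier H)"
    and "left_H_category H \<Delta> \<epsilon> S D"
    and "sayd_module H \<Delta> \<epsilon> S M ract \<rho>"
    and "1 \<le> r"
  shows "homotopy_inverses
    (chain_space M D) (hochschild_boundary H S M \<rho> D)
    (chain_space M (matrix_category r D)) (hochschild_boundary H S M \<rho> (matrix_category r D))
    (inc_map M D r) (trace_map M D r)"
proof -
  interpret C: left_H_category H \<Delta> \<epsilon> S D by fact
  interpret A: sayd_module H \<Delta> \<epsilon> S M ract \<rho> by fact
  interpret hochschild M D H S \<rho>
    by (intro hochschild.intro chains.intro hochschild_axioms.intro A.vectorspace_M C.vectorspace_H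
        C.comp_bilinear C.act_bilinear lin_inv_into C.antipode_linear assms(2) A.coaction_linear)
      (simp add: hom_spaces_def C.vectorspace_Hom)
  interpret matrix_homotopy M D H S \<rho> r \<epsilon>
  proof (intro matrix_homotopy.intro matrix_chains.intro matrix_homotopy_axioms.intro hochschild_axioms)
    fix X a assume X: "X \<in> Obj D" and a: "a \<in> carrier H"
    have "Si a \<in> carrier H" by (rule linD(3)[OF Sinv a])
    \<comment> \<open>\<open>counit_antipode\<close> is applied to the preimage of \<open>a\<close>
      under \<open>S\<close>.\<close>
    moreover have "\<epsilon> (Si a) = \<epsilon> a"
      using C.counit_antipode[OF \<open>Si a \<in> carrier H\<close>] assms(2) a by (simp add: bij_betw_def f_inv_into_f)
    ultimately show "Act D X X (Si a) (Ident D X) = \<epsilon> a \<odot>\<^bsub>Hom D X X\<^esub> Ident D X"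
      using C.act_ident[OF X] by simp
  qed (use assms(5) C.ident_closed C.comp_ident_left C.comp_ident_right A.coaction_counit in auto)
  have inc: "is_chain_map (chain_space M D) bd
      (chain_space M MC) MC.bd (inc_map M D r)"
    unfolding is_chain_map_def
    by (intro conjI allI ballI inc_map(1) boundary_commute[OF hochschild_axioms MC.hochschild_axioms inc_map(1) inc_map(1)]
        inc_face assms(5))
  have tr: "is_chain_map (chain_space M MC) MC.bd
      (chain_space M D) bd (trace_map M D r)"
    unfolding is_chain_map_def
    by (intro conjI allI ballI trace_map(1) boundary_commute[OF MC.hochschild_axioms hochschild_axioms trace_map(1) trace_map(1)]
        trace_face)
  \<comment> \<open>This composite is the identity itself, so the zero homotopy serves.\<close>
  have tr_inc: "chain_homotopic (chain_space M D) bd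
      (chain_space M D) bd (\<lambda>n x. trace_map M D r n (inc_map M D r n x)) (\<lambda>n x. x)"
    unfolding chain_homotopic_def
  proof (intro exI[of _ "\<lambda>n x. \<zero>\<^bsub>C (Suc n)\<^esub>"] conjI allI ballI)
    fix n
    show "lin (C n) (C (Suc n)) (\<lambda>x. \<zero>\<^bsub>C (Suc n)\<^esub>)" by (intro lin_zero vspace_chain_space)
  next
    fix x assume x: "x \<in> carrier (C 0)"
    interpret W: vectorspace class_ring "C 0" by (rule vspace_chain_space)
    show "trace_map M D r 0 (inc_map M D r 0 x) \<ominus>\<^bsub>C 0\<^esub> x = bd (Suc 0) \<zero>\<^bsub>C (Suc 0)\<^esub>"
      using x by (simp only: trace_inc[OF assms(5) x] linD(6)[OF lin_boundary] W.module.M.minus_eq W.module.M.r_neg)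
  next
    fix n x assume x: "x \<in> carrier (C (Suc n))"
    interpret W: vectorspace class_ring "C (Suc n)" by (rule vspace_chain_space)
    show "trace_map M D r (Suc n) (inc_map M D r (Suc n) x) \<ominus>\<^bsub>C (Suc n)\<^esub> x
      = bd (Suc (Suc n)) \<zero>\<^bsub>C (Suc (Suc n))\<^esub> \<oplus>\<^bsub>C (Suc n)\<^esub> \<zero>\<^bsub>C (Suc n)\<^esub>"
      using x by (simp add: trace_inc[OF assms(5) x] linD(6)[OF lin_boundary] W.module.M.minus_eq W.module.M.r_neg)
  qed
  \<comment> \<open>The total homotopy connects the identity minus the composite, while here the
    difference is taken the other way round; hence the factor -1.\<close>
  have inc_tr: "chain_homotopic (chain_space M MC) MC.bd
      (chain_space M MC) MC.bd (\<lambda>n x. inc_map M D r n (trace_map M D r n x)) (\<lambda>n x. x)"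
    unfolding chain_homotopic_def
  proof (intro exI[of _ "\<lambda>n x. (- 1) \<odot>\<^bsub>MC.C (Suc n)\<^esub> total_homotopy n x"] conjI allI ballI)
    fix n
    show "lin (MC.C n) (MC.C (Suc n)) (\<lambda>x. (- 1) \<odot>\<^bsub>MC.C (Suc n)\<^esub> total_homotopy n x)"
      by (rule lin_smult[OF lin_total_homotopy])
  next
    fix x assume x: "x \<in> carrier (MC.C 0)"
    interpret W: vectorspace class_ring "MC.C 0" by (rule MC.vspace_chain_space)
    have y: "inc_map M D r 0 (trace_map M D r 0 x) \<in> carrier (MC.C 0)"
      by (intro linD(3)[OF inc_map(1)] linD(3)[OF trace_map(1)] x)
    have "MC.bd (Suc 0) ((- 1) \<odot>\<^bsub>MC.C (Suc 0)\<^esub> total_homotopy 0 x)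
      = \<ominus>\<^bsub>MC.C 0\<^esub> (x \<ominus>\<^bsub>MC.C 0\<^esub> inc_map M D r 0 (trace_map M D r 0 x))"
      unfolding linD(5)[OF MC.lin_boundary linD(3)[OF lin_total_homotopy x]] total_homotopy_0[OF x]
      by (rule vspaceD(9)[OF MC.vspace_chain_space]) (use x y in simp)
    then show "inc_map M D r 0 (trace_map M D r 0 x) \<ominus>\<^bsub>MC.C 0\<^esub> x
      = MC.bd (Suc 0) ((- 1) \<odot>\<^bsub>MC.C (Suc 0)\<^esub> total_homotopy 0 x)"
      using x y by (simp add: W.module.M.minus_eq W.module.M.minus_add W.module.M.a_comm)
  next
    fix n x assume x: "x \<in> carrier (MC.C (Suc n))"
    interpret W: vectorspace class_ring "MC.C (Suc n)" by (rule MC.vspace_chain_space)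
    note V = MC.vspace_chain_space
    let ?y = "inc_map M D r (Suc n) (trace_map M D r (Suc n) x)"
    let ?p = "MC.bd (Suc (Suc n)) (total_homotopy (Suc n) x)"
    let ?q = "total_homotopy n (MC.bd (Suc n) x)"
    have y: "?y \<in> carrier (MC.C (Suc n))"
      by (intro linD(3)[OF inc_map(1)] linD(3)[OF trace_map(1)] x)
    have p: "?p \<in> carrier (MC.C (Suc n))"
      by (intro linD(3)[OF MC.lin_boundary] linD(3)[OF lin_total_homotopy] x)
    have q: "?q \<in> carrier (MC.C (Suc n))"
      by (intro linD(3)[OF MC.lin_boundary] linD(3)[OF lin_total_homotopy] x)
    have "MC.bd (Suc (Suc n)) ((- 1) \<odot>\<^bsub>MC.C (Suc (Suc n))\<^esub> total_homotopy (Suc n) x)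
        \<oplus>\<^bsub>MC.C (Suc n)\<^esub> (- 1) \<odot>\<^bsub>MC.C (Suc n)\<^esub> ?q = (- 1) \<odot>\<^bsub>MC.C (Suc n)\<^esub> (?p \<oplus>\<^bsub>MC.C (Suc n)\<^esub> ?q)"
      unfolding linD(5)[OF MC.lin_boundary linD(3)[OF lin_total_homotopy x]] by (rule vspaceD(4)[OF V p q, symmetric])
    also have "\<dots> = \<ominus>\<^bsub>MC.C (Suc n)\<^esub> (x \<ominus>\<^bsub>MC.C (Suc n)\<^esub> ?y)"
      unfolding total_homotopy_Suc[OF x] by (rule vspaceD(9)[OF V]) (use x y in simp)
    also have "\<dots> = ?y \<ominus>\<^bsub>MC.C (Suc n)\<^esub> x"
      using x y by (simp add: W.module.M.minus_eq W.module.M.minus_add W.module.M.a_comm)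
    finally show "?y \<ominus>\<^bsub>MC.C (Suc n)\<^esub> x
      = MC.bd (Suc (Suc n)) ((- 1) \<odot>\<^bsub>MC.C (Suc (Suc n))\<^esub> total_homotopy (Suc n) x)
        \<oplus>\<^bsub>MC.C (Suc n)\<^esub> (- 1) \<odot>\<^bsub>MC.C (Suc n)\<^esub> ?q" ..
  qed
  show ?thesis
    unfolding homotopy_inverses_def by (intro conjI inc tr tr_inc inc_tr)
qed

end
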